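(* Let $\gamma$ be a non-simple closed geodesic of the pair of pants $P=\mathbb D/\Gamma$ and let $L(\gamma)$ be its combinatorial length. If $L(\gamma)$ is even, then $$\frac{L(\gamma)}{2}-1\le i(\gamma;\gamma)\le \frac{L(\gamma)^2}{4},$$ and if $L(\gamma)$ is odd, then $$\frac{L(\gamma)-1}{2}\le i(\gamma;\gamma)\le\frac{L(\gamma)^2-1}{4}.$$ These bounds are sharp (equality is attained in each of them).
   Context: Setting. $\mathbb D$ is the Poincaré disk with its hyperbolic metric, $a,b$ are hyperbolic isometries of $\mathbb D$, and $\bar e$ denotes the inverse of $e$. There are four pairwise disjoint closed half-disks $D(a),D(\bar a),D(b),D(\bar b)$ of $\mathbb D$, bounded by circles orthogonal to $\mathbb S^1=\partial\mathbb D$, with $a(D(\bar a))=\mathbb D\setminus \mathring D(a)$ and $b(D(\bar b))=\mathbb D\setminus\mathring D(b)$, and the corresponding arcs $A(e)$ of $\partial\mathbb D$ occur anticlockwise in the cyclic order $A(a),A(\bar b),A(b),A(\bar a)$. The group $\Gamma=\langle a,b\rangle$ is a (free) Schottky group, $P=\mathbb D/\Gamma$ is a pair of pants, and $\mathcal D=\bigcap_{e\in\{a,\bar a,b,\bar b\}}(\mathbb D\setminus\mathring D(e))$ is a fundamental domain. Coding. An infinite reduced word $f_1f_2\cdots$ in the letters $a,\bar a,b,\bar b$ denotes the limit point $\lim_m f_1\cdots f_m(o)\in\partial\mathbb D$. Oriented closed geodesics of $P$ (multiples allowed) correspond bijectively to nonempty cyclically reduced words $e_1\cdots e_L$ up to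 cyclic permutation; $L=L(\gamma)$ is the combinatorial length. The lifts of $\gamma$ meeting $\mathcal D$ are the geodesics $\gamma_i$ ($1\le i\le L$, indices mod $L$) with positive endpoint the periodic word $e_ie_{i+1}\cdots$ and negative endpoint the periodic word $\bar e_{i-1}\bar e_{i-2}\cdots$. Self-intersection number. If the word of $\gamma$ is not a proper power, $i(\gamma;\gamma)$ is the number of equivalence classes of intersecting unordered pairs $\{\gamma_i,\gamma_j\}$, $i\ne j$, where two pairs are equivalent if some element of $\Gamma$ maps one pair onto the other. If $\gamma=\gamma_0^m$, then $i(\gamma;\gamma)=m^2\,i(\gamma_0;\gamma_0)$. A closed geodesic is non-simple if $i(\gamma;\gamma)>0$.
   Formalization: With i(γ0^m)=m² i(γ0), no non-simple closed geodesic of even length attains L/2−1, so equality in the even lower bound is claimed only for some closed geodesic of even length, possibly simple; the other three bounds are attained by non-simple ones. *)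

theory Defs
  imports "HOL-Complex_Analysis.Complex_Analysis"
begin

text \<open>The Poincare disk is \<^term>\<open>ball 0 1 :: complex set\<close>, its ideal boundary is
  \<^term>\<open>sphere 0 1 :: complex set\<close>. Isometries are orientation preserving, and only their values
  on the closed unit disk matter.\<close>

definition disk_isometry :: "(complex \<Rightarrow> complex) \<Rightarrow> bool" where
  "disk_isometry f \<longleftrightarrow> (\<exists>t w. cmod w < 1 \<and> f = Moebius_function t w)"

text \<open>A non-trivial isometry has one fixed point in the open disk (elliptic), or exactly one
  (parabolic) or exactly two (hyperbolic) fixed points on the ideal boundary. The cardinality of
  an infinite set being 0, the identity is excluded.\<close>

definition hyperbolic_isometry :: "(complex \<Rightarrow> complex) \<Rightarrow> bool" where
  "hyperbolic_isometry f \<longleftrightarrow> disk_isometry f \<and> card {z \<in> sphere 0 1. f z = z} = 2"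

text \<open>The geodesic with negative endpoint \<open>p\<close> and positive endpoint \<open>q\<close>, as a subset of the open
  disk. All isometries mapping \<open>-1\<close> to \<open>p\<close> and \<open>1\<close> to \<open>q\<close> yield the same image of the real diameter.\<close>

definition geodesic :: "complex \<Rightarrow> complex \<Rightarrow> complex set" where
  "geodesic p q = {f (of_real t) | f t. disk_isometry f \<and> f (- 1) = p \<and> f 1 = q \<and> - 1 < t \<and> t < 1}"

text \<open>For \<open>k > 0\<close> and \<open>k < 0\<close> the inequality says that \<open>z\<close> is inside, respectively outside, the circle
  with centre \<open>c = w / k\<close> and squared radius \<open>|c|^2 - 1\<close>, i.e. the circle about \<open>c\<close> orthogonal to
  the unit circle. For \<open>k = 0\<close> the bounding circle is a diameter.\<close>

definition closed_half_disk :: "complex set \<Rightarrow> bool" where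
  "closed_half_disk S \<longleftrightarrow> (\<exists>w k. \<bar>k\<bar> < cmod w \<and>
     S = {z \<in> ball 0 1. k * (1 + (cmod z)\<^sup>2) \<le> 2 * Re (cnj w * z)})"

definition boundary_arc :: "complex set \<Rightarrow> complex set" where
  "boundary_arc S = closure S \<inter> sphere 0 1"

definition anticlockwise4 ::
  "complex set \<Rightarrow> complex set \<Rightarrow> complex set \<Rightarrow> complex set \<Rightarrow> bool" where
  "anticlockwise4 A B C D \<longleftrightarrow> (\<forall>p\<in>A. \<forall>q\<in>B. \<forall>r\<in>C. \<forall>s\<in>D. \<exists>t1 t2 t3 t4.
     p = cis t1 \<and> q = cis t2 \<and> r = cis t3 \<and> s = cis t4 \<and>
     t1 < t2 \<and> t2 < t3 \<and> t3 < t4 \<and> t4 < t1 + 2 * pi)"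

datatype letter = GenA | InvA | GenB | InvB

fun bar :: "letter \<Rightarrow> letter" where
  "bar GenA = InvA"
| "bar InvA = GenA"
| "bar GenB = InvB"
| "bar InvB = GenB"

text \<open>The four isometries \<open>a\<close>, \<open>b\<close> and their inverses are given as a family \<open>g\<close> indexed by letters.
  As usual for Schottky groups, the half-disks are disjoint up to and including the ideal boundary,
  so tangencies at infinity are excluded.\<close>

definition schottky_pants ::
  "(letter \<Rightarrow> complex \<Rightarrow> complex) \<Rightarrow> (letter \<Rightarrow> complex set) \<Rightarrow> bool" where
  "schottky_pants g D \<longleftrightarrow>
     (\<forall>e. hyperbolic_isometry (g e)) \<and>
     (\<forall>e. \<forall>z\<in>cball 0 1. g (bar e) (g e z) = z) \<and>
     (\<forall>e. closed_half_disk (D e)) \<and>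
     (\<forall>e f. e \<noteq> f \<longrightarrow> closure (D e) \<inter> closure (D f) = {}) \<and>
     g GenA ` D InvA = ball 0 1 - interior (D GenA) \<and>
     g GenB ` D InvB = ball 0 1 - interior (D GenB) \<and>
     anticlockwise4 (boundary_arc (D GenA)) (boundary_arc (D InvB))
       (boundary_arc (D GenB)) (boundary_arc (D InvA))"

text \<open>The word \<open>e1, ..., en\<close> acts on the disk as the composition of \<open>g e1, ..., g en\<close>, the last letter
  acting first. The maps arising in this way from arbitrary words form the group generated by
  \<open>a\<close> and \<open>b\<close>.\<close>

definition word_act :: "(letter \<Rightarrow> complex \<Rightarrow> complex) \<Rightarrow> letter list \<Rightarrow> complex \<Rightarrow> complex" where
  "word_act g xs z = foldr g xs z"

definition limit_point :: "(letter \<Rightarrow> complex \<Rightarrow> complex) \<Rightarrow> (nat \<Rightarrow> letter) \<Rightarrow> complex" where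
  "limit_point g f = lim (\<lambda>m. word_act g (map f [0..<m]) 0)"

text \<open>An oriented closed geodesic is represented by a nonempty cyclically reduced word, determined up
  to rotation; the combinatorial length is the length of the word.\<close>

definition closed_geodesic_word :: "letter list \<Rightarrow> bool" where
  "closed_geodesic_word w \<longleftrightarrow> w \<noteq> [] \<and>
     (\<forall>i < length w. w ! (Suc i mod length w) \<noteq> bar (w ! i))"

text \<open>Indices start at 0, and the index \<open>i - 1 - k\<close> of the negative endpoint is reduced modulo the
  length as an integer.\<close>

definition lift_pos :: "(letter \<Rightarrow> complex \<Rightarrow> complex) \<Rightarrow> letter list \<Rightarrow> nat \<Rightarrow> complex" where
  "lift_pos g w i = limit_point g (\<lambda>k. w ! ((i + k) mod length w))"

definition lift_neg :: "(letter \<Rightarrow> complex \<Rightarrow> complex) \<Rightarrow> letter list \<Rightarrow> nat \<Rightarrow> complex" where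
  "lift_neg g w i =
     limit_point g (\<lambda>k. bar (w ! nat ((int i - 1 - int k) mod int (length w))))"

definition geodesic_lift :: "(letter \<Rightarrow> complex \<Rightarrow> complex) \<Rightarrow> letter list \<Rightarrow> nat \<Rightarrow> complex set" where
  "geodesic_lift g w i = geodesic (lift_neg g w i) (lift_pos g w i)"

definition intersecting_pairs ::
  "(letter \<Rightarrow> complex \<Rightarrow> complex) \<Rightarrow> letter list \<Rightarrow> complex set set set" where
  "intersecting_pairs g w =
     {{geodesic_lift g w i, geodesic_lift g w j} | i j.
        i < length w \<and> j < length w \<and> i \<noteq> j \<and>
        geodesic_lift g w i \<inter> geodesic_lift g w j \<noteq> {}}"

definition pair_equiv ::
  "(letter \<Rightarrow> complex \<Rightarrow> complex) \<Rightarrow> letter list \<Rightarrow> (complex set set \<times> complex set set) set" where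
  "pair_equiv g w = {(p, q). p \<in> intersecting_pairs g w \<and> q \<in> intersecting_pairs g w \<and>
     (\<exists>xs. (\<lambda>S. word_act g xs ` S) ` p = q)}"

definition primitive_self_intersection ::
  "(letter \<Rightarrow> complex \<Rightarrow> complex) \<Rightarrow> letter list \<Rightarrow> nat" where
  "primitive_self_intersection g w = card (intersecting_pairs g w // pair_equiv g w)"

definition word_power :: "letter list \<Rightarrow> nat \<Rightarrow> letter list" where
  "word_power u m = concat (replicate m u)"

text \<open>The largest \<open>m\<close> such that the nonempty word \<open>w\<close> is an \<open>m\<close>-th power; it is 1 iff \<open>w\<close> is not a
  proper power. The corresponding root is itself not a proper power.\<close>

definition word_exponent :: "letter list \<Rightarrow> nat" where
  "word_exponent w = (GREATEST m. \<exists>u. w = word_power u m)"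

definition word_root :: "letter list \<Rightarrow> letter list" where
  "word_root w = take (length w div word_exponent w) w"

definition self_intersection :: "(letter \<Rightarrow> complex \<Rightarrow> complex) \<Rightarrow> letter list \<Rightarrow> nat" where
  "self_intersection g w = (word_exponent w)\<^sup>2 * primitive_self_intersection g (word_root w)"

definition non_simple :: "(letter \<Rightarrow> complex \<Rightarrow> complex) \<Rightarrow> letter list \<Rightarrow> bool" where
  "non_simple g w \<longleftrightarrow> self_intersection g w > 0"

end

theory Submission
  imports Defs
begin

text \<open>The lower bound needs a drawing with at most as many crossings as there are classes.
  Instead of the points where the lifts meet the sides, \<open>pos\<close> places a strand on a side
  by weighing the code of the word ahead against the code of the word behind. Strands with a common
  word then switch their order at most once along it, so each chain is drawn with at most one
  crossing. That inequality is all the bound uses.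

  Smoothing proves \<open>2 * card E \<le> 8 * labels + crossings\<close>. In ordered pairs of ends
  a crossing counts 8; a smoothing loses at least these 8 pairs and at most one label has to be
  merged away in return. Without crossings the matching commutes with the gluing, so a component has
  at most four ends. A single geodesic has \<open>card E = 2 * L\<close> and one label.

  The upper bound only counts possible ends of chains and does not decide which of them come from
  crossings. For the extremal words one must therefore exhibit crossings and show that their classes
  differ; ping-pong does the latter, since a group element carrying one lift that meets the domain
  to another must move along the lift.\<close>

text \<open>Two lifts of a closed geodesic cross iff their endpoints are linked on the circle, and the cyclic
  order of the endpoints can be read off the infinite reduced words. The pairs of crossing lifts that
  meet the fundamental domain fall into chains, along which both lifts follow the same word; a chain
  is a self-intersection point.

  Upper bound. Since each side is crossed as often as its image, there are numbers \<open>x\<close>, \<open>p\<close>, \<open>n\<close> such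
  that \<open>x\<close> lifts join the sides \<open>GenA\<close> and \<open>GenB\<close> and \<open>x\<close> lifts join \<open>InvB\<close> and \<open>InvA\<close>; \<open>p\<close> lifts join
  \<open>GenA\<close> and \<open>InvB\<close> and \<open>p\<close> lifts join \<open>GenB\<close> and \<open>InvA\<close>; \<open>n\<close> lifts join inverse letters. Then \<open>L = n + 2 p + 2 x\<close>, and counting
  the ends of chains gives \<open>i \<le> x\<^sup>2 + 2 p x + (p + x) n = (L\<^sup>2 - n\<^sup>2) / 4 - p\<^sup>2\<close>.

  Lower bound. Draw a primitive geodesic with \<open>i\<close> crossings, all of them inside the fundamental domain,
  and smooth them one by one without creating a chord from a side to itself. This yields a simple
  multicurve with at most \<open>i + 1\<close> components, each of which crosses the sides at most twice, whence
  \<open>L \<le> 2 i + 2\<close>.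

  The bounds are attained by \<open>a a\<close>, by the powers of \<open>a\<close> times the inverse of \<open>b\<close>, and by
  \<open>a (a b)\<^sup>k\<close> and \<open>a (a c)\<^sup>k\<close> with \<open>c\<close> the inverse of \<open>b\<close>.\<close>

section \<open>Isometries and geodesics of the disk\<close>

definition su11 :: "complex \<Rightarrow> complex \<Rightarrow> complex \<Rightarrow> complex" where
  "su11 a b z = (a * z + b) / (cnj b * z + cnj a)"

text \<open>Equality is only asked on the closed disk: outside it \<open>Moebius_function\<close>
  may divide by zero, and with literal equality the class would not be closed under
  composition.\<close>

definition disk_map :: "(complex \<Rightarrow> complex) \<Rightarrow> bool" where
  "disk_map f \<longleftrightarrow> (\<exists>a b. cmod b < cmod a \<and> (\<forall>z. cmod z \<le> 1 \<longrightarrow> f z = su11 a b z))"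

lemma su11_denom:
  assumes "cmod b < cmod a" "cmod z \<le> 1"
  shows "cnj b * z + cnj a \<noteq> 0"
proof
  assume "cnj b * z + cnj a = 0"
  hence "cmod (cnj a) = cmod (cnj b * z)" by (metis add_eq_0_iff norm_minus_cancel)
  also have "\<dots> \<le> cmod b" using assms(2) by (simp add: norm_mult mult_left_le)
  finally show False using assms(1) by simp
qed

text \<open>The matrix with rows \<open>a, b\<close> and \<open>cnj b, cnj a\<close> preserves the
  Hermitian form of signature (1,1) up to its determinant; here it is applied to the vector
  \<open>z, 1\<close>.\<close>

lemma su11_numer_norm:
  "(cmod (cnj b * z + cnj a))\<^sup>2 - (cmod (a * z + b))\<^sup>2 = ((cmod a)\<^sup>2 - (cmod b)\<^sup>2) * (1 - (cmod z)\<^sup>2)"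
proof -
  have "complex_of_real ((cmod (cnj b * z + cnj a))\<^sup>2 - (cmod (a * z + b))\<^sup>2) =
        complex_of_real (((cmod a)\<^sup>2 - (cmod b)\<^sup>2) * (1 - (cmod z)\<^sup>2))"
    unfolding of_real_diff of_real_mult complex_norm_square of_real_1 by (simp add: algebra_simps)
  thus ?thesis by (simp only: of_real_eq_iff)
qed

lemma su11_norm:
  assumes "cmod b < cmod a" "cmod z \<le> 1"
  shows "1 - (cmod (su11 a b z))\<^sup>2 = ((cmod a)\<^sup>2 - (cmod b)\<^sup>2) * (1 - (cmod z)\<^sup>2) / (cmod (cnj b * z + cnj a))\<^sup>2"
proof -
  have "(cmod (cnj b * z + cnj a))\<^sup>2 \<noteq> 0" using su11_denom[OF assms] by simp
  thus ?thesis unfolding su11_numer_norm[symmetric] su11_def norm_divide power_divide by (simp add: diff_divide_distrib)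
qed

lemma disk_map_norm_lt: assumes "disk_map f" "cmod z < 1" shows "cmod (f z) < 1"
proof -
  obtain a b where ab: "cmod b < cmod a" "f z = su11 a b z" using assms by (force simp: disk_map_def)
  have "0 < 1 - (cmod (su11 a b z))\<^sup>2"
    unfolding su11_norm[OF ab(1) less_imp_le[OF assms(2)]]
    using ab su11_denom[OF ab(1) less_imp_le[OF assms(2)]] assms(2)
    by (intro divide_pos_pos mult_pos_pos) (simp_all add: power_strict_mono power_less_one_iff)
  thus ?thesis using ab by (simp add: abs_square_less_1)
qed

lemma disk_map_norm_1: assumes "disk_map f" "cmod z = 1" shows "cmod (f z) = 1"
proof -
  obtain a b where ab: "cmod b < cmod a" "f z = su11 a b z" using assms by (force simp: disk_map_def)
  have "1 - (cmod (su11 a b z))\<^sup>2 = 0"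
    using su11_norm[OF ab(1), of z] assms(2) by simp
  thus ?thesis using ab norm_ge_zero[of "su11 a b z"] by (auto simp: power2_eq_1_iff)
qed

lemma disk_map_norm_le: assumes "disk_map f" "cmod z \<le> 1" shows "cmod (f z) \<le> 1"
proof (cases "cmod z < 1")
  case True
  thus ?thesis using disk_map_norm_lt[OF assms(1)] by (simp add: less_imp_le)
next
  case False
  hence "cmod z = 1" using assms(2) by simp
  thus ?thesis using disk_map_norm_1[OF assms(1)] by simp
qed

lemma disk_map_cong: assumes "disk_map f" "\<And>z. cmod z \<le> 1 \<Longrightarrow> f z = h z" shows "disk_map h"
proof -
  obtain a b where "cmod b < cmod a" "\<And>z. cmod z \<le> 1 \<Longrightarrow> f z = su11 a b z"
    using assms(1) by (auto simp: disk_map_def)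
  hence "cmod b < cmod a \<and> (\<forall>z. cmod z \<le> 1 \<longrightarrow> h z = su11 a b z)" by (simp add: assms(2)[symmetric])
  thus ?thesis unfolding disk_map_def by blast
qed

lemma disk_map_compose:
  assumes "disk_map f" "disk_map h" shows "disk_map (\<lambda>z. f (h z))"
proof -
  obtain a b where ab: "cmod b < cmod a" "\<And>z. cmod z \<le> 1 \<Longrightarrow> f z = su11 a b z"
    using assms(1) by (auto simp: disk_map_def)
  obtain c d where cd: "cmod d < cmod c" "\<And>z. cmod z \<le> 1 \<Longrightarrow> h z = su11 c d z"
    using assms(2) by (auto simp: disk_map_def)
  \<comment> \<open>First row of the product of the two matrices; multiplicativity of the
    determinant gives \<open>cmod B < cmod A\<close>.\<close>
  define A B where "A = a * c + b * cnj d" and "B = a * d + b * cnj c"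
  have "complex_of_real ((cmod A)\<^sup>2 - (cmod B)\<^sup>2) = complex_of_real (((cmod a)\<^sup>2 - (cmod b)\<^sup>2) * ((cmod c)\<^sup>2 - (cmod d)\<^sup>2))"
    unfolding of_real_diff of_real_mult complex_norm_square A_def B_def by (simp add: algebra_simps)
  hence "(cmod A)\<^sup>2 - (cmod B)\<^sup>2 = ((cmod a)\<^sup>2 - (cmod b)\<^sup>2) * ((cmod c)\<^sup>2 - (cmod d)\<^sup>2)"
    by (simp only: of_real_eq_iff)
  also have "\<dots> > 0" using ab(1) cd(1) by (intro mult_pos_pos) (auto intro!: power_strict_mono)
  finally have lt: "cmod B < cmod A" by (simp add: power2_less_imp_less)
  have "f (h z) = su11 A B z" if z: "cmod z \<le> 1" for z
  proof -
    have hz: "cmod (h z) \<le> 1" using disk_map_norm_le[OF assms(2) z] .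
    let ?D = "cnj d * z + cnj c"
    have D: "?D \<noteq> 0" using su11_denom[OF cd(1) z] .
    have frac: "p * (n / e) + q = (p * n + q * e) / e" if "e \<noteq> 0" for p q n e :: complex
      using that by (simp add: field_simps)
    have n: "a * h z + b = (A * z + B) / ?D"
      unfolding cd(2)[OF z] su11_def A_def B_def frac[OF D] by (simp add: algebra_simps)
    have m: "cnj b * h z + cnj a = (cnj B * z + cnj A) / ?D"
      unfolding cd(2)[OF z] su11_def A_def B_def frac[OF D] by (simp add: algebra_simps)
    have "f (h z) = (a * h z + b) / (cnj b * h z + cnj a)" using ab(2)[OF hz] by (simp add: su11_def)
    also have "\<dots> = su11 A B z" unfolding n m su11_def using D by simp
    finally show ?thesis .
  qed
  thus ?thesis using lt unfolding disk_map_def by blast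
qed

lemma disk_map_id: "disk_map (\<lambda>z. z)"
  unfolding disk_map_def by (intro exI[of _ 1] exI[of _ 0]) (simp add: su11_def)

lemma disk_isometry_disk_map: assumes "disk_isometry f" shows "disk_map f"
proof -
  obtain t w where w: "cmod w < 1" "f = Moebius_function t w" using assms by (auto simp: disk_isometry_def)
  \<comment> \<open>A square root of the rotation factor makes the coefficients of numerator and
    denominator conjugate.\<close>
  define u where "u = cis (t / 2)"
  have u: "cmod u = 1" "u * cnj u = 1" "u * u = exp (\<i> * of_real t)"
    by (auto simp: u_def cis_mult cis_conv_exp[symmetric] cis_cnj)
  have "f z = su11 u (- u * w) z" for z
  proof -
    have "su11 u (- u * w) z = (u * (z - w)) / (cnj u * (1 - cnj w * z))"
      by (simp add: su11_def algebra_simps)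
    also have "\<dots> = (u * (z - w)) * u / ((cnj u * (1 - cnj w * z)) * u)"
      using u(1) by (subst mult_divide_mult_cancel_right) auto
    also have "\<dots> = (u * u) * (z - w) / ((u * cnj u) * (1 - cnj w * z))"
      by (simp add: mult_ac)
    finally show ?thesis using u w by (simp add: Moebius_function_def)
  qed
  thus ?thesis unfolding disk_map_def using w u by (intro exI[of _ u] exI[of _ "- u * w"]) (simp add: norm_mult)
qed

lemma disk_map_Moebius:
  assumes "disk_map f"
  obtains h where "disk_isometry h" "\<And>z. cmod z \<le> 1 \<Longrightarrow> f z = h z"
proof -
  obtain a b where ab: "cmod b < cmod a" "\<And>z. cmod z \<le> 1 \<Longrightarrow> f z = su11 a b z"
    using assms(1) by (auto simp: disk_map_def)
  have a0: "a \<noteq> 0" using ab by auto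
  define t w where "t = Arg (a / cnj a)" and "w = - b / a"
  have "cmod (a / cnj a) = 1" using a0 by (simp add: norm_divide)
  hence t: "exp (\<i> * of_real t) = a / cnj a" using a0 unfolding t_def
    by (metis cis_Arg cis_conv_exp complex_cnj_zero_iff divide_eq_0_iff div_by_1 of_real_1 sgn_eq)
  have w: "cmod w < 1" using ab a0 by (simp add: w_def norm_divide)
  have "f z = Moebius_function t w z" if z: "cmod z \<le> 1" for z
  proof -
    have D: "cnj b * z + cnj a \<noteq> 0" using su11_denom[OF ab(1) z] .
    have "1 - cnj w * z = (cnj b * z + cnj a) / cnj a" using a0 by (simp add: w_def field_simps)
    moreover have "z - w = (a * z + b) / a" using a0 by (simp add: w_def field_simps)
    ultimately show ?thesis unfolding ab(2)[OF z] Moebius_function_def t su11_def using a0 D by simp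
  qed
  thus ?thesis using that[of "Moebius_function t w"] w by (auto simp: disk_isometry_def)
qed

text \<open>Away from the pole of \<open>f\<close>, distances shrink by a factor of order
  \<open>1 - (cmod w)\<^sup>2\<close>. As \<open>cmod w\<close> is also the modulus of the image of
  0, this yields convergence along the group once the orbit of 0 approaches the circle.\<close>

lemma disk_map_diff:
  assumes "disk_map f" "cmod z \<le> 1" "cmod y \<le> 1"
  obtains w where "cmod w < 1" "f w = 0"
    "cmod (f z - f y) = cmod (z - y) * (1 - (cmod w)\<^sup>2) / (cmod (1 - cnj w * z) * cmod (1 - cnj w * y))"
    "cmod (f 0) = cmod w"
proof -
  obtain h where h: "disk_isometry h" "\<And>z. cmod z \<le> 1 \<Longrightarrow> f z = h z" using disk_map_Moebius[OF assms(1)] by metis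
  then obtain t w where w: "cmod w < 1" "h = Moebius_function t w" by (auto simp: disk_isometry_def)
  have nz: "1 - cnj w * z \<noteq> 0" if "cmod z \<le> 1" for z
  proof
    assume "1 - cnj w * z = 0"
    hence "cmod (cnj w * z) = 1" by (metis eq_iff_diff_eq_0 norm_one)
    moreover have "cmod (cnj w * z) \<le> cmod w" using that by (simp add: norm_mult mult_left_le)
    ultimately show False using w by simp
  qed
  have "h z - h y = exp (\<i> * of_real t) * ((z - y) * (1 - w * cnj w)) / ((1 - cnj w * z) * (1 - cnj w * y))"
    unfolding w Moebius_function_def diff_frac_eq[OF nz[OF assms(2)] nz[OF assms(3)]] by (simp add: algebra_simps)
  hence "cmod (h z - h y) = cmod (z - y) * cmod (1 - w * cnj w) / (cmod (1 - cnj w * z) * cmod (1 - cnj w * y))"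
    by (simp add: norm_mult norm_divide)
  moreover have "1 - w * cnj w = of_real (1 - (cmod w)\<^sup>2)" by (simp only: of_real_diff complex_norm_square of_real_1)
  hence "cmod (1 - w * cnj w) = 1 - (cmod w)\<^sup>2" using w(1) by (simp only: norm_of_real) (simp add: power_le_one)
  ultimately have "cmod (f z - f y) = cmod (z - y) * (1 - (cmod w)\<^sup>2) / (cmod (1 - cnj w * z) * cmod (1 - cnj w * y))"
    using h(2) assms by simp
  moreover have "f w = 0" using h(2)[of w] w by (simp add: Moebius_function_eq_zero)
  moreover have "cmod (f 0) = cmod w" using h(2)[of 0] w by (simp add: Moebius_function_of_zero norm_mult)
  ultimately show ?thesis using that w(1) by blast
qed

lemma disk_map_continuous: assumes "disk_map f" shows "continuous_on (cball 0 1) f"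
proof -
  obtain a b where ab: "cmod b < cmod a" "\<And>z. cmod z \<le> 1 \<Longrightarrow> f z = su11 a b z"
    using assms(1) by (auto simp: disk_map_def)
  have "continuous_on (cball 0 1) (su11 a b)"
    unfolding su11_def using su11_denom[OF ab(1)] by (intro continuous_intros) auto
  thus ?thesis using ab(2) by (subst continuous_on_cong[OF refl, of _ _ "su11 a b"]) auto
qed

text \<open>This is the invariance of \<open>|z - y|\<^sup>2 / ((1 - |z|\<^sup>2) (1 - |y|\<^sup>2))\<close>, multiplied out.\<close>

lemma disk_map_distortion:
  assumes "disk_map f" "cmod z < 1" "cmod y < 1"
  shows "(cmod (f z - f y))\<^sup>2 * ((1 - (cmod z)\<^sup>2) * (1 - (cmod y)\<^sup>2)) = 
         (cmod (z - y))\<^sup>2 * ((1 - (cmod (f z))\<^sup>2) * (1 - (cmod (f y))\<^sup>2))"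
proof -
  obtain a b where ab: "cmod b < cmod a" "\<And>z. cmod z \<le> 1 \<Longrightarrow> f z = su11 a b z"
    using assms(1) by (auto simp: disk_map_def)
  let ?d = "\<lambda>z. cnj b * z + cnj a"
  have d: "?d z \<noteq> 0" "?d y \<noteq> 0" using su11_denom[OF ab(1)] assms by auto
  have "f z - f y = (z - y) * (a * cnj a - b * cnj b) / (?d z * ?d y)"
  proof -
    have f: "f z = (a * z + b) / ?d z" "f y = (a * y + b) / ?d y" using ab(2) assms by (simp_all add: su11_def)
    show ?thesis unfolding f diff_frac_eq[OF d] by (simp add: algebra_simps)
  qed
  moreover have "a * cnj a - b * cnj b = of_real ((cmod a)\<^sup>2 - (cmod b)\<^sup>2)" by (simp only: of_real_diff complex_norm_square)
  ultimately have "cmod (f z - f y) = cmod (z - y) * \<bar>(cmod a)\<^sup>2 - (cmod b)\<^sup>2\<bar> / (cmod (?d z) * cmod (?d y))"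
    by (simp add: norm_mult norm_divide del: of_real_diff of_real_power)
  hence "(cmod (f z - f y))\<^sup>2 = (cmod (z - y))\<^sup>2 * ((cmod a)\<^sup>2 - (cmod b)\<^sup>2)\<^sup>2 / ((cmod (?d z))\<^sup>2 * (cmod (?d y))\<^sup>2)"
    by (simp add: power_divide power_mult_distrib)
  moreover have "1 - (cmod (f z))\<^sup>2 = ((cmod a)\<^sup>2 - (cmod b)\<^sup>2) * (1 - (cmod z)\<^sup>2) / (cmod (?d z))\<^sup>2"
    "1 - (cmod (f y))\<^sup>2 = ((cmod a)\<^sup>2 - (cmod b)\<^sup>2) * (1 - (cmod y)\<^sup>2) / (cmod (?d y))\<^sup>2"
    using ab(2)[of z] ab(2)[of y] assms su11_norm[OF ab(1)] by simp_all
  ultimately show ?thesis by (simp add: power2_eq_square)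
qed

text \<open>Twice the signed area of the triangle with these vertices: positive for three points in
  anticlockwise order on a circle.\<close>

definition orient :: "complex \<Rightarrow> complex \<Rightarrow> complex \<Rightarrow> real" where
  "orient p q r = Im (cnj (q - p) * (r - p))"

text \<open>On the circle \<open>cnj z = 1 / z\<close> turns the signed area into a product of
  differences, and disk maps change differences by simple factors.\<close>

lemma orient_sphere:
  assumes "cmod p = 1" "cmod q = 1" "cmod r = 1"
  shows "of_real (orient p q r) * (2 * \<i> * (p * q * r)) = - ((q - p) * (r - p) * (r - q))"
proof -
  have c: "cnj z = 1 / z" "z \<noteq> 0" if "cmod z = 1" for z
  proof -
    show "z \<noteq> 0" using that by auto
    have "z * cnj z = 1" using that complex_norm_square[of z] by simp
    thus "cnj z = 1 / z" using \<open>z \<noteq> 0\<close> by (simp add: nonzero_eq_divide_eq mult.commute)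
  qed
  have frac: "((1 / q - 1 / p) * (r - p) - (q - p) * (1 / r - 1 / p)) * (p * q * r) = - ((q - p) * (r - p) * (r - q))"
    if "p \<noteq> 0" "q \<noteq> 0" "r \<noteq> 0" for p q r :: complex
    using that by (simp add: field_simps)
  have "of_real (orient p q r) * (2 * \<i>) = (cnj (q - p) * (r - p)) - cnj (cnj (q - p) * (r - p))"
    unfolding orient_def complex_diff_cnj by (simp add: mult_ac)
  also have "\<dots> * (p * q * r) = - ((q - p) * (r - p) * (r - q))"
    unfolding complex_cnj_mult complex_cnj_diff complex_cnj_cnj
    unfolding c(1)[OF assms(1)] c(1)[OF assms(2)] c(1)[OF assms(3)]
    using c(2) assms by (intro frac) auto
  finally show ?thesis by (simp add: mult_ac)
qed

lemma orient_cycle: "orient p q r = orient q r p"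
  by (simp add: orient_def algebra_simps)

lemma orient_swap: "orient p q r = - orient q p r"
  by (simp add: orient_def algebra_simps)

lemma orient_nonzero:
  assumes "cmod p = 1" "cmod q = 1" "cmod r = 1" "p \<noteq> q" "q \<noteq> r" "p \<noteq> r"
  shows "orient p q r \<noteq> 0"
  using orient_sphere[OF assms(1-3)] assms(4-6) by auto

text \<open>Each difference is multiplied by \<open>K\<close> over two values of \<open>?d\<close>,
  and on the circle \<open>?n z * ?d z\<close> is a positive multiple of \<open>z\<close>.
  Altogether the orientation is multiplied by \<open>K ^ 3 / N\<close>, which is positive.\<close>

lemma orient_disk_map:
  assumes f: "disk_map f" and u: "cmod p = 1" "cmod q = 1" "cmod r = 1"
  shows "orient (f p) (f q) (f r) > 0 \<longleftrightarrow> orient p q r > 0"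
proof -
  obtain a b where ab: "cmod b < cmod a" "\<And>z. cmod z \<le> 1 \<Longrightarrow> f z = su11 a b z"
    using f by (auto simp: disk_map_def)
  let ?d = "\<lambda>z. cnj b * z + cnj a" and ?n = "\<lambda>z. a * z + b"
  have d: "?d p \<noteq> 0" "?d q \<noteq> 0" "?d r \<noteq> 0" using su11_denom[OF ab(1)] u by auto
  have nd: "?n z * ?d z = of_real ((cmod (?n z))\<^sup>2) * z" if "cmod z = 1" for z
  proof -
    have "z * cnj z = 1" using that by (simp add: complex_norm_square[symmetric])
    thus ?thesis unfolding complex_norm_square by (simp add: algebra_simps)
  qed
  have fs: "f z = ?n z / ?d z" if "cmod z = 1" for z using ab(2) that by (simp add: su11_def)
  have frac1: "(n / d - m / e) * (d * e) = n * e - m * d" if "d \<noteq> 0" "e \<noteq> 0" for n m d e :: complex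
    using that by (simp add: field_simps)
  have frac2: "(n / d * (m / e) * (k / f)) * ((d * e * f) * (d * e * f)) = (n * d) * (m * e) * (k * f)"
    if "d \<noteq> 0" "e \<noteq> 0" "f \<noteq> 0" for n m k d e f :: complex
    using that by (simp add: field_simps)
  define K where "K = (cmod a)\<^sup>2 - (cmod b)\<^sup>2"
  have K: "K > 0" using ab(1) by (simp add: K_def power_strict_mono)
  have Kc: "a * cnj a - b * cnj b = of_real K" by (simp only: of_real_diff complex_norm_square K_def)
  have df: "(f y - f z) * (?d y * ?d z) = (y - z) * of_real K" if "cmod y = 1" "cmod z = 1" "?d y \<noteq> 0" "?d z \<noteq> 0" for y z
    unfolding fs[OF that(1)] fs[OF that(2)] Kc[symmetric] frac1[OF that(3,4)] by (simp add: algebra_simps)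
  define N where "N = (cmod (?n p))\<^sup>2 * (cmod (?n q))\<^sup>2 * (cmod (?n r))\<^sup>2"
  have n0: "?n z \<noteq> 0" if "cmod z = 1" "?d z \<noteq> 0" for z
    using disk_map_norm_1[OF f that(1)] fs[OF that(1)] by auto
  have N: "N > 0" using n0 u d by (simp add: N_def)
  have fu: "cmod (f p) = 1" "cmod (f q) = 1" "cmod (f r) = 1" using disk_map_norm_1[OF f] u by auto
  let ?P = "?d p * ?d q * ?d r"
  have e1: "(f p * f q * f r) * (?P * ?P) = of_real N * (p * q * r)"
  proof -
    have "(f p * f q * f r) * (?P * ?P) = (?n p * ?d p) * (?n q * ?d q) * (?n r * ?d r)"
      unfolding fs[OF u(1)] fs[OF u(2)] fs[OF u(3)] by (rule frac2[OF d])
    thus ?thesis unfolding nd[OF u(1)] nd[OF u(2)] nd[OF u(3)] by (simp add: N_def)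
  qed
  have "of_real (orient (f p) (f q) (f r)) * (2 * \<i> * (of_real N * (p * q * r)))
    = of_real (orient (f p) (f q) (f r)) * (2 * \<i> * (f p * f q * f r)) * (?P * ?P)"
    unfolding e1[symmetric] by (simp add: mult_ac)
  also have "\<dots> = - ((f q - f p) * (f r - f p) * (f r - f q)) * (?P * ?P)"
    unfolding orient_sphere[OF fu] ..
  also have "\<dots> = - (((f q - f p) * (?d q * ?d p)) * ((f r - f p) * (?d r * ?d p)) * ((f r - f q) * (?d r * ?d q)))"
    by (simp add: mult_ac)
  also have "\<dots> = of_real (K ^ 3) * (- ((q - p) * (r - p) * (r - q)))"
    unfolding df[OF u(2,1) d(2,1)] df[OF u(3,1) d(3,1)] df[OF u(3,2) d(3,2)] by (simp add: power3_eq_cube)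
  also have "\<dots> = of_real (K ^ 3) * (of_real (orient p q r) * (2 * \<i> * (p * q * r)))"
    unfolding orient_sphere[OF u] ..
  finally have "(of_real (orient (f p) (f q) (f r)) * of_real N) * (2 * \<i> * (p * q * r)) = 
     (of_real (K ^ 3) * of_real (orient p q r)) * (2 * \<i> * (p * q * r))" by (simp add: mult_ac)
  moreover have "2 * \<i> * (p * q * r) \<noteq> 0" using u by auto
  ultimately have "complex_of_real (orient (f p) (f q) (f r)) * of_real N = of_real (K ^ 3) * of_real (orient p q r)"
    by (simp only: mult_cancel_right) simp
  hence "orient (f p) (f q) (f r) * N = K ^ 3 * orient p q r"
    by (simp only: of_real_mult[symmetric] of_real_eq_iff)
  thus ?thesis using K N by (metis zero_less_mult_iff zero_less_power mult.commute order_less_asym)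
qed

lemma orient_cis:
  "orient (cis s) (cis t) (cis u) = 4 * sin ((t - s) / 2) * sin ((u - t) / 2) * sin ((u - s) / 2)"
proof -
  define x y where "x = (t - s) / 2" and "y = (u - t) / 2"
  have t: "t = s + 2 * x" and u: "u = s + 2 * x + 2 * y" by (simp_all add: x_def y_def field_simps)
  have "orient (cis s) (cis t) (cis u) = sin (u - t) - sin (u - s) + sin (t - s)"
    by (simp add: orient_def cis.ctr sin_diff algebra_simps)
  also have "\<dots> = sin (2 * y) - sin (2 * (x + y)) + sin (2 * x)" by (simp add: t u algebra_simps)
  also have "\<dots> = 4 * sin x * sin y * sin (x + y)"
  proof -
    have "(2 * S * C + 2 * s * c - 2 * (s * C + c * S) * (c * C - s * S)) - 4 * s * S * (s * C + c * S)
      = 2 * s * c * (1 - (C * C + S * S)) + 2 * S * C * (1 - (c * c + s * s))" for s c S C :: real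
      by (simp add: algebra_simps)
    from this[of "sin y" "cos y" "sin x" "cos x"] show ?thesis
      using sin_cos_squared_add[of x] sin_cos_squared_add[of y]
      unfolding sin_double sin_add cos_add by (simp add: power2_eq_square add.commute)
  qed
  also have "x + y = (u - s) / 2" by (simp add: x_def y_def field_simps)
  finally show ?thesis by (simp add: x_def y_def)
qed

lemma orient_cis_pos:
  assumes "s < t" "t < u" "u < s + 2 * pi" shows "orient (cis s) (cis t) (cis u) > 0"
  unfolding orient_cis using assms by (intro mult_pos_pos sin_gt_zero) auto

text \<open>The passage from the Poincare model to the Klein model, in which geodesics are chords.\<close>

definition klein :: "complex \<Rightarrow> complex" where
  "klein z = 2 * z / of_real (1 + (cmod z)\<^sup>2)"

lemma klein_inj:
  assumes "cmod z < 1" "cmod y < 1" "klein z = klein y" shows "z = y"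
proof -
  let ?r = "cmod z" and ?s = "cmod y"
  have pos: "1 + ?r\<^sup>2 > 0" "1 + ?s\<^sup>2 > 0" by (simp_all add: add_pos_nonneg)
  have n: "cmod (klein w) = 2 * cmod w / (1 + (cmod w)\<^sup>2)" for w
  proof -
    have "cmod (of_real (1 + (cmod w)\<^sup>2)) = 1 + (cmod w)\<^sup>2" by (simp only: norm_of_real) simp
    thus ?thesis by (simp add: klein_def norm_divide norm_mult del: of_real_add of_real_power)
  qed
  have "2 * ?r / (1 + ?r\<^sup>2) = 2 * ?s / (1 + ?s\<^sup>2)" using n assms(3) by metis
  hence "?r * (1 + ?s\<^sup>2) = ?s * (1 + ?r\<^sup>2)" using pos by (simp add: frac_eq_eq)
  hence "(?r - ?s) * (1 - ?r * ?s) = 0" by (simp add: algebra_simps power2_eq_square)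
  moreover have "?r * ?s < 1" using assms by (metis mult_le_one less_imp_le mult_strict_mono' norm_ge_zero mult.right_neutral)
  ultimately have e: "?r = ?s" by simp
  have "2 * z / of_real (1 + ?s\<^sup>2) = 2 * y / of_real (1 + ?s\<^sup>2)" using assms(3) by (simp only: klein_def e)
  moreover have "complex_of_real (1 + ?s\<^sup>2) \<noteq> 0" using pos(2) by (simp only: of_real_eq_0_iff)
  ultimately show ?thesis by (simp del: of_real_add of_real_power)
qed

lemma klein_su11:
  assumes "cmod b < cmod a" "-1 < t" "t < 1"
  shows "klein (su11 a b (of_real t)) = 
    (of_real (1 + t) * (a + b))\<^sup>2 / of_real ((1 + t)\<^sup>2 * (cmod (a + b))\<^sup>2 + (1 - t)\<^sup>2 * (cmod (a - b))\<^sup>2)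
    - (of_real (1 - t) * (a - b))\<^sup>2 / of_real ((1 + t)\<^sup>2 * (cmod (a + b))\<^sup>2 + (1 - t)\<^sup>2 * (cmod (a - b))\<^sup>2)"
proof -
  define n d where "n = a * of_real t + b" and "d = cnj b * of_real t + cnj a"
  have d: "d \<noteq> 0" unfolding d_def using assms by (intro su11_denom) auto
  have fr: "2 * (n / d) / (1 + (n / d) * (n' / d')) = 2 * (n * d') / (d * d' + n * n')" 
    if "d \<noteq> 0" "d' \<noteq> 0" for n d n' d' :: complex
    using that by (simp add: field_simps)
  have "klein (n / d) = 2 * (n / d) / (1 + (n / d) * (cnj n / cnj d))"
    unfolding klein_def of_real_add of_real_1 complex_norm_square by simp
  also have "\<dots> = 2 * (n * cnj d) / (d * cnj d + n * cnj n)" using d by (intro fr) auto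
  also have "2 * (n * cnj d) = ((of_real (1 + t) * (a + b))\<^sup>2 - (of_real (1 - t) * (a - b))\<^sup>2) / 2"
    unfolding n_def d_def by (simp add: power2_eq_square algebra_simps)
  also have "d * cnj d + n * cnj n = (of_real ((1 + t)\<^sup>2) * ((a + b) * cnj (a + b)) + of_real ((1 - t)\<^sup>2) * ((a - b) * cnj (a - b))) / 2"
    unfolding n_def d_def by (simp add: power2_eq_square algebra_simps)
  also have "of_real ((1 + t)\<^sup>2) * ((a + b) * cnj (a + b)) + of_real ((1 - t)\<^sup>2) * ((a - b) * cnj (a - b))
     = of_real ((1 + t)\<^sup>2 * (cmod (a + b))\<^sup>2 + (1 - t)\<^sup>2 * (cmod (a - b))\<^sup>2)"
    by (simp only: of_real_add of_real_mult complex_norm_square)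
  finally show ?thesis unfolding n_def d_def su11_def by (simp add: diff_divide_distrib)
qed

text \<open>In the hyperboloid model the real point \<open>t\<close> is, up to scale, the
  combination of the null vectors of 1 and -1 with weights \<open>(1 + t)\<^sup>2\<close> and
  \<open>(1 - t)\<^sup>2\<close>. The isometry acts linearly and rescales these vectors by the
  squared moduli of \<open>a + b\<close> and \<open>a - b\<close>.\<close>

lemma klein_su11_segment:
  assumes "cmod b < cmod a" "-1 < t" "t < 1"
  defines "A \<equiv> (1 + t)\<^sup>2 * (cmod (a + b))\<^sup>2" and "B \<equiv> (1 - t)\<^sup>2 * (cmod (a - b))\<^sup>2"
  shows "klein (su11 a b (of_real t)) = (1 - A / (A + B)) *\<^sub>R su11 a b (- 1) + (A / (A + B)) *\<^sub>R su11 a b 1"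
    and "0 < A" "0 < B"
proof -
  have nz: "a + b \<noteq> 0" "a - b \<noteq> 0" using assms(1) by (auto simp: add_eq_0_iff)
  show A: "0 < A" and B: "0 < B" using assms nz by (simp_all add: A_def B_def)
  have sq: "z\<^sup>2 = of_real ((cmod z)\<^sup>2) * (z / cnj z)" if "z \<noteq> 0" for z
    unfolding complex_norm_square using that by (simp add: power2_eq_square)
  have p: "(of_real (1 - t) * (a - b))\<^sup>2 = - (of_real B * su11 a b (- 1))"
  proof -
    have "su11 a b (- 1) = - ((a - b) / cnj (a - b))" unfolding su11_def
      by (metis (no_types, lifting) add.commute complex_cnj_diff diff_conv_add_uminus minus_diff_eq minus_divide_left mult_minus1_right)
    thus ?thesis unfolding power_mult_distrib sq[OF nz(2)] B_def by simp
  qed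
  have q: "(of_real (1 + t) * (a + b))\<^sup>2 = of_real A * su11 a b 1"
  proof -
    have "su11 a b 1 = (a + b) / cnj (a + b)" by (simp add: su11_def add.commute)
    thus ?thesis unfolding power_mult_distrib sq[OF nz(1)] A_def by simp
  qed
  have "1 - A / (A + B) = B / (A + B)" using A B by (simp add: field_simps)
  thus "klein (su11 a b (of_real t)) = (1 - A / (A + B)) *\<^sub>R su11 a b (- 1) + (A / (A + B)) *\<^sub>R su11 a b 1"
    unfolding klein_su11[OF assms(1-3)] p q A_def[symmetric] B_def[symmetric]
    by (simp add: scaleR_conv_of_real mult.commute)
qed

lemma klein_diameter_image:
  assumes f: "disk_map f" and pq: "f (- 1) = p" "f 1 = q" "p \<noteq> q"
  shows "klein ` {f (of_real t) | t. - 1 < t \<and> t < 1} = open_segment p q"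
proof -
  obtain a b where ab: "cmod b < cmod a" "\<And>z. cmod z \<le> 1 \<Longrightarrow> f z = su11 a b z"
    using f by (auto simp: disk_map_def)
  have pq': "su11 a b (- 1) = p" "su11 a b 1 = q" using ab(2)[of "-1"] ab(2)[of 1] pq by auto
  have nz: "cmod (a + b) > 0" "cmod (a - b) > 0" using ab(1) by (auto simp: add_eq_0_iff)
  have ft: "f (of_real t) = su11 a b (of_real t)" if "-1 < t" "t < 1" for t
    using that by (intro ab(2)) simp
  show ?thesis
  proof (intro equalityI subsetI)
    fix y assume "y \<in> klein ` {f (of_real t) | t. - 1 < t \<and> t < 1}"
    then obtain t where t: "-1 < t" "t < 1" "y = klein (su11 a b (of_real t))" using ft by auto
    note k = klein_su11_segment[OF ab(1) t(1,2), unfolded pq']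
    show "y \<in> open_segment p q" unfolding in_segment using pq(3) k t(3)
      by (intro conjI exI[of _ "(1 + t)\<^sup>2 * (cmod (a + b))\<^sup>2 / ((1 + t)\<^sup>2 * (cmod (a + b))\<^sup>2 + (1 - t)\<^sup>2 * (cmod (a - b))\<^sup>2)"])
        (simp_all add: divide_less_eq_1 add_pos_pos)
  next
    fix y assume "y \<in> open_segment p q"
    then obtain u where u: "0 < u" "u < 1" "y = (1 - u) *\<^sub>R p + u *\<^sub>R q" by (auto simp: in_segment)
    \<comment> \<open>\<open>r\<close> stands for \<open>(1 + t) / (1 - t)\<close>; this value
      solves \<open>(1 - u) * ?A = u * ?B\<close>.\<close>
    define r where "r = sqrt (u * (cmod (a - b))\<^sup>2 / ((1 - u) * (cmod (a + b))\<^sup>2))"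
    have r2: "r\<^sup>2 = u * (cmod (a - b))\<^sup>2 / ((1 - u) * (cmod (a + b))\<^sup>2)" and r: "r > 0"
      unfolding r_def using u nz by simp_all
    define t where "t = (r - 1) / (r + 1)"
    have t: "-1 < t" "t < 1" using r by (simp_all add: t_def field_simps)
    have t1: "1 + t = 2 * r / (r + 1)" "1 - t = 2 / (r + 1)" using r by (simp_all add: t_def field_simps)
    let ?A = "(1 + t)\<^sup>2 * (cmod (a + b))\<^sup>2" and ?B = "(1 - t)\<^sup>2 * (cmod (a - b))\<^sup>2"
    have "(1 - u) * ?A = u * ?B"
    proof -
      have "(1 - u) * ?A = (2 / (r + 1))\<^sup>2 * (r\<^sup>2 * ((1 - u) * (cmod (a + b))\<^sup>2))"
        unfolding t1 by (simp add: power_divide power_mult_distrib)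
      also have "r\<^sup>2 * ((1 - u) * (cmod (a + b))\<^sup>2) = u * (cmod (a - b))\<^sup>2"
        unfolding r2 using u nz by simp
      finally show ?thesis unfolding t1 by simp
    qed
    moreover note k = klein_su11_segment[OF ab(1) t, unfolded pq']
    ultimately have "?A / (?A + ?B) = u" using add_pos_pos[OF k(2,3)] by (simp add: field_simps)
    hence "y = klein (f (of_real t))" using k(1) u(3) ft[OF t] by simp
    thus "y \<in> klein ` {f (of_real t) | t. - 1 < t \<and> t < 1}" using t by blast
  qed
qed

lemma disk_map_transitive:
  assumes "cmod p = 1" "cmod q = 1" "p \<noteq> q"
  obtains f where "disk_isometry f" "f (- 1) = p" "f 1 = q"
proof -
  \<comment> \<open>With \<open>a + b = s\<close> and \<open>a - b = d\<close> of modulus 1, the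
    images of 1 and -1 are \<open>s\<^sup>2\<close> and \<open>- d\<^sup>2\<close>, and
    \<open>(cmod a)\<^sup>2 - (cmod b)\<^sup>2\<close> is \<open>Re (s * cnj d)\<close>. This
    vanishes only for \<open>p = q\<close>, and the choice of the root \<open>d\<close> makes it
    positive.\<close>
  define s d0 where "s = csqrt q" and "d0 = csqrt (- p)"
  have s: "s\<^sup>2 = q" and d0: "d0\<^sup>2 = - p" by (simp_all add: s_def d0_def)
  have ns: "cmod s = 1" "cmod d0 = 1" using s d0 assms
    by (metis norm_minus_cancel norm_power power2_eq_1_iff norm_ge_zero neg_0_le_iff_le not_one_le_zero)+
  have "Re (s * cnj d0) \<noteq> 0"
  proof
    assume *: "Re (s * cnj d0) = 0"
    define k where "k = Im (s * cnj d0)"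
    have e: "s * cnj d0 = \<i> * of_real k" using * by (simp add: complex_eq_iff k_def)
    have "cmod (s * cnj d0) = 1" using ns by (simp add: norm_mult)
    hence "k\<^sup>2 = 1" unfolding e by (simp add: norm_mult power2_eq_1_iff abs_if split: if_splits)
    hence "(s * cnj d0)\<^sup>2 = - 1" unfolding e by (simp add: power_mult_distrib flip: of_real_power)
    hence "q * cnj (- p) = - 1" by (simp add: power_mult_distrib s flip: d0)
    hence "q * (cnj p * p) = p" by simp
    moreover have "cnj p * p = 1" using complex_norm_square[of p] assms(1) by (simp add: mult.commute)
    ultimately show False using assms(3) by simp
  qed
  then obtain d where d: "d\<^sup>2 = - p" "cmod d = 1" "Re (s * cnj d) > 0"
    using d0 ns that[of] by (cases "Re (s * cnj d0) > 0") (force, (elim meta_allE[of _ "- d0"], simp))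
  define a b where "a = (s + d) / 2" and "b = (s - d) / 2"
  have "complex_of_real ((cmod a)\<^sup>2 - (cmod b)\<^sup>2) = (s * cnj d + cnj (s * cnj d)) / 2"
    unfolding of_real_diff complex_norm_square a_def b_def by (simp add: field_simps)
  also have "\<dots> = of_real (Re (s * cnj d))" by (simp only: complex_add_cnj) simp
  finally have "(cmod a)\<^sup>2 - (cmod b)\<^sup>2 = Re (s * cnj d)" by (simp only: of_real_eq_iff)
  hence lt: "cmod b < cmod a" using d(3) by (simp add: power2_less_imp_less)
  have u: "s / cnj s = s\<^sup>2" "d / cnj d = d\<^sup>2"
    using complex_norm_square[of s] complex_norm_square[of d] ns d
    by (simp_all add: field_simps power2_eq_square) (metis mult.assoc mult.right_neutral mult.commute divide_eq_eq mult_zero_left zero_neq_one)+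
  have "a + b = s" "a - b = d" by (simp_all add: a_def b_def field_simps)
  hence "su11 a b 1 = s / cnj s" "su11 a b (- 1) = - (d / cnj d)"
    unfolding su11_def by (auto simp: a_def b_def field_simps)
  hence e: "su11 a b 1 = q" "su11 a b (- 1) = p" using u s d by auto
  have "disk_map (su11 a b)" using lt by (auto simp: disk_map_def)
  then obtain h where "disk_isometry h" "\<And>z. cmod z \<le> 1 \<Longrightarrow> su11 a b z = h z" using disk_map_Moebius by metis
  thus ?thesis using that[of h] e by (metis norm_minus_cancel norm_one order_refl)
qed

lemma geodesicE:
  assumes "z \<in> geodesic p q"
  obtains f t where "disk_isometry f" "f (- 1) = p" "f 1 = q" "- 1 < t" "t < 1" "z = f (of_real t)"
proof -
  have "\<exists>f t. z = f (of_real t) \<and> disk_isometry f \<and> f (- 1) = p \<and> f 1 = q \<and> - 1 < t \<and> t < 1"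
    using assms by (simp add: geodesic_def)
  thus ?thesis
  proof (elim exE conjE)
    fix f and t :: real
    assume "z = f (of_real t)" "disk_isometry f" "f (- 1) = p" "f 1 = q" "- 1 < t" "t < 1"
    thus ?thesis using that[of f t] by simp
  qed
qed

text \<open>The definition is a union over all isometries with the prescribed endpoints; in the
  Klein model each of them contributes the same chord, and \<open>klein\<close> is injective on the
  disk.\<close>

lemma geodesic_klein:
  assumes "cmod p = 1" "cmod q = 1" "p \<noteq> q"
  shows "geodesic p q = {z. cmod z < 1 \<and> klein z \<in> open_segment p q}"
    and "klein ` geodesic p q = open_segment p q"
proof -
  have g: "geodesic p q = \<Union> {{f (of_real t) | t. - 1 < t \<and> t < 1} | f. disk_isometry f \<and> f (- 1) = p \<and> f 1 = q}"
    unfolding geodesic_def by blast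
  obtain f where f: "disk_isometry f" "f (- 1) = p" "f 1 = q" using disk_map_transitive[OF assms] .
  show img: "klein ` geodesic p q = open_segment p q"
  proof
    show "klein ` geodesic p q \<subseteq> open_segment p q"
      unfolding g using klein_diameter_image[OF disk_isometry_disk_map _ _ assms(3)] by blast
    show "open_segment p q \<subseteq> klein ` geodesic p q"
      unfolding g using klein_diameter_image[OF disk_isometry_disk_map[OF f(1)] f(2,3) assms(3)] f by blast
  qed
  have lt: "cmod z < 1" if "z \<in> geodesic p q" for z
  proof -
    from that obtain f t where "disk_isometry f" "-1 < t" "t < 1" "z = f (of_real t)" by (rule geodesicE)
    thus ?thesis using disk_map_norm_lt[OF disk_isometry_disk_map, of f "of_real t"] by auto
  qed
  show "geodesic p q = {z. cmod z < 1 \<and> klein z \<in> open_segment p q}"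
  proof (intro equalityI subsetI)
    fix z assume "z \<in> geodesic p q" thus "z \<in> {z. cmod z < 1 \<and> klein z \<in> open_segment p q}" using lt img by blast
  next
    fix z assume z: "z \<in> {z. cmod z < 1 \<and> klein z \<in> open_segment p q}"
    then obtain y where "y \<in> geodesic p q" "klein y = klein z" using img by (metis (no_types, lifting) imageE mem_Collect_eq)
    thus "z \<in> geodesic p q" using klein_inj[of y z] lt z by auto
  qed
qed

lemma geodesic_commute: "cmod p = 1 \<Longrightarrow> cmod q = 1 \<Longrightarrow> p \<noteq> q \<Longrightarrow> geodesic p q = geodesic q p"
  by (simp add: geodesic_klein(1) open_segment_commute)

lemma open_segment_ball:
  assumes "cmod p = 1" "cmod q = 1" "y \<in> open_segment p q" shows "cmod y < 1"
  using dist_decreases_open_segment[OF assms(3), of 0] assms(1,2) by auto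

lemma geodesic_eq:
  assumes "cmod p = 1" "cmod q = 1" "p \<noteq> q" "cmod p' = 1" "cmod q' = 1" "p' \<noteq> q'" "geodesic p q = geodesic p' q'"
  shows "{p, q} = {p', q'}"
proof -
  have "open_segment p q = open_segment p' q'"
    using assms geodesic_klein(2) by metis
  hence "closed_segment p q = closed_segment p' q'"
    using closure_open_segment[of p q] closure_open_segment[of p' q'] assms by simp
  moreover have "closed_segment p q \<inter> sphere 0 1 = {p, q}" if "cmod p = 1" "cmod q = 1" for p q :: complex
    unfolding closed_segment_eq_open using open_segment_ball[OF that] that by fastforce
  ultimately show ?thesis using assms by metis
qed

lemma geodesic_image:
  assumes "disk_map f"
  shows "f ` geodesic p q \<subseteq> geodesic (f p) (f q)"
proof
  fix y assume "y \<in> f ` geodesic p q"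
  then obtain z where z: "z \<in> geodesic p q" "y = f z" by blast
  from z(1) obtain h t where "disk_isometry h" "h (- 1) = p" "h 1 = q" "- 1 < t" "t < 1" "z = h (of_real t)"
    by (rule geodesicE)
  hence h: "disk_isometry h" "h (- 1) = p" "h 1 = q" "- 1 < t" "t < 1" "y = f (h (of_real t))"
    using z(2) by simp_all
  obtain k where k: "disk_isometry k" "\<And>z. cmod z \<le> 1 \<Longrightarrow> f (h z) = k z"
    using disk_map_Moebius[OF disk_map_compose[OF assms disk_isometry_disk_map[OF h(1)]]] by metis
  have "k (- 1) = f p" "k 1 = f q" "y = k (of_real t)" using k(2)[of "-1"] k(2)[of 1] k(2)[of "of_real t"] h by auto
  thus "y \<in> geodesic (f p) (f q)" using k(1) h(4,5) unfolding geodesic_def mem_Collect_eq by (intro exI[of _ k] exI[of _ t]) simp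
qed

lemma orient_convex:
  "orient p q ((1 - u) *\<^sub>R r + u *\<^sub>R s) = (1 - u) * orient p q r + u * orient p q s"
  by (simp add: orient_def algebra_simps)

text \<open>In the Klein model \<open>orient p q\<close> is affine along the other chord, so ends on
  different sides of the line give a zero. Being inside the disk, this point of the line lies
  between \<open>p\<close> and \<open>q\<close>.\<close>

lemma geodesic_intersect_iff:
  assumes "cmod p = 1" "cmod q = 1" "p \<noteq> q" "cmod p' = 1" "cmod q' = 1" "p' \<noteq> q'"
    and d: "p' \<noteq> p" "p' \<noteq> q" "q' \<noteq> p" "q' \<noteq> q"
  shows "geodesic p q \<inter> geodesic p' q' \<noteq> {} \<longleftrightarrow> (orient p q p' > 0 \<longleftrightarrow> \<not> orient p q q' > 0)"
proof -
  have nz: "orient p q p' \<noteq> 0" "orient p q q' \<noteq> 0" using assms orient_nonzero by blast+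
  have "geodesic p q \<inter> geodesic p' q' \<noteq> {} \<longleftrightarrow> open_segment p q \<inter> open_segment p' q' \<noteq> {}"
  proof
    assume "geodesic p q \<inter> geodesic p' q' \<noteq> {}"
    then obtain z where "z \<in> geodesic p q" "z \<in> geodesic p' q'" by blast
    hence "klein z \<in> open_segment p q \<inter> open_segment p' q'"
      using geodesic_klein(1)[OF assms(1-3)] geodesic_klein(1)[OF assms(4-6)] by auto
    thus "open_segment p q \<inter> open_segment p' q' \<noteq> {}" by blast
  next
    assume "open_segment p q \<inter> open_segment p' q' \<noteq> {}"
    then obtain y where y: "y \<in> open_segment p q" "y \<in> open_segment p' q'" by blast
    then obtain z where z: "z \<in> geodesic p q" "klein z = y" using geodesic_klein(2)[OF assms(1-3)] by (metis imageE)
    hence "z \<in> geodesic p' q'" using y(2) geodesic_klein(1)[OF assms(1-3)] geodesic_klein(1)[OF assms(4-6)] by auto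
    thus "geodesic p q \<inter> geodesic p' q' \<noteq> {}" using z by blast
  qed
  also have "\<dots> \<longleftrightarrow> (orient p q p' > 0 \<longleftrightarrow> \<not> orient p q q' > 0)"
  proof
    assume "open_segment p q \<inter> open_segment p' q' \<noteq> {}"
    then obtain y where y: "y \<in> open_segment p q" "y \<in> open_segment p' q'" by blast
    obtain u where "y = (1 - u) *\<^sub>R p + u *\<^sub>R q" using y by (auto simp: in_segment)
    hence "orient p q y = 0" by (simp only: orient_convex) (simp add: orient_def algebra_simps)
    moreover obtain v where v: "0 < v" "v < 1" "y = (1 - v) *\<^sub>R p' + v *\<^sub>R q'" using y by (auto simp: in_segment)
    ultimately have "(1 - v) * orient p q p' + v * orient p q q' = 0" by (simp add: orient_convex)
    thus "orient p q p' > 0 \<longleftrightarrow> \<not> orient p q q' > 0" using nz v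
      by (smt (verit) mult_pos_pos mult_pos_neg)
  next
    assume a: "orient p q p' > 0 \<longleftrightarrow> \<not> orient p q q' > 0"
    define v where "v = orient p q p' / (orient p q p' - orient p q q')"
    have ne: "orient p q p' - orient p q q' \<noteq> 0" using a nz by linarith
    have v: "0 < v" "v < 1" using a nz ne unfolding v_def by (cases "orient p q p' > 0"; simp add: field_simps)+
    define y where "y = (1 - v) *\<^sub>R p' + v *\<^sub>R q'"
    have y: "y \<in> open_segment p' q'" using v assms(6) by (auto simp: in_segment y_def)
    have "orient p q y = orient p q p' - v * (orient p q p' - orient p q q')" unfolding y_def orient_convex by (simp add: algebra_simps)
    hence o: "orient p q y = 0" unfolding v_def using ne by simp
    \<comment> \<open>\<open>m\<close> is real because \<open>orient p q y = 0\<close>; hence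
      \<open>y - p\<close> is a real multiple \<open>s\<close> of \<open>q - p\<close>.\<close>
    define m where "m = cnj (q - p) * (y - p)"
    have "m = of_real (Re m)" using o by (simp add: complex_eq_iff m_def orient_def)
    moreover have "(q - p) * cnj (q - p) = of_real ((cmod (q - p))\<^sup>2)" by (simp only: complex_norm_square)
    moreover have "(q - p) * m = of_real ((cmod (q - p))\<^sup>2) * (y - p)"
      unfolding complex_norm_square m_def by (simp add: mult_ac)
    moreover have nqp: "(cmod (q - p))\<^sup>2 \<noteq> 0" using assms(3) by simp
    ultimately have "y - p = of_real (Re m / (cmod (q - p))\<^sup>2) * (q - p)" by (simp add: field_simps)
    then obtain s :: real where s: "y = p + of_real s * (q - p)" by (metis add.commute diff_add_cancel)
    \<comment> \<open>Expansion of the squared norm along the line: it will read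
      \<open>1 - s * (1 - s) * (cmod (q - p))\<^sup>2\<close>.\<close>
    have "complex_of_real ((cmod y)\<^sup>2) = p * cnj p - of_real (s * (1 - s)) * ((q - p) * cnj (q - p)) + of_real s * (q * cnj q - p * cnj p)"
      unfolding complex_norm_square s by (simp add: algebra_simps)
    also have "p * cnj p = 1" using complex_norm_square[of p] assms by simp
    also have "q * cnj q = 1" using complex_norm_square[of q] assms by simp
    also have "(q - p) * cnj (q - p) = of_real ((cmod (q - p))\<^sup>2)" by (simp only: complex_norm_square)
    finally have "complex_of_real ((cmod y)\<^sup>2) = of_real (1 - s * (1 - s) * (cmod (q - p))\<^sup>2)"
      by simp
    hence "(cmod y)\<^sup>2 = 1 - s * (1 - s) * (cmod (q - p))\<^sup>2" by (simp only: of_real_eq_iff)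
    moreover have "(cmod y)\<^sup>2 < 1" using open_segment_ball[OF assms(4,5) y] by (simp add: power_less_one_iff)
    ultimately have "s * (1 - s) > 0" using nqp by (simp add: zero_less_mult_iff)
    hence "0 < s" "s < 1" by (auto simp: zero_less_mult_iff)
    moreover have "y = (1 - s) *\<^sub>R p + s *\<^sub>R q" unfolding s by (simp add: scaleR_conv_of_real algebra_simps)
    ultimately have "y \<in> open_segment p q" using assms(3) by (auto simp: in_segment)
    thus "open_segment p q \<inter> open_segment p' q' \<noteq> {}" using y by blast
  qed
  finally show ?thesis .
qed

section \<open>Limit points\<close>

lemma bar_bar [simp]: "bar (bar e) = e"
  by (cases e) auto

lemma bar_neq [simp]: "bar e \<noteq> e" "e \<noteq> bar e"
  by (cases e; simp)+

lemma bar_eq_iff [simp]: "bar e = bar f \<longleftrightarrow> e = f"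
  by (metis bar_bar)

lemma UNIV_letter: "(UNIV :: letter set) = {GenA, InvB, GenB, InvA}"
  using letter.exhaust by blast

instance letter :: finite
  by standard (simp add: UNIV_letter)

definition reduced :: "(nat \<Rightarrow> letter) \<Rightarrow> bool" where
  "reduced f \<longleftrightarrow> (\<forall>k. f (Suc k) \<noteq> bar (f k))"

text \<open>The pseudohyperbolic distance is at most 1. This bounds the denominators in
  \<open>disk_map_diff\<close> from below by Euclidean distances.\<close>

lemma one_minus_cnj_mult_ge:
  assumes "cmod z \<le> 1" "cmod c \<le> 1"
  shows "cmod (z - c) \<le> cmod (1 - cnj c * z)"
proof -
  have "complex_of_real ((cmod (1 - cnj c * z))\<^sup>2 - (cmod (z - c))\<^sup>2) = complex_of_real ((1 - (cmod z)\<^sup>2) * (1 - (cmod c)\<^sup>2))"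
    unfolding of_real_diff of_real_mult complex_norm_square of_real_1 by (simp add: algebra_simps)
  hence "(cmod (1 - cnj c * z))\<^sup>2 - (cmod (z - c))\<^sup>2 = (1 - (cmod z)\<^sup>2) * (1 - (cmod c)\<^sup>2)"
    by (simp only: of_real_eq_iff)
  also have "\<dots> \<ge> 0" using assms by (intro mult_nonneg_nonneg) (simp_all add: power_le_one)
  finally have "(cmod (z - c))\<^sup>2 \<le> (cmod (1 - cnj c * z))\<^sup>2" by simp
  thus ?thesis by (rule power2_le_imp_le) simp
qed

lemma word_act_append: "word_act g (xs @ ys) z = word_act g xs (word_act g ys z)"
  by (simp add: word_act_def)

lemma word_act_Cons [simp]: "word_act g (e # xs) z = g e (word_act g xs z)"
  by (simp add: word_act_def)

lemma word_act_Nil [simp]: "word_act g [] z = z"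
  by (simp add: word_act_def)

definition inverse_word :: "letter list \<Rightarrow> letter list" where
  "inverse_word xs = rev (map bar xs)"

section \<open>Ping-pong on the half-disks\<close>

locale schottky =
  fixes g :: "letter \<Rightarrow> complex \<Rightarrow> complex" and D :: "letter \<Rightarrow> complex set"
  assumes pants: "schottky_pants g D"
begin

lemma g_disk_map: "disk_map (g e)"
  using pants disk_isometry_disk_map by (auto simp: schottky_pants_def hyperbolic_isometry_def)

lemma g_bar: "cmod z \<le> 1 \<Longrightarrow> g (bar e) (g e z) = z"
  using pants by (auto simp: schottky_pants_def)

lemma bar_g: "cmod z \<le> 1 \<Longrightarrow> g e (g (bar e) z) = z"
  using g_bar[of z "bar e"] by simp

lemma word_act_disk_map: "disk_map (word_act g xs)"
proof (induction xs)
  case Nil thus ?case using disk_map_cong[OF disk_map_id] by simp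
next
  case (Cons e xs)
  show ?case by (rule disk_map_cong[OF disk_map_compose[OF g_disk_map[of e] Cons]]) simp
qed

lemma word_act_inverse: "cmod z \<le> 1 \<Longrightarrow> word_act g (inverse_word xs) (word_act g xs z) = z"
proof (induction xs)
  case (Cons e xs)
  have "cmod (word_act g xs z) \<le> 1" using Cons.prems disk_map_norm_le[OF word_act_disk_map] by simp
  thus ?case using Cons by (simp add: inverse_word_def word_act_append g_bar)
qed (simp add: inverse_word_def)

lemma inverse_inverse_word [simp]: "inverse_word (inverse_word xs) = xs"
  by (simp add: inverse_word_def rev_map[symmetric] comp_def)

lemma inverse_word_act: "cmod z \<le> 1 \<Longrightarrow> word_act g xs (word_act g (inverse_word xs) z) = z"
  using word_act_inverse[of z "inverse_word xs"] by simp

lemma D_ball: "D e \<subseteq> ball 0 1" and D_rel_closed: "closure (D e) \<inter> ball 0 1 \<subseteq> D e"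
proof -
  have "closed_half_disk (D e)" using pants by (auto simp: schottky_pants_def)
  then obtain w k where D: "D e = {z \<in> ball 0 1. k * (1 + (cmod z)\<^sup>2) \<le> 2 * Re (cnj w * z)}"
    by (auto simp: closed_half_disk_def)
  thus "D e \<subseteq> ball 0 1" by auto
  have "closed {z. k * (1 + (cmod z)\<^sup>2) \<le> 2 * Re (cnj w * z)}"
    by (intro closed_Collect_le continuous_intros)
  moreover have "D e \<subseteq> {z. k * (1 + (cmod z)\<^sup>2) \<le> 2 * Re (cnj w * z)}" using D by auto
  ultimately have "closure (D e) \<subseteq> {z. k * (1 + (cmod z)\<^sup>2) \<le> 2 * Re (cnj w * z)}"
    by (rule closure_minimal[rotated])
  thus "closure (D e) \<inter> ball 0 1 \<subseteq> D e" using D by auto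
qed

lemma closure_D_cball: "closure (D e) \<subseteq> cball 0 1"
  using D_ball[of e] by (intro closure_minimal) auto

lemma closure_D_disjoint: "e \<noteq> f \<Longrightarrow> closure (D e) \<inter> closure (D f) = {}"
  using pants by (auto simp: schottky_pants_def)

text \<open>\<open>pants\<close> describes the side pairing only for \<open>GenA\<close> and
  \<open>GenB\<close>; \<open>pos\<close> extracts from it the claim for the generator,
  \<open>neg\<close> the claim for its inverse.\<close>

lemma ping: assumes z: "cmod z < 1" "z \<notin> D (bar e)" shows "g e z \<in> D e"
proof -
  have pos: "g e z \<in> D e" if "g e ` D (bar e) = ball 0 1 - interior (D e)" and z: "cmod z < 1" "z \<notin> D (bar e)" for e z
  proof (rule ccontr)
    assume "g e z \<notin> D e"
    hence "g e z \<in> ball 0 1 - interior (D e)"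
      using disk_map_norm_lt[OF g_disk_map z(1), of e] interior_subset[of "D e"] by (simp add: subset_iff) blast
    hence "g e z \<in> g e ` D (bar e)" unfolding that(1) .
    then obtain y where y: "y \<in> D (bar e)" "g e z = g e y" by blast
    have y1: "cmod y < 1" using y(1) D_ball[of "bar e"] by auto
    have "z = g (bar e) (g e z)" using g_bar[of z e] z(1) by simp
    also have "\<dots> = y" unfolding y(2) using g_bar[of y e] y1 by simp
    finally show False using y(1) z(2) by simp
  qed
  have neg: "g (bar e) z \<in> D (bar e)" if "g e ` D (bar e) = ball 0 1 - interior (D e)" and z: "cmod z < 1" "z \<notin> D e" for e z
  proof -
    have "z \<in> ball 0 1 - interior (D e)" using z interior_subset[of "D e"] by (simp add: subset_iff) blast
    hence "z \<in> g e ` D (bar e)" unfolding that(1) .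
    then obtain y where y: "y \<in> D (bar e)" "z = g e y" by blast
    hence "cmod y < 1" using D_ball by force
    thus ?thesis using y g_bar by simp
  qed
  have a: "g GenA ` D (bar GenA) = ball 0 1 - interior (D GenA)" and b: "g GenB ` D (bar GenB) = ball 0 1 - interior (D GenB)"
    using pants by (auto simp: schottky_pants_def)
  show ?thesis
  proof (cases e)
    case GenA show ?thesis using pos[OF a, of z] z unfolding GenA by simp
  next
    case InvA show ?thesis using neg[OF a, of z] z unfolding InvA by simp
  next
    case GenB show ?thesis using pos[OF b, of z] z unfolding GenB by simp
  next
    case InvB show ?thesis using neg[OF b, of z] z unfolding InvB by simp
  qed
qed

text \<open>The complement of \<open>closure (D (bar e))\<close> is open, so a point of the circle
  in it is a limit of points of the open disk in it; there \<open>ping\<close> applies, and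
  \<open>g e\<close> is continuous.\<close>

lemma ping_closure: assumes z: "cmod z \<le> 1" "z \<notin> closure (D (bar e))" shows "g e z \<in> closure (D e)"
proof -
  let ?U = "- closure (D (bar e))"
  have "z \<in> ?U \<inter> closure (ball 0 1)" using z by simp
  hence zc: "z \<in> closure (?U \<inter> ball 0 1)"
    by (rule subsetD[OF open_Int_closure_subset, rotated]) (rule open_Compl[OF closed_closure])
  have "closure (?U \<inter> ball 0 1) \<subseteq> cball (0::complex) 1" by (intro closure_minimal) auto
  hence "continuous_on (closure (?U \<inter> ball 0 1)) (g e)"
    using disk_map_continuous[OF g_disk_map] continuous_on_subset by blast
  moreover have "g e ` (?U \<inter> ball 0 1) \<subseteq> closure (D e)"
  proof
    fix y assume "y \<in> g e ` (?U \<inter> ball 0 1)"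
    then obtain x where x: "y = g e x" "x \<notin> closure (D (bar e))" "cmod x < 1" by auto
    hence "x \<notin> D (bar e)" using closure_subset by blast
    thus "y \<in> closure (D e)" using x ping closure_subset by blast
  qed
  ultimately have "g e ` closure (?U \<inter> ball 0 1) \<subseteq> closure (D e)"
    by (rule image_closure_subset[OF _ closed_closure])
  thus ?thesis using zc by (metis image_subset_iff)
qed

lemma ping_arc:
  assumes "z \<in> boundary_arc (D f)" "f \<noteq> bar e" shows "g e z \<in> boundary_arc (D e)"
proof -
  have "z \<notin> closure (D (bar e))" using assms closure_D_disjoint[of f "bar e"] by (auto simp: boundary_arc_def)
  thus ?thesis using assms(1) ping_closure[of z e] disk_map_norm_1[OF g_disk_map, of z e] by (auto simp: boundary_arc_def)
qed

text \<open>By \<open>ping\<close>, an empty half-disk makes the one of the inverse letter the whole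
  disk. Disjointness then empties a third one, and two disjoint half-disks would both be the whole
  disk.\<close>

lemma D_nonempty: "D e \<noteq> {}"
proof
  assume e: "D e = {}"
  have "\<exists>f. f \<noteq> e \<and> f \<noteq> bar e" by (cases e) (auto intro: exI[of _ GenA] exI[of _ GenB])
  then obtain f where f: "f \<noteq> e" "f \<noteq> bar e" by blast
  have full: "ball 0 1 \<subseteq> D (bar e)" if "D e = {}" for e using ping[of _ e] that by fastforce
  have "D f = {}"
    using full[OF e] D_ball[of f] closure_D_disjoint[OF f(2)] closure_subset by blast
  hence "ball 0 1 \<subseteq> D (bar f)" by (rule full)
  moreover have "bar f \<noteq> bar e" using f by simp
  ultimately have "ball (0::complex) 1 = {}"
    using full[OF e] closure_D_disjoint[of "bar f" "bar e"] closure_subset by blast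
  thus False by simp
qed

lemma separation:
  obtains d where "d > 0" "\<And>e f z y. e \<noteq> f \<Longrightarrow> z \<in> closure (D e) \<Longrightarrow> y \<in> closure (D f) \<Longrightarrow> d \<le> cmod (z - y)"
proof -
  have "\<exists>d>0. e \<noteq> f \<longrightarrow> (\<forall>z\<in>closure (D e). \<forall>y\<in>closure (D f). d \<le> dist z y)" for e f
  proof (cases "e = f")
    case False
    have "compact (closure (D e))" using closure_D_cball[of e] by (meson bounded_cball bounded_subset closed_closure compact_eq_bounded_closed)
    from separate_compact_closed[OF this closed_closure closure_D_disjoint[OF False]] show ?thesis by blast
  qed (auto intro: exI[of _ 1])
  then obtain d where d: "\<And>e f. d e f > (0::real)"
    "\<And>e f z y. e \<noteq> f \<Longrightarrow> z \<in> closure (D e) \<Longrightarrow> y \<in> closure (D f) \<Longrightarrow> d e f \<le> dist z y" by metis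
  define m where "m = Min (range (\<lambda>(e, f). d e f))"
  have "m > 0" unfolding m_def using d(1) by (subst Min_gr_iff) auto
  moreover have "m \<le> d e f" for e f unfolding m_def by (rule Min_le) (auto intro: range_eqI[of _ _ "(e, f)"])
  ultimately show ?thesis using that[of m] d(2) by (metis dist_norm order_trans)
qed

end

section \<open>Convergence along an infinite reduced word\<close>

locale schottky_ray = schottky +
  fixes f :: "nat \<Rightarrow> letter"
  assumes red: "reduced f"
begin

definition gam :: "nat \<Rightarrow> complex \<Rightarrow> complex" where
  "gam m = word_act g (map f [0..<m])"

definition gami :: "nat \<Rightarrow> complex \<Rightarrow> complex" where
  "gami m = word_act g (inverse_word (map f [0..<m]))"

lemma gam_disk_map: "disk_map (gam m)" and gami_disk_map: "disk_map (gami m)"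
  unfolding gam_def gami_def by (rule word_act_disk_map)+

lemma gami_gam: "cmod z \<le> 1 \<Longrightarrow> gami m (gam m z) = z" and gam_gami: "cmod z \<le> 1 \<Longrightarrow> gam m (gami m z) = z"
  by (simp_all add: gam_def gami_def word_act_inverse inverse_word_act)

lemma gam_Suc: "gam (Suc m) z = gam m (g (f m) z)"
  by (simp add: gam_def word_act_append)

lemma gami_Suc: "gami (Suc m) z = g (bar (f m)) (gami m z)"
  by (simp add: gami_def inverse_word_def)

lemma gam_0 [simp]: "gam 0 z = z" by (simp add: gam_def)

lemma f_step: "f (Suc m) \<noteq> bar (f m)" "bar (f m) \<noteq> f (Suc m)"
  using red by (auto simp: reduced_def) metis

definition H :: "nat \<Rightarrow> complex set" where "H m = gam m ` D (f m)"

lemma H_ball: "H m \<subseteq> ball 0 1"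
  using disk_map_norm_lt[OF gam_disk_map] D_ball by (fastforce simp: H_def)

lemma mem_H: assumes z: "cmod z < 1" shows "z \<in> H m \<longleftrightarrow> gami m z \<in> D (f m)"
proof -
  show "z \<in> H m \<longleftrightarrow> gami m z \<in> D (f m)"
  proof
    assume "z \<in> H m"
    then obtain y where y: "y \<in> D (f m)" "z = gam m y" by (auto simp: H_def)
    have "cmod y < 1" using y(1) D_ball[of "f m"] by auto
    thus "gami m z \<in> D (f m)" using y gami_gam[of y m] by simp
  next
    assume "gami m z \<in> D (f m)"
    moreover have "z = gam m (gami m z)" using gam_gami[of z m] z by simp
    ultimately show "z \<in> H m" unfolding H_def by blast
  qed
qed

lemma H_decreasing: "H (Suc m) \<subseteq> H m"
proof
  fix z assume "z \<in> H (Suc m)"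
  then obtain y where y: "y \<in> D (f (Suc m))" "z = gam m (g (f m) y)" by (auto simp: H_def gam_Suc)
  have "y \<notin> D (bar (f m))" using y(1) closure_D_disjoint[OF f_step(1)[of m]] closure_subset by blast
  moreover have "cmod y < 1" using y(1) D_ball by force
  ultimately show "z \<in> H m" using y(2) ping by (auto simp: H_def)
qed

lemma H_antimono: "m \<le> n \<Longrightarrow> H n \<subseteq> H m"
  using lift_Suc_antimono_le[of H, OF H_decreasing] .

lemma outside_pull_back: "cmod z < 1 \<Longrightarrow> z \<notin> H m \<Longrightarrow> gami (Suc m) z \<in> D (bar (f m))"
  unfolding gami_Suc using mem_H ping[of "gami m z" "bar (f m)"] disk_map_norm_lt[OF gami_disk_map] by simp

text \<open>A point common to all nested half-disks would be joined to a point outside them by a compact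
  segment, which crosses infinitely many shells \<open>H m - H (Suc m)\<close>; but each shell has hyperbolic
  width bounded below.\<close>

lemma H_empty_intersection: assumes z: "cmod z < 1" shows "\<exists>m. z \<notin> H m"
proof (rule ccontr)
  assume "\<not> ?thesis"
  hence zH: "z \<in> H m" for m by blast
  obtain d where d: "d > 0" "\<And>e f z y. e \<noteq> f \<Longrightarrow> z \<in> closure (D e) \<Longrightarrow> y \<in> closure (D f) \<Longrightarrow> d \<le> cmod (z - y)"
    using separation by blast
  obtain b where b: "b \<in> D (bar (f 0))" using D_nonempty by blast
  have b1: "cmod b < 1" using b D_ball by force
  have bH: "b \<notin> H 0" using b closure_D_disjoint[of "bar (f 0)" "f 0"] closure_subset by (auto simp: H_def)
  define seg where "seg t = (1 - t) *\<^sub>R b + t *\<^sub>R z" for t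
  define R where "R = max (cmod b) (cmod z)"
  have R: "R < 1" "0 \<le> R" using z b1 by (simp_all add: R_def le_max_iff_disj)
  have segR: "cmod (seg t) \<le> R" if "0 \<le> t" "t \<le> 1" for t
  proof -
    have "cmod (seg t) \<le> (1 - t) * cmod b + t * cmod z" unfolding seg_def using that norm_triangle_ineq[of "(1 - t) *\<^sub>R b" "t *\<^sub>R z"] by simp
    also have "\<dots> \<le> (1 - t) * R + t * R" using that by (intro add_mono mult_left_mono) (auto simp: R_def)
    finally show ?thesis by (simp add: algebra_simps)
  qed
  have segdiff: "cmod (seg t - seg s) \<le> 2 * \<bar>t - s\<bar>" for s t
  proof -
    have "seg t - seg s = (t - s) *\<^sub>R (z - b)" by (simp add: seg_def algebra_simps)
    moreover have "cmod (z - b) \<le> 2" using norm_triangle_ineq4[of z b] z b1 by simp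
    ultimately show ?thesis using mult_left_mono[of "cmod (z - b)" 2 "\<bar>t - s\<bar>"] by (simp add: mult.commute)
  qed
  define T where "T m = {t \<in> {0..1}. seg t \<in> H m}" for m
  have one: "1 \<in> T m" for m using zH by (simp add: T_def seg_def)
  have bdd: "bdd_below (T m)" for m by (rule bdd_belowI[of _ 0]) (simp add: T_def)
  \<comment> \<open>Parameter at which the segment enters \<open>H m\<close>. It increases with
    \<open>m\<close> and is at most 1, so consecutive values become arbitrarily close.\<close>
  define r where "r m = Inf (T m)" for m
  have r01: "0 \<le> r m" "r m \<le> 1" for m
    unfolding r_def using one[of m] bdd[of m] by (auto intro!: cInf_greatest cInf_lower simp: T_def)
  have "incseq r"
    unfolding incseq_Suc_iff r_def using H_decreasing one bdd
    by (intro allI cInf_superset_mono) (auto simp: T_def)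
  hence "convergent r" using r01 by (intro Bseq_mono_convergent BseqI'[of _ 1]) (auto simp: mono_def incseq_def)
  hence "Cauchy r" by (rule convergent_Cauchy)
  \<comment> \<open>Parameters less than \<open>3 * q\<close> apart give points less than
    \<open>6 * q\<close> apart, and \<open>(6 * q)\<^sup>2\<close> is 36/64 of the lower bound
    \<open>d\<^sup>2 * ((1 - R\<^sup>2) * (1 - R\<^sup>2))\<close>.\<close>
  define q where "q = d * (1 - R\<^sup>2) / 8"
  have R2: "R\<^sup>2 < 1" using R by (simp add: power_less_one_iff)
  have q: "q > 0" using d(1) R2 by (simp add: q_def)
  obtain m where m: "\<bar>r (Suc m) - r m\<bar> < q"
    using \<open>Cauchy r\<close> q unfolding Cauchy_def dist_real_def by (meson le_SucI order_refl)
  obtain t where t: "t \<in> T (Suc m)" "t < r (Suc m) + q"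
    using cInf_lessD[of "T (Suc m)" "r (Suc m) + q"] one q unfolding r_def by auto
  \<comment> \<open>Just before the entry into \<open>H m\<close>, or else the start
    \<open>b\<close> of the segment, which lies outside \<open>H 0\<close>.\<close>
  define s where "s = max 0 (r m - q)"
  have s: "0 \<le> s" "s \<le> 1" using r01[of m] q by (auto simp: s_def)
  have "seg s \<notin> H m"
  proof (cases "s = 0")
    case True thus ?thesis using bH H_antimono[of 0 m] by (auto simp: seg_def)
  next
    case False
    hence "s < r m" using q by (auto simp: s_def)
    hence "s \<notin> T m" unfolding r_def using bdd cInf_lower leD by metis
    thus ?thesis using s by (simp add: T_def)
  qed
  have t01: "0 \<le> t" "t \<le> 1" "seg t \<in> H (Suc m)" using t by (auto simp: T_def)
  have tr: "r (Suc m) \<le> t" unfolding r_def using t bdd by (intro cInf_lower)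
  have "\<bar>t - s\<bar> < 3 * q" using m t(2) tr r01[of m] q unfolding s_def by (auto simp: abs_if max_def split: if_splits)
  hence close: "cmod (seg t - seg s) < 6 * q" by (intro order_le_less_trans[OF segdiff[of t s]]) simp
  let ?y = "gami (Suc m) (seg t)" and ?x = "gami (Suc m) (seg s)"
  have lt: "cmod (seg t) < 1" "cmod (seg s) < 1" using segR[of t] segR[of s] t01 s R by auto
  have y: "?y \<in> D (f (Suc m))" using mem_H[OF lt(1)] t01 by simp
  have x: "?x \<in> D (bar (f m))" using outside_pull_back[OF lt(2) \<open>seg s \<notin> H m\<close>] .
  have "d \<le> cmod (?y - ?x)" using d(2)[OF f_step(1)] x y closure_subset by blast
  hence d2: "d\<^sup>2 \<le> (cmod (?y - ?x))\<^sup>2" using d(1) by (intro power_mono) auto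
  have one_sub: "1 - R\<^sup>2 \<le> 1 - (cmod (seg u))\<^sup>2" if "0 \<le> u" "u \<le> 1" for u
    using power_mono[OF segR[OF that], of 2] by simp
  have "d\<^sup>2 * ((1 - R\<^sup>2) * (1 - R\<^sup>2)) \<le> (cmod (?y - ?x))\<^sup>2 * ((1 - (cmod (seg t))\<^sup>2) * (1 - (cmod (seg s))\<^sup>2))"
    using R2 one_sub[OF t01(1,2)] one_sub[OF s] by (intro mult_mono d2) auto
  also have "\<dots> = (cmod (seg t - seg s))\<^sup>2 * ((1 - (cmod ?y)\<^sup>2) * (1 - (cmod ?x)\<^sup>2))"
    by (rule disk_map_distortion[OF gami_disk_map lt])
  also have "\<dots> \<le> (cmod (seg t - seg s))\<^sup>2 * (1 * 1)"
    using disk_map_norm_lt[OF gami_disk_map lt(1), of "Suc m"] disk_map_norm_lt[OF gami_disk_map lt(2), of "Suc m"]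
    by (intro mult_left_mono mult_mono) (simp_all add: power_le_one)
  also have "\<dots> \<le> (6 * q)\<^sup>2" using close power_mono[of "cmod (seg t - seg s)" "6 * q" 2] by simp
  also have "\<dots> = (36 / 64) * (d\<^sup>2 * ((1 - R\<^sup>2) * (1 - R\<^sup>2)))" by (simp add: q_def power2_eq_square)
  finally have "d\<^sup>2 * ((1 - R\<^sup>2) * (1 - R\<^sup>2)) \<le> 0" by simp
  moreover have "d\<^sup>2 * ((1 - R\<^sup>2) * (1 - R\<^sup>2)) > 0" using d(1) R2 by simp
  ultimately show False by simp
qed

text \<open>The sets \<open>K m\<close> are compact and nested; if all were nonempty, a common point
  would contradict \<open>H_empty_intersection\<close>.\<close>

lemma H_escapes: assumes R: "R < 1" shows "\<exists>M. \<forall>m\<ge>M. H m \<inter> cball 0 R = {}"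
proof (rule ccontr)
  assume "\<not> ?thesis"
  hence ne: "H m \<inter> cball 0 R \<noteq> {}" for m using H_antimono[of m] by blast
  define K where "K m = cball 0 R \<inter> gami m -` closure (D (f m))" for m
  have KH: "K m = H m \<inter> cball 0 R" for m
  proof -
    have "gami m z \<in> closure (D (f m)) \<longleftrightarrow> z \<in> H m" if "z \<in> cball 0 R" for z
    proof -
      have lt: "cmod z < 1" using that R by simp
      hence "gami m z \<in> ball 0 1" using disk_map_norm_lt[OF gami_disk_map] by simp
      thus ?thesis using mem_H[OF lt] D_rel_closed[of "f m"] closure_subset[of "D (f m)"] by blast
    qed
    thus ?thesis unfolding K_def by auto
  qed
  have "cball (0::complex) R \<subseteq> cball 0 1" using R by auto
  hence "closed (K m)" for m unfolding K_def
    by (intro continuous_closed_preimage continuous_on_subset[OF disk_map_continuous[OF gami_disk_map]]) (auto simp: Int_commute)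
  moreover have "K m \<subseteq> cball 0 R" for m by (auto simp: K_def)
  ultimately have "compact (K m)" for m by (meson bounded_cball bounded_subset compact_eq_bounded_closed)
  hence "\<Inter> (range K) \<noteq> {}"
    using ne KH H_antimono by (intro compact_nest) (auto, blast)
  then obtain z where "\<And>m. z \<in> H m" "z \<in> cball 0 R" using KH by blast
  thus False using H_empty_intersection[of z] R by auto
qed

text \<open>One point per letter is chosen in the half-disks, so their hyperbolic distances to 0 are
  bounded. The image of the point in \<open>D (f m)\<close> lies in \<open>H m\<close>, which
  escapes to the circle, and invariance of the distance drags the image of 0 along.\<close>

lemma gam_0_norm: "(\<lambda>m. cmod (gam m 0)) \<longlonglongrightarrow> 1"
proof (rule LIMSEQ_I)
  fix e :: real assume e: "0 < e"
  define p where "p e = (SOME z. z \<in> D e)" for e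
  have p: "p e \<in> D e" for e unfolding p_def using D_nonempty by (simp add: some_in_eq)
  define r0 where "r0 = Max (range (\<lambda>e. cmod (p e)))"
  have r0: "cmod (p e) \<le> r0" for e unfolding r0_def by (rule Max_ge) auto
  have r01: "r0 < 1" unfolding r0_def using p D_ball by (subst Max_less_iff) force+
  have r00: "0 \<le> r0" using r0[of GenA] norm_ge_zero order_trans by blast
  define R where "R = max 0 (1 - e)"
  have R: "0 \<le> R" "R < 1" using e by (auto simp: R_def)
  \<comment> \<open>If \<open>gam m 0\<close> stayed within \<open>R\<close> while
    \<open>gam m (p (f m))\<close> is beyond \<open>(1 + R) / 2\<close>, then \<open>c\<close> would
    bound the left side of the distortion identity from below. The right side is at most
    \<open>1 - (cmod ?y)\<^sup>2\<close>, which the second entry of \<open>R'\<close> makes smaller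
    than \<open>c\<close>.\<close>
  define c where "c = ((1 - R) / 2)\<^sup>2 * (1 - r0\<^sup>2)"
  have "r0\<^sup>2 < 1" using r01 r00 by (simp add: power_less_one_iff)
  hence c: "c > 0" using R by (simp add: c_def)
  define R' where "R' = max ((1 + R) / 2) (sqrt (max 0 (1 - c)))"
  have R': "R' < 1" using R c by (auto simp: R'_def real_sqrt_less_iff intro: real_less_lsqrt)
  obtain M where M: "\<And>m. m \<ge> M \<Longrightarrow> H m \<inter> cball 0 R' = {}" using H_escapes[OF R'] by blast
  have "norm (cmod (gam m 0) - 1) < e" if m: "m \<ge> M" for m
  proof (rule ccontr)
    assume "\<not> ?thesis"
    moreover have lx: "cmod (gam m 0) < 1" using disk_map_norm_lt[OF gam_disk_map] by simp
    ultimately have x: "cmod (gam m 0) \<le> R" by (auto simp: R_def)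
    let ?x = "gam m 0" and ?p = "p (f m)" and ?y = "gam m (p (f m))"
    have lp: "cmod ?p < 1" using p D_ball by force
    have yH: "?y \<in> H m" using p by (auto simp: H_def)
    hence y: "R' < cmod ?y" "cmod ?y < 1" using M[OF m] H_ball[of m] by (auto simp: disjoint_iff)
    have "(cmod (?x - ?y))\<^sup>2 * ((1 - (cmod 0)\<^sup>2) * (1 - (cmod ?p)\<^sup>2)) = (cmod (0 - ?p))\<^sup>2 * ((1 - (cmod ?x)\<^sup>2) * (1 - (cmod ?y)\<^sup>2))"
      by (rule disk_map_distortion[OF gam_disk_map _ lp]) simp
    hence eq: "(cmod (?x - ?y))\<^sup>2 * (1 - (cmod ?p)\<^sup>2) = (cmod ?p)\<^sup>2 * (1 - (cmod ?x)\<^sup>2) * (1 - (cmod ?y)\<^sup>2)" by simp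
    have "(1 - R) / 2 \<le> cmod (?x - ?y)" using y(1) x norm_triangle_ineq2[of ?y ?x] unfolding R'_def
      by (simp add: norm_minus_commute field_simps)
    hence "c \<le> (cmod (?x - ?y))\<^sup>2 * (1 - (cmod ?p)\<^sup>2)" unfolding c_def
      using R r0[of "f m"] \<open>r0\<^sup>2 < 1\<close> by (intro mult_mono power_mono) (auto intro: power_mono)
    also have "\<dots> \<le> 1 * 1 * (1 - (cmod ?y)\<^sup>2)" unfolding eq
      using lp lx y by (intro mult_mono) (auto simp: power_le_one)
    finally have "(cmod ?y)\<^sup>2 \<le> max 0 (1 - c)" by simp
    hence "cmod ?y \<le> sqrt (max 0 (1 - c))" by (rule real_le_rsqrt)
    thus False using y(1) by (simp add: R'_def)
  qed
  thus "\<exists>no. \<forall>n\<ge>no. norm (cmod (gam n 0) - 1) < e" by blast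
qed

text \<open>\<open>x\<close> is a common point of the nested compact sets \<open>E m\<close>, say
  \<open>x = gam m y\<close>. The point \<open>gami m 0\<close>, which \<open>gam m\<close> sends to
  0, lies in \<open>D (bar (f n))\<close> for \<open>m = Suc n\<close>, hence at distance at least
  \<open>d\<close> from \<open>y\<close>; so \<open>disk_map_diff\<close> gives a bound in terms of
  \<open>1 - (cmod (gam m 0))\<^sup>2\<close>.\<close>

lemma limit_exists:
  obtains x where "(\<lambda>m. gam m 0) \<longlonglongrightarrow> x" "x \<in> closure (D (f 0))"
proof -
  obtain d where d: "d > 0" "\<And>e f z y. e \<noteq> f \<Longrightarrow> z \<in> closure (D e) \<Longrightarrow> y \<in> closure (D f) \<Longrightarrow> d \<le> cmod (z - y)"
    using separation by blast
  define E where "E m = gam m ` closure (D (f m))" for m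
  have dec: "E (Suc m) \<subseteq> E m" for m
  proof
    fix z assume "z \<in> E (Suc m)"
    then obtain y where y: "y \<in> closure (D (f (Suc m)))" "z = gam m (g (f m) y)" by (auto simp: E_def gam_Suc)
    have "y \<notin> closure (D (bar (f m)))" using y(1) closure_D_disjoint[OF f_step(1)[of m]] by blast
    moreover have "cmod y \<le> 1" using y(1) closure_D_cball by force
    ultimately show "z \<in> E m" using y(2) ping_closure by (auto simp: E_def)
  qed
  have cpt: "compact (closure (D e))" for e
    using closure_D_cball[of e] by (meson bounded_cball bounded_subset closed_closure compact_eq_bounded_closed)
  have "compact (E m)" for m unfolding E_def
    using cpt by (intro compact_continuous_image continuous_on_subset[OF disk_map_continuous[OF gam_disk_map] closure_D_cball])
  moreover have "E m \<noteq> {}" for m using D_nonempty by (simp add: E_def)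
  moreover have "E n \<subseteq> E m" if "m \<le> n" for m n using lift_Suc_antimono_le[of E, OF dec that] .
  ultimately have "\<Inter> (range E) \<noteq> {}" by (intro compact_nest)
  then obtain x where x: "\<And>m. x \<in> E m" by auto
  \<comment> \<open>The terms bound the steps from \<open>gam m 0\<close> to \<open>gam m p\<close>
    and from there to \<open>gam m y = x\<close>, with \<open>p\<close> in \<open>D (f m)\<close>.
    In the first step one denominator is 1, in the second both are at least
    \<open>d\<close>.\<close>
  define B where "B m = (1 - (cmod (gam m 0))\<^sup>2) / d + 2 * (1 - (cmod (gam m 0))\<^sup>2) / (d * d)" for m
  have "B \<longlonglongrightarrow> (1 - 1\<^sup>2) / d + 2 * (1 - 1\<^sup>2) / (d * d)"
    unfolding B_def by (intro tendsto_intros gam_0_norm) (use d in auto)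
  hence B0: "B \<longlonglongrightarrow> 0" by simp
  \<comment> \<open>\<open>cball 0 0\<close> is the point 0: from \<open>M\<close> on it lies
    outside \<open>H n\<close>, as \<open>outside_pull_back\<close> requires.\<close>
  obtain M where M: "\<And>m. m \<ge> M \<Longrightarrow> H m \<inter> cball 0 0 = {}" using H_escapes[of 0] by auto
  have bound: "cmod (gam m 0 - x) \<le> B m" if m: "m \<ge> Suc M" for m
  proof -
    obtain n where n: "m = Suc n" "n \<ge> M" using m by (cases m) auto
    have "0 \<notin> H n" using M[OF n(2)] by auto
    hence cD: "gami m 0 \<in> D (bar (f n))" unfolding n(1) by (intro outside_pull_back) auto
    obtain y where y: "y \<in> closure (D (f m))" "x = gam m y" using x[of m] by (auto simp: E_def)
    have y1: "cmod y \<le> 1" using y closure_D_cball by force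
    obtain p where p: "p \<in> D (f m)" using D_nonempty by blast
    have p1: "cmod p \<le> 1" using p D_ball by force
    have away: "d \<le> cmod (1 - cnj w * z)" if "z \<in> closure (D (f m))" "w = gami m 0" for z w
    proof -
      have "d \<le> cmod (z - w)" using d(2)[of "f m" "bar (f n)" z w] f_step(1)[of n] cD that n(1) closure_subset by blast
      also have "\<dots> \<le> cmod (1 - cnj w * z)"
        using that closure_D_cball[of "f m"] cD D_ball[of "bar (f n)"] by (intro one_minus_cnj_mult_ge) (auto simp: subset_iff less_imp_le)
      finally show ?thesis .
    qed
    have w: "w = gami m 0" if "gam m w = 0" "cmod w < 1" for w
      using gami_gam[of w m] that by simp
    obtain w where w0: "cmod w < 1" "gam m w = 0" 
      "cmod (gam m 0 - gam m p) = cmod (0 - p) * (1 - (cmod w)\<^sup>2) / (cmod (1 - cnj w * 0) * cmod (1 - cnj w * p))" "cmod (gam m 0) = cmod w"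
      using disk_map_diff[OF gam_disk_map, of 0 p m] p1 by auto
    have s: "0 \<le> 1 - (cmod w)\<^sup>2" using w0(1) by (simp add: power_le_one)
    have a1: "d \<le> cmod (1 - cnj w * p)" using away[OF _ w[OF w0(2,1)]] p closure_subset by blast
    have "cmod (gam m 0 - gam m p) = cmod p * (1 - (cmod w)\<^sup>2) / cmod (1 - cnj w * p)" using w0(3) by simp
    also have "\<dots> \<le> 1 * (1 - (cmod w)\<^sup>2) / d" using p1 s a1 d(1) by (intro frac_le mult_right_mono) auto
    finally have 1: "cmod (gam m 0 - gam m p) \<le> (1 - (cmod (gam m 0))\<^sup>2) / d" using w0(4) by simp
    obtain v where v0: "cmod v < 1" "gam m v = 0" 
      "cmod (gam m p - gam m y) = cmod (p - y) * (1 - (cmod v)\<^sup>2) / (cmod (1 - cnj v * p) * cmod (1 - cnj v * y))" "cmod (gam m 0) = cmod v"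
      using disk_map_diff[OF gam_disk_map, of p y m] p1 y1 by auto
    have sv: "0 \<le> 1 - (cmod v)\<^sup>2" using v0(1) by (simp add: power_le_one)
    have a2: "d \<le> cmod (1 - cnj v * p)" "d \<le> cmod (1 - cnj v * y)"
      using away[OF _ w[OF v0(2,1)]] p y closure_subset by blast+
    have "cmod (p - y) \<le> 2" using norm_triangle_ineq4[of p y] p1 y1 by simp
    hence 2: "cmod (gam m p - gam m y) \<le> 2 * (1 - (cmod (gam m 0))\<^sup>2) / (d * d)"
      unfolding v0(3,4) using sv a2 d(1) by (intro frac_le mult_right_mono mult_mono) auto
    show ?thesis unfolding B_def using 1 2 y(2) norm_triangle_ineq[of "gam m 0 - gam m p" "gam m p - gam m y"] by simp
  qed
  have "(\<lambda>m. gam m 0 - x) \<longlonglongrightarrow> 0"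
    using B0 by (rule Lim_null_comparison[rotated]) (use bound in \<open>auto simp: eventually_sequentially\<close>)
  hence "(\<lambda>m. gam m 0) \<longlonglongrightarrow> x" by (simp add: LIM_zero_iff)
  moreover have "x \<in> closure (D (f 0))" using x[of 0] by (auto simp: E_def)
  ultimately show ?thesis using that by blast
qed

lemma limit_point_converges: "(\<lambda>m. gam m 0) \<longlonglongrightarrow> limit_point g f"
  unfolding limit_point_def gam_def[symmetric] using limit_exists limI by metis

lemma limit_point_arc: "limit_point g f \<in> boundary_arc (D (f 0))"
proof -
  have "limit_point g f \<in> closure (D (f 0))"
    using limit_exists limit_point_converges LIMSEQ_unique by metis
  moreover have "cmod (limit_point g f) = 1"
    using tendsto_norm[OF limit_point_converges] gam_0_norm LIMSEQ_unique by blast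
  ultimately show ?thesis by (simp add: boundary_arc_def)
qed

end

context schottky
begin

lemma limit_arc: "reduced f \<Longrightarrow> limit_point g f \<in> boundary_arc (D (f 0))"
  by (rule schottky_ray.limit_point_arc) (unfold_locales)

lemma limit_norm: "reduced f \<Longrightarrow> cmod (limit_point g f) = 1"
  using limit_arc by (force simp: boundary_arc_def)

lemma limit_shift:
  assumes f: "reduced f" shows "limit_point g f = g (f 0) (limit_point g (\<lambda>k. f (Suc k)))"
proof -
  interpret F: schottky_ray g D f using f by unfold_locales
  interpret S: schottky_ray g D "\<lambda>k. f (Suc k)" using f by unfold_locales (simp add: reduced_def)
  have e: "F.gam (Suc m) 0 = g (f 0) (S.gam m 0)" for m
  proof -
    have "map f [0..<Suc m] = f 0 # map (\<lambda>k. f (Suc k)) [0..<m]"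
      by (rule nth_equalityI) (auto simp: nth_Cons' simp del: upt_Suc)
    thus ?thesis by (simp add: F.gam_def S.gam_def del: upt_Suc)
  qed
  have "cmod (S.gam m 0) \<le> 1" for m using disk_map_norm_le[OF S.gam_disk_map] by simp
  moreover have "cmod (limit_point g (\<lambda>k. f (Suc k))) = 1" using S.limit_point_arc by (simp add: boundary_arc_def)
  ultimately have "(\<lambda>m. g (f 0) (S.gam m 0)) \<longlonglongrightarrow> g (f 0) (limit_point g (\<lambda>k. f (Suc k)))"
    using continuous_on_tendsto_compose[OF disk_map_continuous[OF g_disk_map] S.limit_point_converges] by auto
  hence "(\<lambda>m. F.gam (Suc m) 0) \<longlonglongrightarrow> g (f 0) (limit_point g (\<lambda>k. f (Suc k)))" using e by simp
  hence "(\<lambda>m. F.gam m 0) \<longlonglongrightarrow> g (f 0) (limit_point g (\<lambda>k. f (Suc k)))" by (rule LIMSEQ_imp_Suc)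
  thus ?thesis using F.limit_point_converges LIMSEQ_unique by blast
qed

end

section \<open>The cyclic order of limit points\<close>

text \<open>Anticlockwise numbering of the arcs. Passing to the inverse letter becomes the
  reflection \<open>3 - i\<close>, the form in which \<open>glued_polygon\<close> glues its
  sides.\<close>

fun idx :: "letter \<Rightarrow> nat" where
  "idx GenA = 0" | "idx InvB = 1" | "idx GenB = 2" | "idx InvA = 3"

lemma idx_bar: "idx (bar e) = 3 - idx e" by (cases e) auto
lemma idx_le: "idx e \<le> 3" by (cases e) auto
lemma idx_inj [simp]: "idx e = idx f \<longleftrightarrow> e = f" by (cases e; cases f) auto

text \<open>The position of \<open>t\<close> in the anticlockwise order of the letters starting after \<open>bar s\<close>;
  the simple formula is due to \<open>idx (bar s) = 3 - idx s\<close>.\<close>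

definition rank :: "letter \<Rightarrow> letter \<Rightarrow> nat" where
  "rank s t = (idx s + idx t) mod 4"

definition ccw :: "nat \<Rightarrow> nat \<Rightarrow> nat \<Rightarrow> bool" where
  "ccw i j k \<longleftrightarrow> (i < j \<and> j < k) \<or> (j < k \<and> k < i) \<or> (k < i \<and> i < j)"

lemma rank_le: "t \<noteq> bar s \<Longrightarrow> rank s t \<le> 2"
  by (cases s; cases t) (auto simp: rank_def)

lemma rank_le3: "rank s t \<le> 3"
  by (cases s; cases t) (auto simp: rank_def)

lemma rank_inj: "rank s t = rank s u \<longleftrightarrow> t = u"
  by (cases s; cases t; cases u) (auto simp: rank_def)

lemma ccw_rank: "t \<noteq> bar s \<Longrightarrow> u \<noteq> bar s \<Longrightarrow> ccw (idx t) (idx u) (idx (bar s)) \<longleftrightarrow> rank s t < rank s u"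
  by (cases s; cases t; cases u) (auto simp: rank_def ccw_def)

definition tl_ray :: "(nat \<Rightarrow> letter) \<Rightarrow> nat \<Rightarrow> letter" where
  "tl_ray f k = f (Suc k)"

lemma reduced_tl: "reduced f \<Longrightarrow> reduced (tl_ray f)"
  by (simp add: reduced_def tl_ray_def)

text \<open>Among the infinite reduced words with a given first letter, the code increases anticlockwise.
  The base 4 exceeds the number 3 of digits, so that the first differing digit decides.\<close>

definition code :: "(nat \<Rightarrow> letter) \<Rightarrow> real" where
  "code f = (\<Sum>k. real (rank (f k) (f (Suc k))) * (1 / 4) ^ k)"

lemma code_summable: "summable (\<lambda>k. real (rank (f k) (f (Suc k))) * (1 / 4) ^ k)"
proof (rule summable_comparison_test)
  show "summable (\<lambda>k. 3 * (1 / 4 :: real) ^ k)" by (intro summable_mult summable_geometric) simp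
  show "\<exists>N. \<forall>k\<ge>N. norm (real (rank (f k) (f (Suc k))) * (1 / 4) ^ k) \<le> 3 * (1 / 4) ^ k"
    using rank_le3 by (auto intro!: mult_right_mono)
qed

lemma code_step: "code f = real (rank (f 0) (f 1)) + code (tl_ray f) / 4"
  unfolding code_def using suminf_split_head[OF code_summable, of f]
    suminf_divide[OF code_summable, of "tl_ray f" 4]
  by (simp add: tl_ray_def)

lemma code_bounds: assumes "reduced f" shows "0 \<le> code f" "code f \<le> 8 / 3"
proof -
  show "0 \<le> code f" unfolding code_def by (intro suminf_nonneg code_summable) simp
  have "code f \<le> (\<Sum>k. 2 * (1 / 4) ^ k)" unfolding code_def
    using rank_le assms by (intro suminf_le code_summable summable_mult summable_geometric mult_right_mono)
      (auto simp: reduced_def)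
  also have "\<dots> = 8 / 3" by (subst suminf_mult) (auto simp: suminf_geometric summable_geometric)
  finally show "code f \<le> 8 / 3" .
qed

lemma code_less_digit:
  assumes "reduced f" "reduced h" "f 0 = h 0" "f 1 \<noteq> h 1"
  shows "code f < code h \<longleftrightarrow> rank (f 0) (f 1) < rank (f 0) (h 1)"
proof -
  have "rank (f 0) (f 1) \<noteq> rank (f 0) (h 1)" using assms(4) by (simp add: rank_inj)
  moreover have "0 \<le> code (tl_ray f)" "code (tl_ray f) \<le> 8 / 3" "0 \<le> code (tl_ray h)" "code (tl_ray h) \<le> 8 / 3"
    using code_bounds assms reduced_tl by blast+
  ultimately show ?thesis unfolding code_step[of f] code_step[of h] assms(3) by linarith
qed

lemma code_less_tl: "f 0 = h 0 \<Longrightarrow> f 1 = h 1 \<Longrightarrow> code f - code h = (code (tl_ray f) - code (tl_ray h)) / 4"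
  unfolding code_step[of f] code_step[of h] by simp

context schottky
begin

lemma limit_tl: "reduced f \<Longrightarrow> limit_point g f = g (f 0) (limit_point g (tl_ray f))"
  using limit_shift by (simp add: tl_ray_def[abs_def])

lemma limit_tl': "reduced f \<Longrightarrow> g (bar (f 0)) (limit_point g f) = limit_point g (tl_ray f)"
  using limit_tl g_bar limit_norm[OF reduced_tl] by simp

lemma arc_disjoint: "z \<in> boundary_arc (D e) \<Longrightarrow> z \<in> boundary_arc (D f) \<Longrightarrow> e = f"
  using closure_D_disjoint[of e f] by (auto simp: boundary_arc_def)

lemma limit_inj:
  assumes "reduced f" "reduced h" "limit_point g f = limit_point g h" shows "f = h"
proof
  fix k
  show "f k = h k" using assms
  proof (induction k arbitrary: f h)
    case 0 thus ?case using limit_arc arc_disjoint by metis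
  next
    case (Suc k)
    have "f 0 = h 0" using Suc.prems limit_arc arc_disjoint by metis
    hence "limit_point g (tl_ray f) = limit_point g (tl_ray h)" using Suc.prems limit_tl' by metis
    from Suc.IH[OF reduced_tl[OF Suc.prems(1)] reduced_tl[OF Suc.prems(2)] this] show ?case by (simp add: tl_ray_def)
  qed
qed

lemma arc_norm: "z \<in> boundary_arc S \<Longrightarrow> cmod z = 1" by (simp add: boundary_arc_def)

lemma orient_increasing:
  assumes "p \<in> boundary_arc (D s)" "q \<in> boundary_arc (D t)" "r \<in> boundary_arc (D u)" "idx s < idx t" "idx t < idx u"
  shows "orient p q r > 0"
proof -
  \<comment> \<open>The cyclic order is given for four points, one on each arc; the arc not in use
    receives the limit of a constant word.\<close>
  define P where "P e = (if e = s then p else if e = t then q else if e = u then r else limit_point g (\<lambda>_. e))" for e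
  have P: "P e \<in> boundary_arc (D e)" for e using assms limit_arc[of "\<lambda>_. e"] by (auto simp: P_def reduced_def)
  have "anticlockwise4 (boundary_arc (D GenA)) (boundary_arc (D InvB)) (boundary_arc (D GenB)) (boundary_arc (D InvA))"
    using pants by (simp add: schottky_pants_def)
  then obtain t1 t2 t3 t4 where t: "P GenA = cis t1" "P InvB = cis t2" "P GenB = cis t3" "P InvA = cis t4"
    "t1 < t2" "t2 < t3" "t3 < t4" "t4 < t1 + 2 * pi" using P unfolding anticlockwise4_def by blast
  have "orient (P s) (P t) (P u) > 0" using assms(4,5) t
    by (cases s; cases t; cases u) (auto intro!: orient_cis_pos)
  moreover have "s \<noteq> t" "s \<noteq> u" "t \<noteq> u" using assms(4,5) by auto
  ultimately show ?thesis by (simp add: P_def)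
qed

lemma orient_letters:
  assumes "p \<in> boundary_arc (D s)" "q \<in> boundary_arc (D t)" "r \<in> boundary_arc (D u)" "s \<noteq> t" "t \<noteq> u" "s \<noteq> u"
  shows "orient p q r > 0 \<longleftrightarrow> ccw (idx s) (idx t) (idx u)"
proof -
  have "idx s \<noteq> idx t" "idx t \<noteq> idx u" "idx s \<noteq> idx u" using assms by auto
  then consider "idx s < idx t" "idx t < idx u" | "idx t < idx u" "idx u < idx s" | "idx u < idx s" "idx s < idx t"
    | "idx s < idx u" "idx u < idx t" | "idx u < idx t" "idx t < idx s" | "idx t < idx s" "idx s < idx u" by linarith
  thus ?thesis
  proof cases
    case 1 thus ?thesis using orient_increasing[OF assms(1-3)] by (simp add: ccw_def)
  next
    case 2 thus ?thesis using orient_increasing[OF assms(2,3,1)] orient_cycle[of p q r] by (simp add: ccw_def)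
  next
    case 3 thus ?thesis using orient_increasing[OF assms(3,1,2)] orient_cycle[of p q r] orient_cycle[of q r p] by (simp add: ccw_def)
  next
    case 4 thus ?thesis using orient_increasing[OF assms(1,3,2)] orient_swap[of p q r] orient_cycle[of q p r] orient_cycle[of p r q] by (simp add: ccw_def)
  next
    case 5 thus ?thesis using orient_increasing[OF assms(3,2,1)] orient_swap[of p q r] orient_cycle[of r q p] by (simp add: ccw_def)
  next
    case 6 thus ?thesis using orient_increasing[OF assms(2,1,3)] orient_swap[of p q r] by (simp add: ccw_def)
  qed
qed

text \<open>Common letters are stripped by applying \<open>bar (f 0)\<close>: this preserves
  orientation and moves \<open>z\<close> into the arc of \<open>bar (f 0)\<close>, the very letter
  after which \<open>rank\<close> starts to count.\<close>

lemma code_less_iff_orient: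
  assumes "reduced f" "reduced h" "f 0 = h 0" "f \<noteq> h" "z \<in> boundary_arc (D u)" "u \<noteq> f 0"
  shows "code f < code h \<longleftrightarrow> orient (limit_point g f) (limit_point g h) z > 0"
proof -
  from assms(4) obtain k where k: "f k \<noteq> h k" by blast
  from k assms show ?thesis
  proof (induction k arbitrary: f h z u)
    case 0 thus ?case by simp
  next
    case (Suc k)
    let ?z = "g (bar (f 0)) z"
    have z': "?z \<in> boundary_arc (D (bar (f 0)))" using Suc.prems by (intro ping_arc) auto
    have r: "reduced (tl_ray f)" "reduced (tl_ray h)" using Suc.prems reduced_tl by auto
    have "orient (limit_point g f) (limit_point g h) z > 0 \<longleftrightarrow> 
       orient (g (bar (f 0)) (limit_point g f)) (g (bar (f 0)) (limit_point g h)) ?z > 0"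
      using orient_disk_map[OF g_disk_map limit_norm[OF Suc.prems(2)] limit_norm[OF Suc.prems(3)] arc_norm[OF Suc.prems(6)]] by simp
    also have "\<dots> \<longleftrightarrow> orient (limit_point g (tl_ray f)) (limit_point g (tl_ray h)) ?z > 0"
      using limit_tl'[OF Suc.prems(2)] limit_tl'[OF Suc.prems(3)] Suc.prems(4) by simp
    finally have e: "orient (limit_point g f) (limit_point g h) z > 0 \<longleftrightarrow> orient (limit_point g (tl_ray f)) (limit_point g (tl_ray h)) ?z > 0" .
    have nb: "f 1 \<noteq> bar (f 0)" "h 1 \<noteq> bar (f 0)" 
      using Suc.prems(2)[unfolded reduced_def, rule_format, of 0] Suc.prems(3)[unfolded reduced_def, rule_format, of 0] Suc.prems(4)
      by simp_all
    show ?case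
    proof (cases "f 1 = h 1")
      case True
      have "code f < code h \<longleftrightarrow> code (tl_ray f) < code (tl_ray h)"
        using code_less_tl[OF Suc.prems(4) True] by auto
      also have "\<dots> \<longleftrightarrow> orient (limit_point g (tl_ray f)) (limit_point g (tl_ray h)) ?z > 0"
        using Suc.prems(1) True nb by (intro Suc.IH[OF _ r _ _ z']) (auto simp: tl_ray_def fun_eq_iff)
      finally show ?thesis using e by simp
    next
      case False
      have "orient (limit_point g (tl_ray f)) (limit_point g (tl_ray h)) ?z > 0 \<longleftrightarrow> ccw (idx (f 1)) (idx (h 1)) (idx (bar (f 0)))"
        using limit_arc[OF r(1)] limit_arc[OF r(2)] z' False nb by (intro orient_letters) (auto simp: tl_ray_def)
      also have "\<dots> \<longleftrightarrow> code f < code h" 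
        using ccw_rank[OF nb] code_less_digit[OF Suc.prems(2,3,4) False] by simp
      finally show ?thesis using e by simp
    qed
  qed
qed

lemma code_inj:
  assumes "reduced f" "reduced h" "f 0 = h 0" "code f = code h" shows "f = h"
proof (rule ccontr)
  assume ne: "f \<noteq> h"
  let ?z = "limit_point g (\<lambda>_. bar (f 0))"
  have red: "reduced (\<lambda>_. bar (f 0))" by (simp add: reduced_def)
  have z: "?z \<in> boundary_arc (D (bar (f 0)))" using limit_arc[OF red] .
  have "\<not> orient (limit_point g f) (limit_point g h) ?z > 0" "\<not> orient (limit_point g h) (limit_point g f) ?z > 0"
    using code_less_iff_orient[OF assms(1,2,3) ne z] code_less_iff_orient[OF assms(2,1) assms(3)[symmetric] ne[symmetric] z] assms by simp_all
  moreover have "orient (limit_point g f) (limit_point g h) ?z \<noteq> 0"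
  proof (rule orient_nonzero)
    show "limit_point g f \<noteq> limit_point g h" using limit_inj[OF assms(1,2)] ne by blast
    show "limit_point g h \<noteq> ?z" "limit_point g f \<noteq> ?z" using limit_inj[OF _ red] assms
      by (metis bar_neq(1))+
  qed (use limit_norm assms red in blast)+
  ultimately show False using orient_swap[of "limit_point g f" "limit_point g h" ?z] by linarith
qed

end

section \<open>The lifts of a closed geodesic\<close>

lemma nth_concat_replicate:
  "i < m * length u \<Longrightarrow> concat (replicate m u) ! i = u ! (i mod length u)"
proof (induction m arbitrary: i)
  case (Suc m)
  show ?case
  proof (cases "i < length u")
    case False
    hence "concat (replicate m u) ! (i - length u) = u ! ((i - length u) mod length u)"
      using Suc.prems by (intro Suc.IH) auto
    thus ?thesis using False by (simp add: nth_append le_mod_geq)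
  qed (simp add: nth_append)
qed simp

lemma length_word_power [simp]: "length (word_power u m) = m * length u"
  by (simp add: word_power_def length_concat sum_list_replicate)

type_synonym state = "int \<times> bool"

definition opp :: "state \<Rightarrow> state" where "opp u = (fst u, \<not> snd u)"

lemma opp_opp [simp]: "opp (opp u) = u" by (simp add: opp_def)
lemma opp_neq [simp]: "opp u \<noteq> u" "u \<noteq> opp u" by (auto simp: opp_def prod_eq_iff)
lemma opp_eq_iff [simp]: "opp u = opp v \<longleftrightarrow> u = v" by (metis opp_opp)

text \<open>A state \<open>(i, b)\<close> is the lift with index \<open>i\<close>, oriented forwards or backwards according to \<open>b\<close>.
  It is identified with the endpoint towards which it is oriented.\<close>

locale schottky_word = schottky +
  fixes w :: "letter list"
  assumes cgw: "closed_geodesic_word w"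
    and prim: "\<And>u m. w = word_power u m \<Longrightarrow> m = 1"
begin

abbreviation L :: int where "L \<equiv> int (length w)"

lemma L_pos: "L > 0" using cgw by (simp add: closed_geodesic_word_def)

definition e :: "int \<Rightarrow> letter" where "e k = w ! nat (k mod L)"

lemma e_periodic: "e (k + j * L) = e k" "e (k + L) = e k" by (simp_all add: e_def)

lemma e_reduced: "e (k + 1) \<noteq> bar (e k)"
proof -
  let ?i = "nat (k mod L)"
  have i: "?i < length w" using L_pos by (simp add: nat_less_iff)
  have "int (Suc ?i mod length w) = (k + 1) mod L"
    using L_pos by (simp add: zmod_int mod_simps add.commute)
  hence "nat ((k + 1) mod L) = Suc ?i mod length w" by (metis nat_int)
  thus ?thesis using cgw i by (simp add: e_def closed_geodesic_word_def)
qed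

lemma e_reduced': "e k \<noteq> bar (e (k + 1))" using e_reduced[of k] by (metis bar_bar)

text \<open>By Bezout the gcd \<open>r\<close> of \<open>d\<close> and \<open>L\<close> is a period
  too, so \<open>w\<close> is a power of its prefix of length \<open>r\<close>; primitivity forces
  \<open>r = L\<close>.\<close>

lemma e_aperiodic:
  assumes p: "\<And>k. e (k + d) = e k" shows "L dvd d"
proof -
  define r where "r = gcd d L"
  have r: "r > 0" "r dvd L" "r dvd d" using L_pos by (auto simp: r_def)
  have px: "e (k + x * d) = e k" for k x
  proof -
    have nonneg: "e (k + int n * d) = e k" for n k
      by (induction n) (use p in \<open>auto simp: algebra_simps\<close>, metis add.assoc add.commute)
    show ?thesis
    proof (cases "x \<ge> 0")
      case True thus ?thesis using nonneg[of k "nat x"] by simp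
    next
      case False thus ?thesis using nonneg[of "k + x * d" "nat (- x)"] by simp
    qed
  qed
  obtain x y where xy: "x * d + y * L = r" using bezout_int[of d L] by (auto simp: r_def)
  have per: "e (k + r) = e k" for k
    using px[of "k + y * L" x] e_periodic(1)[of k y] xy by (simp add: algebra_simps)
  have perj: "e (k + int n * r) = e k" for k n
    by (induction n) (use per in \<open>auto simp: algebra_simps\<close>, metis add.assoc add.commute)
  obtain m where m: "L = r * m" using r by auto
  have m0: "m > 0" using m r L_pos by (metis zero_less_mult_pos)
  let ?u = "take (nat r) w"
  have lr: "nat r \<le> length w" using r zdvd_imp_le[OF r(2) L_pos] by simp
  have len: "length w = nat m * nat r" using m r m0 by (metis mult.commute nat_int nat_mult_distrib less_imp_le)
  have "w = word_power ?u (nat m)"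
  proof (rule nth_equalityI)
    show "length w = length (word_power ?u (nat m))" using lr len by (simp add: min_absorb2)
    fix i assume i: "i < length w"
    have "word_power ?u (nat m) ! i = ?u ! (i mod nat r)"
      unfolding word_power_def using i lr len by (subst nth_concat_replicate) (auto simp: min_absorb2)
    also have "\<dots> = w ! (i mod nat r)" using r by (simp add: nat_less_iff)
    also have "\<dots> = e (int (i mod nat r))"
      using i unfolding e_def by (metis le_less_trans mod_less_eq_dividend nat_int of_nat_mod mod_less)
    also have "\<dots> = e (int (i mod nat r) + int (i div nat r) * r)" by (rule perj[symmetric])
    also have "int (i mod nat r) + int (i div nat r) * r = int i"
      using r by (metis int_nat_eq less_imp_le mod_div_mult_eq of_nat_add of_nat_mult)
    also have "e (int i) = w ! i" using i by (simp add: e_def)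
    finally show "w ! i = word_power ?u (nat m) ! i" ..
  qed
  hence "nat m = 1" by (rule prim)
  hence "m = 1" using m0 by simp
  hence "L = r" using m by simp
  thus ?thesis using r by simp
qed

definition E :: "state set" where "E = {0..<L} \<times> UNIV"

text \<open>The gluing of the sides: \<open>bar (sd u)\<close> carries the lift of \<open>u\<close>
  to the lift of \<open>tau u\<close> (see \<open>g_lift\<close>), and \<open>tau u\<close> points
  back at the side that was just crossed. Accordingly \<open>nx u\<close> continues in the direction
  of \<open>u\<close>.\<close>

definition tau :: "state \<Rightarrow> state" where
  "tau u = ((if snd u then fst u + 1 else fst u - 1) mod L, \<not> snd u)"

definition nx :: "state \<Rightarrow> state" where "nx u = opp (tau u)"

definition ray :: "state \<Rightarrow> nat \<Rightarrow> letter" where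
  "ray u k = (if snd u then e (fst u + int k) else bar (e (fst u - 1 - int k)))"

definition sd :: "state \<Rightarrow> letter" where "sd u = ray u 0"

lemma finite_E: "finite E" by (simp add: E_def)
lemma card_E: "card E = 2 * length w" by (simp add: E_def card_cartesian_product)

lemma opp_E [simp]: "opp u \<in> E \<longleftrightarrow> u \<in> E" by (simp add: E_def opp_def mem_Times_iff)
lemma tau_E [simp]: "tau u \<in> E" using L_pos by (simp add: E_def tau_def)
lemma nx_E [simp]: "nx u \<in> E" by (simp add: nx_def)

lemma tau_tau: "u \<in> E \<Longrightarrow> tau (tau u) = u"
  by (cases u) (auto simp: E_def tau_def mod_simps)

lemma snd_nx [simp]: "snd (nx u) = snd u" by (simp add: nx_def opp_def tau_def)
lemma snd_tau [simp]: "snd (tau u) = (\<not> snd u)" by (simp add: tau_def)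

lemma e_mod_add: "e (k mod L + j) = e (k + j)" "e (k mod L - j) = e (k - j)"
  by (simp_all add: e_def mod_simps)

lemma ray_tau_0: "ray (tau u) 0 = bar (sd u)"
  using e_mod_add(2)[of "fst u + 1" 1] e_mod_add(1)[of "fst u - 1" 0] by (auto simp: ray_def tau_def sd_def)

lemma ray_tau_Suc: "ray (tau u) (Suc k) = ray (opp u) k"
  using e_mod_add(2)[of "fst u + 1" "2 + int k"] e_mod_add(1)[of "fst u - 1" "1 + int k"]
  by (auto simp: ray_def tau_def opp_def algebra_simps)

lemma ray_nx: "ray (nx u) k = ray u (Suc k)"
  using e_mod_add(2)[of "fst u - 1" "1 + int k"] e_mod_add(1)[of "fst u + 1" "int k"]
  by (auto simp: ray_def nx_def tau_def opp_def algebra_simps)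

lemma sd_tau [simp]: "sd (tau u) = bar (sd u)" using ray_tau_0 by (simp add: sd_def)

lemma tl_ray_tau: "tl_ray (ray (tau u)) = ray (opp u)" by (simp add: fun_eq_iff tl_ray_def ray_tau_Suc)
lemma tl_ray_ray: "tl_ray (ray u) = ray (nx u)" by (simp add: fun_eq_iff tl_ray_def ray_nx)

lemma ray_reduced: "reduced (ray u)"
  unfolding reduced_def
proof
  fix k
  show "ray u (Suc k) \<noteq> bar (ray u k)"
    unfolding ray_def using e_reduced[of "fst u + int k"] e_reduced'[of "fst u - 2 - int k"] e_reduced[of "fst u - 2 - int k"] by (auto simp: algebra_simps)
qed

lemma sd_opp: "sd (opp u) \<noteq> sd u" "sd u \<noteq> sd (opp u)"
  using e_reduced[of "fst u - 1"] e_reduced'[of "fst u - 1"] by (auto simp: sd_def ray_def opp_def)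

lemma opp_nx: "opp (nx u) = tau u" by (simp add: nx_def)

text \<open>For equal directions, equal rays make the index difference a period. For opposite
  directions the periodic word would contain a stretch that is its own inverse.\<close>

lemma ray_inj: assumes uv: "u \<in> E" "v \<in> E" and eq: "ray u = ray v" shows "u = v"
proof -
  obtain i b j c where d: "u = (i, b)" "v = (j, c)" by (metis surj_pair)
  have ij: "0 \<le> i" "i < L" "0 \<le> j" "j < L" using uv d by (auto simp: E_def)
  have dvd: "i = j" if "L dvd i - j"
    using that ij by (metis zdiff_int_split mod_eq_dvd_iff mod_pos_pos_trivial)
  \<comment> \<open>Adding \<open>\<bar>m\<bar> * L\<close> makes an index nonnegative without
    changing its letter; this extends equality of the rays to all integers.\<close>
  have big: "0 \<le> m + \<bar>m\<bar> * L" "0 \<le> - m + \<bar>m\<bar> * L" for m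
  proof -
    have "\<bar>m\<bar> * 1 \<le> \<bar>m\<bar> * L" using L_pos by (intro mult_left_mono) linarith+
    thus "0 \<le> m + \<bar>m\<bar> * L" "0 \<le> - m + \<bar>m\<bar> * L" by linarith+
  qed
  have opposite: False if h: "\<And>k. k \<ge> 0 \<Longrightarrow> e (i + k) = bar (e (j - 1 - k))" and ij: "0 \<le> i" "i < L" "0 \<le> j" for i j
  proof -
    \<comment> \<open>The stretch from \<open>i\<close> to \<open>i + n\<close> is its own inverse:
      for even \<open>n\<close> its middle letter would be its own inverse, for odd \<open>n\<close>
      two neighbours would be inverse to each other.\<close>
    define n where "n = j + L - 1 - i"
    have n: "n \<ge> 0" using ij by (simp add: n_def)
    have h': "e (i + k) = bar (e (i + n - k))" if "k \<ge> 0" for k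
      using h[OF that] e_periodic(2)[of "j - 1 - k"] by (simp add: n_def algebra_simps)
    show False
    proof (cases "even n")
      case True
      then obtain k where k: "n = 2 * k" by blast
      have ik: "i + n - k = i + k" using k by simp
      have "k \<ge> 0" using n k by simp
      thus False using h'[of k] unfolding ik by simp
    next
      case False
      then obtain k where "n = 2 * k + 1" by (metis oddE)
      thus False using h'[of k] n e_reduced'[of "i + k"] by (simp add: algebra_simps)
    qed
  qed
  show ?thesis
  proof (cases b; cases c)
    assume bc: b c
    have h: "e (i + k) = e (j + k)" if "k \<ge> 0" for k
      using fun_cong[OF eq, of "nat k"] d bc that by (simp add: ray_def)
    have "L dvd i - j"
    proof (rule e_aperiodic)
      fix k
      have "e (i + (k - j + \<bar>k - j\<bar> * L)) = e (j + (k - j + \<bar>k - j\<bar> * L))" using h big by blast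
      thus "e (k + (i - j)) = e k" using e_periodic(1)[of "k + (i - j)" "\<bar>k - j\<bar>"] e_periodic(1)[of k "\<bar>k - j\<bar>"]
        by (simp add: algebra_simps)
    qed
    thus ?thesis using dvd d bc by simp
  next
    assume bc: "\<not> b" "\<not> c"
    have h: "e (i - 1 - k) = e (j - 1 - k)" if "k \<ge> 0" for k
      using fun_cong[OF eq, of "nat k"] d bc that by (simp add: ray_def)
    have "L dvd j - i"
    proof (rule e_aperiodic)
      fix k
      define n where "n = i - 1 - k"
      have "e (i - 1 - (n + \<bar>n\<bar> * L)) = e (j - 1 - (n + \<bar>n\<bar> * L))" using h big by blast
      moreover have "i - 1 - (n + \<bar>n\<bar> * L) = k + (- \<bar>n\<bar>) * L" "j - 1 - (n + \<bar>n\<bar> * L) = k + (j - i) + (- \<bar>n\<bar>) * L"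
        by (simp_all add: n_def algebra_simps)
      ultimately show "e (k + (j - i)) = e k" by (simp only: e_periodic)
    qed
    thus ?thesis using dvd d bc by (simp add: dvd_diff_commute)
  next
    assume bc: b "\<not> c"
    have False
    proof (rule opposite[of i j])
      fix k :: int assume "k \<ge> 0"
      thus "e (i + k) = bar (e (j - 1 - k))" using fun_cong[OF eq, of "nat k"] d bc by (simp add: ray_def)
    qed (use ij in auto)
    thus ?thesis ..
  next
    assume bc: "\<not> b" c
    have False
    proof (rule opposite[of j i])
      fix k :: int assume "k \<ge> 0"
      thus "e (j + k) = bar (e (i - 1 - k))" using fun_cong[OF eq, of "nat k"] d bc by (simp add: ray_def)
    qed (use ij in auto)
    thus ?thesis ..
  qed
qed

definition pt :: "state \<Rightarrow> complex" where "pt u = limit_point g (ray u)"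

definition lift :: "state \<Rightarrow> complex set" where "lift u = geodesic (pt (opp u)) (pt u)"

definition cd :: "state \<Rightarrow> real" where "cd u = code (ray u)"

lemma pt_arc: "pt u \<in> boundary_arc (D (sd u))"
  using limit_arc[OF ray_reduced] by (simp add: pt_def sd_def)

lemma pt_norm [simp]: "cmod (pt u) = 1" using limit_norm[OF ray_reduced] by (simp add: pt_def)

lemma pt_inj: "u \<in> E \<Longrightarrow> v \<in> E \<Longrightarrow> pt u = pt v \<longleftrightarrow> u = v"
  unfolding pt_def using limit_inj[OF ray_reduced ray_reduced] ray_inj by blast

lemma pt_opp_neq [simp]: "pt (opp u) \<noteq> pt u"
  using pt_arc arc_disjoint sd_opp by metis

lemma g_pt: "g (bar (sd u)) (pt u) = pt (nx u)"
  using limit_tl'[OF ray_reduced, of u] by (simp add: pt_def sd_def tl_ray_ray)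

lemma g_pt_opp: "g (bar (sd u)) (pt (opp u)) = pt (tau u)"
  using limit_tl[OF ray_reduced, of "tau u"] by (simp add: pt_def tl_ray_tau ray_tau_0)

lemma lift_opp: "lift (opp u) = lift u"
  unfolding lift_def by (simp add: geodesic_commute)

lemma lift_ball: "lift u \<subseteq> ball 0 1"
  unfolding lift_def by (auto simp: geodesic_klein(1))

lemma lift_eq_iff: assumes "u \<in> E" "v \<in> E" shows "lift u = lift v \<longleftrightarrow> v = u \<or> v = opp u"
proof
  assume "lift u = lift v"
  hence "{pt (opp u), pt u} = {pt (opp v), pt v}" unfolding lift_def by (intro geodesic_eq) auto
  hence "pt v = pt u \<or> pt v = pt (opp u)" by auto
  thus "v = u \<or> v = opp u" using assms by (simp add: pt_inj)
qed (auto simp: lift_opp)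

lemma g_lift: "g (bar (sd u)) ` lift u = lift (tau u)"
proof
  have o: "opp (tau u) = nx u" by (simp add: nx_def)
  have l: "lift (tau u) = geodesic (pt (tau u)) (pt (nx u))"
    using lift_opp[of "tau u"] by (simp add: lift_def o[symmetric])
  show 1: "g (bar (sd u)) ` lift u \<subseteq> lift (tau u)"
    unfolding l lift_def[of u] using geodesic_image[OF g_disk_map[of "bar (sd u)"], of "pt (opp u)" "pt u"] by (simp only: g_pt g_pt_opp)
  have "g (sd u) ` lift (tau u) \<subseteq> lift u"
  proof -
    have "g (sd u) (pt (tau u)) = pt (opp u)" "g (sd u) (pt (nx u)) = pt u"
      by (simp_all add: g_pt[symmetric] g_pt_opp[symmetric] bar_g)
    thus ?thesis unfolding l lift_def[of u] using geodesic_image[OF g_disk_map[of "sd u"], of "pt (tau u)" "pt (nx u)"] by simp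
  qed
  thus "lift (tau u) \<subseteq> g (bar (sd u)) ` lift u"
  proof (intro subsetI)
    fix z assume z: "z \<in> lift (tau u)" and s: "g (sd u) ` lift (tau u) \<subseteq> lift u"
    have "z = g (bar (sd u)) (g (sd u) z)" using g_bar[of z "sd u"] z lift_ball by fastforce
    thus "z \<in> g (bar (sd u)) ` lift u" using s z by blast
  qed
qed

definition meets :: "state \<Rightarrow> state \<Rightarrow> bool" where "meets u v \<longleftrightarrow> lift u \<inter> lift v \<noteq> {}"

lemma meets_opp [simp]: "meets (opp u) v = meets u v" "meets u (opp v) = meets u v"
  by (simp_all add: meets_def lift_opp)

lemma meets_iff_orient:
  assumes "u \<in> E" "v \<in> E" "v \<noteq> u" "v \<noteq> opp u"
  shows "meets u v \<longleftrightarrow> (orient (pt u) (pt (opp u)) (pt v) > 0 \<longleftrightarrow> \<not> orient (pt u) (pt (opp u)) (pt (opp v)) > 0)"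
proof -
  have "opp v \<noteq> u" "opp v \<noteq> opp u" using assms by auto
  hence "geodesic (pt u) (pt (opp u)) \<inter> geodesic (pt (opp v)) (pt v) \<noteq> {} \<longleftrightarrow>
     (orient (pt u) (pt (opp u)) (pt (opp v)) > 0 \<longleftrightarrow> \<not> orient (pt u) (pt (opp u)) (pt v) > 0)"
    using assms by (intro geodesic_intersect_iff) (simp_all add: pt_inj)
  moreover have "meets u v = meets (opp u) v" by simp
  ultimately show ?thesis unfolding meets_def lift_def opp_opp by blast
qed

lemma cd_inj: "u \<in> E \<Longrightarrow> v \<in> E \<Longrightarrow> sd u = sd v \<Longrightarrow> cd u = cd v \<longleftrightarrow> u = v"
  unfolding cd_def using code_inj[OF ray_reduced ray_reduced] ray_inj by (metis sd_def)

lemma cd_less_orient: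
  assumes "u \<in> E" "v \<in> E" "sd u = sd v" "u \<noteq> v" "sd z \<noteq> sd u"
  shows "cd u < cd v \<longleftrightarrow> orient (pt u) (pt v) (pt z) > 0"
  unfolding cd_def pt_def
  using assms ray_inj[of u v] limit_arc[OF ray_reduced, of z]
  by (intro code_less_iff_orient[OF ray_reduced ray_reduced, where u="sd z"]) (auto simp: sd_def)

text \<open>The front ends lie in the arc of \<open>sd u\<close> and are ordered by
  \<open>cd\<close>. After applying \<open>bar (sd u)\<close> the back ends lie in the arc of
  \<open>sd (tau u)\<close> and are ordered by \<open>cd\<close> of \<open>tau\<close>. The four
  ends alternate on the circle exactly if both anticlockwise orders agree.\<close>

lemma meets_shared:
  assumes u: "u \<in> E" "v \<in> E" "sd u = sd v" "u \<noteq> v"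
  shows "meets u v \<longleftrightarrow> (cd u < cd v \<longleftrightarrow> cd (tau u) < cd (tau v))"
proof -
  have ne: "v \<noteq> opp u" using u(3) sd_opp by metis
  have nt: "tau u \<noteq> tau v" using u tau_tau by metis
  have "pt u \<noteq> pt v" "pt u \<noteq> pt (opp u)" "pt v \<noteq> pt (opp u)" using u ne pt_inj pt_opp_neq by (metis opp_E)+
  hence nz: "orient (pt u) (pt v) (pt (opp u)) \<noteq> 0" by (intro orient_nonzero) auto
  have 1: "orient (pt u) (pt (opp u)) (pt v) > 0 \<longleftrightarrow> \<not> cd u < cd v"
  proof -
    have "cd u < cd v \<longleftrightarrow> orient (pt u) (pt v) (pt (opp u)) > 0"
      using u sd_opp[of u] by (intro cd_less_orient) auto
    moreover have "orient (pt u) (pt (opp u)) (pt v) = - orient (pt u) (pt v) (pt (opp u))"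
      using orient_cycle[of "pt u" "pt (opp u)" "pt v"] orient_swap[of "pt (opp u)" "pt v" "pt u"]
        orient_cycle[of "pt v" "pt (opp u)" "pt u"] orient_cycle[of "pt (opp u)" "pt u" "pt v"] orient_cycle[of "pt v" "pt u" "pt (opp u)"]
        orient_swap[of "pt v" "pt u" "pt (opp u)"] by linarith
    ultimately show ?thesis using nz by auto
  qed
  have 2: "orient (pt u) (pt (opp u)) (pt (opp v)) > 0 \<longleftrightarrow> cd (tau u) < cd (tau v)"
  proof -
    have "orient (pt u) (pt (opp u)) (pt (opp v)) > 0 \<longleftrightarrow> orient (g (bar (sd u)) (pt u)) (g (bar (sd u)) (pt (opp u))) (g (bar (sd u)) (pt (opp v))) > 0"
      by (rule orient_disk_map[OF g_disk_map, symmetric]) auto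
    also have "\<dots> \<longleftrightarrow> orient (pt (nx u)) (pt (tau u)) (pt (tau v)) > 0"
      unfolding g_pt g_pt_opp using g_pt_opp[of v] u(3) by simp
    also have "\<dots> \<longleftrightarrow> orient (pt (tau u)) (pt (tau v)) (pt (nx u)) > 0" by (simp only: orient_cycle[of "pt (nx u)"])
    also have "\<dots> \<longleftrightarrow> cd (tau u) < cd (tau v)"
      using u nt sd_opp[of "tau u"] by (intro cd_less_orient[symmetric]) (auto simp: nx_def)
    finally show ?thesis .
  qed
  show ?thesis unfolding meets_iff_orient[OF u(1,2) u(4)[symmetric] ne] 1 2 by blast
qed

lemma meets_letters:
  assumes u: "u \<in> E" "v \<in> E" "distinct [sd u, sd (opp u), sd v, sd (opp v)]"
  shows "meets u v \<longleftrightarrow> (ccw (idx (sd u)) (idx (sd (opp u))) (idx (sd v)) \<longleftrightarrow> \<not> ccw (idx (sd u)) (idx (sd (opp u))) (idx (sd (opp v))))"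
proof -
  have "v \<noteq> u" "v \<noteq> opp u" using u by auto
  moreover have "orient (pt u) (pt (opp u)) (pt v) > 0 \<longleftrightarrow> ccw (idx (sd u)) (idx (sd (opp u))) (idx (sd v))"
    "orient (pt u) (pt (opp u)) (pt (opp v)) > 0 \<longleftrightarrow> ccw (idx (sd u)) (idx (sd (opp u))) (idx (sd (opp v)))"
    using u(3) by (intro orient_letters pt_arc; simp)+
  ultimately show ?thesis using meets_iff_orient[OF u(1,2)] by simp
qed

end

section \<open>Classes of crossing pairs and the upper bound\<close>

lemma crossing_letters:
  assumes "distinct [s, t, x, y]" "ccw (idx s) (idx t) (idx x) \<longleftrightarrow> \<not> ccw (idx s) (idx t) (idx y)"
  shows "{s, t} = {GenA, GenB} \<and> {x, y} = {InvB, InvA} \<or> {x, y} = {GenA, GenB} \<and> {s, t} = {InvB, InvA}"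
  using assms by (cases s; cases t; cases x; cases y) (simp_all add: ccw_def insert_commute)

context schottky_word
begin

abbreviation P where "P \<equiv> intersecting_pairs g w"
abbreviation R where "R \<equiv> pair_equiv g w"

definition pr :: "state \<Rightarrow> state \<Rightarrow> complex set set" where "pr u v = {lift u, lift v}"

definition cl :: "state \<Rightarrow> state \<Rightarrow> complex set set set" where "cl u v = R `` {pr u v}"

definition crossing :: "state \<Rightarrow> state \<Rightarrow> bool" where
  "crossing u v \<longleftrightarrow> u \<in> E \<and> v \<in> E \<and> v \<noteq> u \<and> v \<noteq> opp u \<and> meets u v"

lemma geodesic_lift: assumes "i < length w" shows "geodesic_lift g w i = lift (int i, True)"
proof -
  have "nat ((int i + int k) mod L) = (i + k) mod length w" for k
    by (metis nat_int of_nat_add zmod_int)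
  hence "lift_pos g w i = pt (int i, True)" by (simp add: lift_pos_def pt_def ray_def[abs_def] e_def)
  moreover have "lift_neg g w i = pt (opp (int i, True))"
    by (simp add: lift_neg_def pt_def ray_def[abs_def] e_def opp_def)
  ultimately show ?thesis by (simp add: geodesic_lift_def lift_def)
qed

lemma lift_fst: "lift u = lift (fst u, True)"
  using lift_opp[of "(fst u, True)"] by (cases u; cases "snd u") (auto simp: opp_def)

lemma pairs_eq: "P = {pr u v | u v. crossing u v}"
proof (intro equalityI subsetI)
  fix p assume "p \<in> P"
  then obtain i j where ij: "i < length w" "j < length w" "i \<noteq> j" "p = {geodesic_lift g w i, geodesic_lift g w j}"
    "geodesic_lift g w i \<inter> geodesic_lift g w j \<noteq> {}" by (auto simp: intersecting_pairs_def)
  hence "crossing (int i, True) (int j, True)" "p = pr (int i, True) (int j, True)"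
    by (auto simp: crossing_def E_def opp_def meets_def geodesic_lift pr_def)
  thus "p \<in> {pr u v | u v. crossing u v}" by blast
next
  fix p assume "p \<in> {pr u v | u v. crossing u v}"
  then obtain u v where uv: "crossing u v" "p = pr u v" by blast
  define i j where "i = nat (fst u)" and "j = nat (fst v)"
  have i: "i < length w" "j < length w" "int i = fst u" "int j = fst v"
    using uv(1) by (auto simp: crossing_def E_def i_def j_def)
  have "i \<noteq> j" using uv(1) i by (auto simp: crossing_def opp_def prod_eq_iff)
  moreover have "lift u = geodesic_lift g w i" "lift v = geodesic_lift g w j"
    using i lift_fst[of u] lift_fst[of v] by (simp_all add: geodesic_lift)
  ultimately have "p = {geodesic_lift g w i, geodesic_lift g w j} \<and> i < length w \<and> j < length w \<and> i \<noteq> j \<and>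
      geodesic_lift g w i \<inter> geodesic_lift g w j \<noteq> {}"
    using uv i by (simp add: crossing_def meets_def pr_def)
  thus "p \<in> P" unfolding intersecting_pairs_def by blast
qed

lemma pr_in_P: "crossing u v \<Longrightarrow> pr u v \<in> P" unfolding pairs_eq by blast

lemma pr_commute: "pr u v = pr v u" by (auto simp: pr_def)
lemma pr_opp [simp]: "pr (opp u) v = pr u v" "pr u (opp v) = pr u v" by (auto simp: pr_def lift_opp)

lemma crossing_opp [simp]: "crossing (opp u) v = crossing u v" "crossing u (opp v) = crossing u v"
  by (auto simp: crossing_def)

lemma finite_P: "finite P"
proof -
  have "P \<subseteq> (\<lambda>(u, v). pr u v) ` (E \<times> E)" by (auto simp: pairs_eq crossing_def)
  thus ?thesis using finite_E finite_subset by blast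
qed

lemma P_ball: "p \<in> P \<Longrightarrow> S \<in> p \<Longrightarrow> S \<subseteq> ball 0 1"
  using lift_ball by (auto simp: pairs_eq pr_def)

lemma equiv_R: "equiv P R"
proof (rule equivI)
  show "R \<subseteq> P \<times> P" by (auto simp: pair_equiv_def)
  show "refl_on P R" unfolding refl_on_def
    by (auto simp: pair_equiv_def intro!: exI[of _ "[]"])
  show "sym R"
  proof (rule symI)
    fix p q assume "(p, q) \<in> R"
    then obtain xs where x: "p \<in> P" "q \<in> P" "q = (\<lambda>S. word_act g xs ` S) ` p" by (auto simp: pair_equiv_def)
    have "word_act g (inverse_word xs) ` word_act g xs ` S = S" if "S \<in> p" for S
    proof -
      have "word_act g (inverse_word xs) (word_act g xs z) = z" if "z \<in> S" for z
        using word_act_inverse[of z xs] P_ball[OF x(1) \<open>S \<in> p\<close>] that by force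
      thus ?thesis by (force simp: image_image)
    qed
    hence "(\<lambda>S. word_act g (inverse_word xs) ` S) ` q = p" unfolding x(3) image_image by (simp add: image_image[symmetric])
    thus "(q, p) \<in> R" using x unfolding pair_equiv_def by blast
  qed
  show "trans R"
  proof (rule transI)
    fix p q r assume "(p, q) \<in> R" "(q, r) \<in> R"
    then obtain xs ys where x: "p \<in> P" "q \<in> P" "r \<in> P" "q = (\<lambda>S. word_act g xs ` S) ` p" "r = (\<lambda>S. word_act g ys ` S) ` q"
      by (auto simp: pair_equiv_def)
    have "(\<lambda>S. word_act g (ys @ xs) ` S) ` p = r" unfolding x(4,5) image_image
      by (simp add: word_act_append image_image)
    thus "(p, r) \<in> R" using x unfolding pair_equiv_def by blast
  qed
qed

lemma crossing_tau: assumes "crossing u v" "sd u = sd v" shows "crossing (tau u) (tau v)"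
proof -
  have "meets (tau u) (tau v)"
    using assms unfolding meets_def crossing_def g_lift[symmetric] by auto
  moreover have "tau v \<noteq> tau u" using assms tau_tau unfolding crossing_def by metis
  moreover have "tau v \<noteq> opp (tau u)" using assms sd_opp(1)[of "tau u"] by (metis sd_tau)
  ultimately show ?thesis by (simp add: crossing_def)
qed

lemma cl_tau: assumes "crossing u v" "sd u = sd v" shows "cl (tau u) (tau v) = cl u v"
proof -
  have "(\<lambda>S. word_act g [bar (sd u)] ` S) ` pr u v = pr (tau u) (tau v)"
    using assms(2) g_lift[of u] g_lift[of v] by (simp add: pr_def)
  hence "(pr u v, pr (tau u) (tau v)) \<in> R"
    using pr_in_P[OF assms(1)] pr_in_P[OF crossing_tau[OF assms]] unfolding pair_equiv_def by blast
  thus ?thesis unfolding cl_def using equiv_class_eq[OF equiv_R] by metis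
qed

lemma cl_opp [simp]: "cl (opp u) v = cl u v" "cl u (opp v) = cl u v" by (simp_all add: cl_def)
lemma cl_commute: "cl u v = cl v u" by (simp add: cl_def pr_commute)

lemma ray_funpow: "ray ((nx ^^ n) u) k = ray u (n + k)"
  by (induction n arbitrary: k) (simp_all add: ray_nx)

lemma sd_funpow: "sd ((nx ^^ n) u) = ray u n" using ray_funpow[of n u 0] by (simp add: sd_def)

lemma funpow_E: "u \<in> E \<Longrightarrow> (nx ^^ n) u \<in> E" by (induction n) auto

lemma snd_funpow [simp]: "snd ((nx ^^ n) u) = snd u" by (induction n) auto

lemma chain_class:
  assumes "crossing u v" "\<And>k. k < n \<Longrightarrow> ray u k = ray v k"
  shows "crossing ((nx ^^ n) u) ((nx ^^ n) v) \<and> cl ((nx ^^ n) u) ((nx ^^ n) v) = cl u v"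
  using assms(2)
proof (induction n)
  case (Suc n)
  have c: "crossing ((nx ^^ n) u) ((nx ^^ n) v)" "cl ((nx ^^ n) u) ((nx ^^ n) v) = cl u v" using Suc by auto
  have s: "sd ((nx ^^ n) u) = sd ((nx ^^ n) v)" using Suc.prems by (simp add: sd_funpow)
  show ?case using crossing_tau[OF c(1) s] cl_tau[OF c(1) s] c(2) by (simp add: nx_def[of "(nx ^^ n) _"])
qed (use assms(1) in simp)

lemma ray_back: "k \<le> n \<Longrightarrow> ray (tau ((nx ^^ n) u)) k = bar (ray u (n - k))"
proof (induction k arbitrary: n)
  case 0 thus ?case by (simp add: ray_tau_0 sd_funpow)
next
  case (Suc k)
  then obtain m where m: "n = Suc m" by (cases n) auto
  have "ray (tau ((nx ^^ n) u)) (Suc k) = ray (opp ((nx ^^ n) u)) k" by (rule ray_tau_Suc)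
  also have "\<dots> = ray (tau ((nx ^^ m) u)) k" by (simp add: m opp_nx)
  also have "\<dots> = bar (ray u (m - k))" using Suc m by simp
  finally show ?case by (simp add: m)
qed

text \<open>A flag is a pair of lifts that share a side of the fundamental domain and separate on its other
  side. A class of crossing pairs either consists of one crossing of two diagonals of the domain, or
  it is a chain of pairs that starts and ends with a flag; the two flags are different since a word
  cannot be its own inverse. As flags are ordered pairs, each chain accounts for four of them.\<close>

definition flags :: "(state \<times> state) set" where
  "flags = {(u, v) \<in> E \<times> E. sd u = sd v \<and> sd (opp u) \<noteq> sd (opp v)}"

definition diagonal_pairs :: "(state \<times> state) set" where
  "diagonal_pairs = {(u, v) \<in> E \<times> E. (sd u = GenA \<and> sd (opp u) = GenB) \<and> (sd v = InvB \<and> sd (opp v) = InvA)}"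

text \<open>The middle letter would be its own inverse, or the two middle letters would
  cancel.\<close>

lemma no_palindrome:
  assumes "\<And>k. k \<le> n \<Longrightarrow> ray u k = bar (ray u (n - k))" shows False
proof (cases "even n")
  case True
  then obtain m where "n = 2 * m" by blast
  thus False using assms[of m] by simp
next
  case False
  then obtain m where m: "n = 2 * m + 1" by (metis oddE)
  have "ray u (Suc m) \<noteq> bar (ray u m)" using ray_reduced by (simp add: reduced_def)
  thus False using assms[of "Suc m"] m by simp
qed

lemma end_flag:
  assumes c: "crossing u v" "sd u = sd v"
  obtains y z where "(y, z) \<in> flags" "crossing y z" "cl y z = cl u v" "y \<noteq> u" "y \<noteq> v" "z \<noteq> u" "z \<noteq> v"
proof -
  have uv: "u \<in> E" "v \<in> E" "u \<noteq> v" using c by (auto simp: crossing_def)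
  hence "\<exists>k. ray u k \<noteq> ray v k" using ray_inj by blast
  define N where "N = (LEAST k. ray u k \<noteq> ray v k)"
  have N: "ray u N \<noteq> ray v N" unfolding N_def using \<open>\<exists>k. ray u k \<noteq> ray v k\<close> by (rule LeastI_ex)
  have less: "ray u k = ray v k" if "k < N" for k using not_less_Least[of k "\<lambda>k. ray u k \<noteq> ray v k"] that by (auto simp: N_def)
  have "N \<noteq> 0" using N c(2) by (metis sd_def)
  then obtain n where n: "N = Suc n" by (cases N) auto
  \<comment> \<open>The last shared side seen from beyond: \<open>opp y\<close> and
    \<open>opp z\<close> part at once, while \<open>y\<close> and \<open>z\<close> look back along
    the common word.\<close>
  define y z where "y = tau ((nx ^^ n) u)" and "z = tau ((nx ^^ n) v)"
  have o: "opp y = (nx ^^ N) u" "opp z = (nx ^^ N) v" by (simp_all add: y_def z_def n nx_def)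
  have E: "y \<in> E" "z \<in> E" by (simp_all add: y_def z_def)
  have "sd y = sd z" using less[of n] n by (simp add: y_def z_def sd_funpow)
  moreover have "sd (opp y) \<noteq> sd (opp z)" unfolding o sd_funpow by (rule N)
  ultimately have f: "(y, z) \<in> flags" using E by (simp add: flags_def)
  have ch: "crossing (opp y) (opp z)" "cl (opp y) (opp z) = cl u v"
    unfolding o using chain_class[OF c(1), of N] less by auto
  have yb: "ray y k = bar (ray u (n - k))" "ray z k = bar (ray u (n - k))" if "k \<le> n" for k
    using ray_back[OF that] that less[of "n - k"] n by (simp_all add: y_def z_def)
  have "y \<noteq> u" "z \<noteq> u" using yb no_palindrome[of n u] by auto
  moreover have "y \<noteq> v" "z \<noteq> v" using yb no_palindrome[of n u] less n by (metis le_imp_less_Suc)+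
  ultimately show ?thesis using that f ch by simp
qed

lemma class_cases:
  assumes c: "crossing u v"
  shows "(\<exists>(y, z)\<in>diagonal_pairs. cl y z = cl u v) \<or> 4 \<le> card {(y, z) \<in> flags. cl y z = cl u v}"
proof (cases "\<exists>a\<in>{u, opp u}. \<exists>b\<in>{v, opp v}. sd a = sd b")
  case False
  have uv: "u \<in> E" "v \<in> E" using c by (auto simp: crossing_def)
  have d: "distinct [sd u, sd (opp u), sd v, sd (opp v)]" using False sd_opp[of u] sd_opp[of v] by auto
  hence "{sd u, sd (opp u)} = {GenA, GenB} \<and> {sd v, sd (opp v)} = {InvB, InvA} \<or> {sd v, sd (opp v)} = {GenA, GenB} \<and> {sd u, sd (opp u)} = {InvB, InvA}"
    using c meets_letters[OF uv d] by (intro crossing_letters) (auto simp: crossing_def)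
  moreover have *: "\<exists>(y, z)\<in>diagonal_pairs. cl y z = cl u v"
    if "{sd u, sd (opp u)} = {GenA, GenB}" "{sd v, sd (opp v)} = {InvB, InvA}" "u \<in> E" "v \<in> E" for u v
  proof -
    define y where "y = (if sd u = GenA then u else opp u)"
    define z where "z = (if sd v = InvB then v else opp v)"
    have "sd y = GenA \<and> sd (opp y) = GenB" using that(1) by (auto simp: y_def doubleton_eq_iff)
    moreover have "sd z = InvB \<and> sd (opp z) = InvA" using that(2) by (auto simp: z_def doubleton_eq_iff)
    moreover have "cl y z = cl u v" by (simp add: y_def z_def)
    moreover have "y \<in> E" "z \<in> E" using that by (simp_all add: y_def z_def)
    ultimately show ?thesis unfolding diagonal_pairs_def by blast
  qed
  ultimately show ?thesis using *[OF _ _ uv] *[OF _ _ uv(2,1), unfolded cl_commute[of v u]] by blast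
next
  case True
  then obtain a b where ab: "crossing a b" "cl a b = cl u v" "sd a = sd b" using c by force
  obtain p q where pq: "(p, q) \<in> flags" "crossing p q" "cl p q = cl u v"
    using end_flag[OF ab(1,3)] ab(2) by metis
  have s: "sd p = sd q" "p \<noteq> q" using pq(1) by (auto simp: flags_def)
  \<comment> \<open>The flag \<open>(p, q)\<close> looks back along the chain, so a second search
    starting from it finds the other end.\<close>
  obtain y z where yz: "(y, z) \<in> flags" "crossing y z" "cl y z = cl u v" "y \<noteq> p" "y \<noteq> q" "z \<noteq> p" "z \<noteq> q"
    using end_flag[OF pq(2) s(1)] pq(3) by metis
  have s': "y \<noteq> z" using yz(1) by (auto simp: flags_def)
  have fs: "(q, p) \<in> flags" "(z, y) \<in> flags" using pq yz by (auto simp: flags_def)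
  have "{(p, q), (q, p), (y, z), (z, y)} \<subseteq> {(y, z) \<in> flags. cl y z = cl u v}"
    using pq yz fs cl_commute by auto
  moreover have "finite flags" unfolding flags_def using finite_E by (auto intro: finite_subset[of _ "E \<times> E"])
  hence "finite {(y, z) \<in> flags. cl y z = cl u v}" by (rule rev_finite_subset) auto
  ultimately have "card {(p, q), (q, p), (y, z), (z, y)} \<le> card {(y, z) \<in> flags. cl y z = cl u v}"
    by (rule card_mono[rotated])
  moreover have "card {(p, q), (q, p), (y, z), (z, y)} = 4" using s s' yz by simp
  ultimately show ?thesis by simp
qed

lemma finite_flags: "finite flags" "finite diagonal_pairs"
  unfolding flags_def diagonal_pairs_def using finite_E by (auto intro: finite_subset[of _ "E \<times> E"])

text \<open>Classes in the image of \<open>diagonal_pairs\<close> are counted by that set; the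
  remaining ones have disjoint fibres of at least four flags each.\<close>

lemma card_classes_le: "4 * card (P // R) \<le> 4 * card diagonal_pairs + card flags"
proof -
  let ?k = "\<lambda>(y, z). cl y z"
  define Q1 where "Q1 = (P // R) \<inter> ?k ` diagonal_pairs"
  define Q2 where "Q2 = (P // R) - Q1"
  have fin: "finite (P // R)" using finite_P by (rule finite_quotient) (auto simp: pair_equiv_def)
  have "4 \<le> card {f \<in> flags. ?k f = q}" if q: "q \<in> Q2" for q
  proof -
    obtain p where p: "p \<in> P" "q = R `` {p}" using q unfolding Q2_def by (auto elim: quotientE)
    then obtain u v where uv: "crossing u v" "p = pr u v" by (auto simp: pairs_eq)
    have "q = cl u v" using p uv by (simp add: cl_def)
    moreover from this have "\<not> (\<exists>(y, z)\<in>diagonal_pairs. cl y z = cl u v)" using q unfolding Q1_def Q2_def by force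
    ultimately have "4 \<le> card {(y, z) \<in> flags. cl y z = q}" using class_cases[OF uv(1)] by simp
    also have "{(y, z) \<in> flags. cl y z = q} = {f \<in> flags. ?k f = q}" by auto
    finally show ?thesis .
  qed
  hence "(\<Sum>q\<in>Q2. 4) \<le> (\<Sum>q\<in>Q2. card {f \<in> flags. ?k f = q})" by (rule sum_mono)
  also have "\<dots> = card (\<Union>q\<in>Q2. {f \<in> flags. ?k f = q})"
    using fin finite_flags by (intro card_UN_disjoint[symmetric]) (auto simp: Q2_def)
  also have "\<dots> \<le> card flags" using finite_flags by (intro card_mono) auto
  finally have "4 * card Q2 \<le> card flags" by simp
  moreover have "card Q1 \<le> card diagonal_pairs"
    unfolding Q1_def using finite_flags by (meson card_image_le card_mono finite_imageI inf_le2 le_trans)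
  moreover have "card (P // R) = card Q1 + card Q2"
    unfolding Q2_def using fin by (subst card_Diff_subset) (auto simp: Q1_def intro: card_mono le_add_diff_inverse[symmetric])
  ultimately show ?thesis by simp
qed

section \<open>Counting the lifts by the two sides they join\<close>

definition turns :: "letter \<Rightarrow> letter \<Rightarrow> nat" where
  "turns s t = card {u \<in> E. sd u = s \<and> sd (opp u) = t}"

lemma turns_same [simp]: "turns s s = 0"
  using sd_opp by (auto simp: turns_def card_eq_0_iff)

lemma turns_commute: "turns s t = turns t s"
  unfolding turns_def by (rule bij_betw_same_card[of opp], rule bij_betw_byWitness[where f'=opp]) auto

lemma card_side: "card {u \<in> E. sd u = s} = (\<Sum>t\<in>UNIV. turns s t)"
proof -
  have "{u \<in> E. sd u = s} = (\<Union>t. {u \<in> E. sd u = s \<and> sd (opp u) = t})" by auto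
  also have "card \<dots> = (\<Sum>t\<in>UNIV. turns s t)"
    unfolding turns_def using finite_E by (intro card_UN_disjoint) auto
  finally show ?thesis .
qed

lemma card_side_bar: "card {u \<in> E. sd u = bar s} = card {u \<in> E. sd u = s}"
  by (rule bij_betw_same_card[of tau], rule bij_betw_byWitness[where f'=tau]) (auto simp: tau_tau)

lemma turns_balance: "turns InvB InvA = turns GenA GenB" "turns GenB InvA = turns GenA InvB"
  using card_side_bar[of GenA] card_side_bar[of GenB] unfolding card_side UNIV_letter
  by (simp_all add: turns_commute[of InvB GenA] turns_commute[of InvA GenA] turns_commute[of GenB GenA]
      turns_commute[of InvA GenB] turns_commute[of InvB GenB] turns_commute[of InvA InvB])

abbreviation straight where "straight \<equiv> turns GenA InvA + turns GenB InvB"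

lemma length_turns: "length w = straight + 2 * turns GenA InvB + 2 * turns GenA GenB"
proof -
  have "E = (\<Union>s. {u \<in> E. sd u = s})" by auto
  hence "card E = card (\<Union>s. {u \<in> E. sd u = s})" by simp
  also have "\<dots> = (\<Sum>s\<in>UNIV. card {u \<in> E. sd u = s})" using finite_E by (intro card_UN_disjoint) auto
  finally show ?thesis unfolding card_E card_side UNIV_letter using turns_balance
    by (simp add: turns_commute[of InvB GenA] turns_commute[of InvA GenA] turns_commute[of GenB GenA]
      turns_commute[of InvA GenB] turns_commute[of InvB GenB] turns_commute[of InvA InvB])
qed

lemma card_diagonal_pairs: "card diagonal_pairs = (turns GenA GenB)\<^sup>2"
proof -
  have "diagonal_pairs = {u \<in> E. sd u = GenA \<and> sd (opp u) = GenB} \<times> {u \<in> E. sd u = InvB \<and> sd (opp u) = InvA}"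
    by (auto simp: diagonal_pairs_def)
  thus ?thesis using turns_balance by (simp add: card_cartesian_product turns_def power2_eq_square)
qed

lemma card_flags: "card flags = 8 * turns GenA InvB * turns GenA GenB + 4 * (turns GenA InvB + turns GenA GenB) * straight"
proof -
  let ?T = "\<lambda>s t. {u \<in> E. sd u = s \<and> sd (opp u) = t}"
  have "flags = (\<Union>(s, t, t')\<in>{(s, t, t'). t \<noteq> t'}. ?T s t \<times> ?T s t')" by (auto simp: flags_def)
  also have "card \<dots> = (\<Sum>(s, t, t')\<in>{(s, t, t'). t \<noteq> t'}. turns s t * turns s t')"
    using finite_E by (subst card_UN_disjoint) (auto simp: turns_def card_cartesian_product intro!: sum.cong)
  also have "\<dots> = (\<Sum>(s, t, t')\<in>UNIV. if t \<noteq> t' then turns s t * turns s t' else 0)"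
    by (rule sum.mono_neutral_cong_left) auto
  also have "\<dots> = (\<Sum>s\<in>UNIV. \<Sum>t\<in>UNIV. \<Sum>t'\<in>UNIV. if t \<noteq> t' then turns s t * turns s t' else 0)"
    unfolding UNIV_Times_UNIV[symmetric] by (simp only: sum.cartesian_product)
  also have "\<dots> = 8 * turns GenA InvB * turns GenA GenB + 4 * (turns GenA InvB + turns GenA GenB) * straight"
    unfolding UNIV_letter using turns_balance
    by (simp add: turns_commute[of InvB GenA] turns_commute[of InvA GenA] turns_commute[of GenB GenA]
      turns_commute[of InvA GenB] turns_commute[of InvB GenB] turns_commute[of InvA InvB] algebra_simps)
  finally show ?thesis .
qed

lemma classes_upper:
  "card (P // R) \<le> (turns GenA GenB)\<^sup>2 + 2 * turns GenA InvB * turns GenA GenB + (turns GenA InvB + turns GenA GenB) * straight"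
  using card_classes_le unfolding card_flags card_diagonal_pairs by (simp add: algebra_simps)

end

section \<open>Smoothing chord diagrams\<close>

text \<open>\<open>(p < q) \<noteq> (r < q)\<close> says that \<open>q\<close> lies between
  \<open>p\<close> and \<open>r\<close>, so the two pairs are linked on the circle that was cut
  open.\<close>

definition separates :: "real \<Rightarrow> real \<Rightarrow> real \<Rightarrow> real \<Rightarrow> bool" where
  "separates p r q s \<longleftrightarrow> ((p < q) \<noteq> (r < q)) \<noteq> ((p < s) \<noteq> (r < s))"

definition crossings :: "'a set \<Rightarrow> ('a \<Rightarrow> real) \<Rightarrow> ('a \<Rightarrow> 'a) \<Rightarrow> ('a \<times> 'a) set" where
  "crossings E x m = {(u, v) \<in> E \<times> E. u \<noteq> v \<and> v \<noteq> m u \<and> separates (x u) (x (m u)) (x v) (x (m v))}"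

text \<open>The ends \<open>E\<close> of the strands lie on the four sides of a polygon, cut open to an interval in which
  \<open>x\<close> is the position; side \<open>i\<close> is glued to side \<open>3 - i\<close> by the orientation reversing map \<open>t\<close>. A
  matching \<open>m\<close> of the ends is a system of chords in the polygon, hence a multicurve on a pair of
  pants.\<close>

locale glued_polygon =
  fixes E :: "'a set" and x :: "'a \<Rightarrow> real" and side :: "'a \<Rightarrow> nat" and t :: "'a \<Rightarrow> 'a"
  assumes finE: "finite E" and inj_x: "inj_on x E"
    and side_le: "u \<in> E \<Longrightarrow> side u \<le> 3"
    and side_mono: "u \<in> E \<Longrightarrow> v \<in> E \<Longrightarrow> x u < x v \<Longrightarrow> side u \<le> side v"
    and t_in: "u \<in> E \<Longrightarrow> t u \<in> E" and t_t: "u \<in> E \<Longrightarrow> t (t u) = u"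
    and side_t: "u \<in> E \<Longrightarrow> side (t u) = 3 - side u"
    and t_rev: "u \<in> E \<Longrightarrow> v \<in> E \<Longrightarrow> side u = side v \<Longrightarrow> x u < x v \<Longrightarrow> x (t v) < x (t u)"
begin

definition chord_matching :: "('a \<Rightarrow> 'a) \<Rightarrow> bool" where
  "chord_matching m \<longleftrightarrow> (\<forall>u\<in>E. m u \<in> E \<and> m (m u) = u \<and> side (m u) \<noteq> side u)"

text \<open>Counting neighbours on the same side locates an end; matching and gluing can then be
  compared by cardinalities (\<open>above_inj\<close>).\<close>

definition above :: "'a \<Rightarrow> 'a set" where "above u = {v \<in> E. side v = side u \<and> x u < x v}"
definition below :: "'a \<Rightarrow> 'a set" where "below u = {v \<in> E. side v = side u \<and> x v < x u}"

lemma card_above_t: assumes "u \<in> E" shows "card (above (t u)) = card (below u)"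
proof -
  have in1: "t v \<in> above (t u)" if "v \<in> below u" for v
    using that assms by (simp add: above_def below_def t_in side_t t_rev)
  have in2: "t v \<in> below u" if "v \<in> above (t u)" for v
  proof -
    have v: "v \<in> E" "side v = side (t u)" "x (t u) < x v" using that by (auto simp: above_def)
    have "x (t v) < x (t (t u))" using v assms by (intro t_rev) (auto simp: t_in)
    moreover have "side (t v) = side u" using v assms side_le[of u] by (simp add: side_t)
    ultimately show ?thesis using v assms by (simp add: below_def t_in t_t)
  qed
  have "bij_betw t (below u) (above (t u))"
  proof (rule bij_betw_byWitness[where f'=t])
    show "\<forall>v\<in>below u. t (t v) = v" "\<forall>v\<in>above (t u). t (t v) = v"
      by (auto simp: above_def below_def t_t)
    show "t ` below u \<subseteq> above (t u)" using in1 by blast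
    show "t ` above (t u) \<subseteq> below u" using in2 by blast
  qed
  thus ?thesis by (simp add: bij_betw_same_card)
qed

lemma card_below_t: assumes "u \<in> E" shows "card (below (t u)) = card (above u)"
  using card_above_t[of "t u"] assms by (simp add: t_in t_t)

lemma above_inj: assumes "u \<in> E" "v \<in> E" "side u = side v" "card (above u) = card (above v)"
  shows "u = v"
proof (rule ccontr)
  assume "u \<noteq> v"
  have *: "False" if "a \<in> E" "b \<in> E" "side a = side b" "card (above a) = card (above b)" "x a < x b" for a b
  proof -
    have "above b \<subset> above a" using that by (auto simp: above_def)
    moreover have "finite (above a)" using finE by (auto simp: above_def)
    ultimately have "card (above b) < card (above a)" by (rule psubset_card_mono[rotated])
    with that show False by simp
  qed
  have "x u \<noteq> x v" using \<open>u \<noteq> v\<close> assms inj_x by (auto dest: inj_onD)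
  with *[of u v] *[of v u] assms show False by linarith
qed

lemma x_less_side: assumes "u \<in> E" "v \<in> E" "side u < side v" shows "x u < x v"
  using assms side_mono[of v u] inj_x by (metis inj_onD leD linorder_neqE_linordered_idom order_less_irrefl)

section \<open>Chord matchings and the rigidity of those without crossings\<close>

context
  fixes m assumes m: "chord_matching m"
begin

lemma m_in: "u \<in> E \<Longrightarrow> m u \<in> E" and m_m: "u \<in> E \<Longrightarrow> m (m u) = u"
  and side_m: "u \<in> E \<Longrightarrow> side (m u) \<noteq> side u"
  using m by (auto simp: chord_matching_def)

lemma m_inj: "u \<in> E \<Longrightarrow> v \<in> E \<Longrightarrow> m u = m v \<Longrightarrow> u = v"
  by (metis m_m)

lemma card_types_sym: "card {u \<in> E. side u = i \<and> side (m u) = j} = card {u \<in> E. side u = j \<and> side (m u) = i}"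
  by (rule bij_betw_same_card[of m], rule bij_betw_byWitness[where f'=m]) (auto simp: m_in m_m)

lemma card_side_split:
  "card {u \<in> E. side u = i} = (\<Sum>j\<le>3. card {u \<in> E. side u = i \<and> side (m u) = j})"
proof -
  have "{u \<in> E. side u = i} = (\<Union>j\<in>{..3}. {u \<in> E. side u = i \<and> side (m u) = j})"
    using side_le m_in by blast
  also have "card \<dots> = (\<Sum>j\<le>3. card {u \<in> E. side u = i \<and> side (m u) = j})"
    by (rule card_UN_disjoint) (auto simp: finE)
  finally show ?thesis .
qed

lemma card_side_t: assumes "i \<le> 3" shows "card {u \<in> E. side u = i} = card {u \<in> E. side u = 3 - i}"
  by (rule bij_betw_same_card[of t], rule bij_betw_byWitness[where f'=t])
    (use assms in \<open>auto simp: t_in t_t side_t\<close>)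

lemma card_same_type: "{u \<in> E. side u = i \<and> side (m u) = i} = {}"
  using side_m by auto

text \<open>Glued sides carry equally many ends. The equations for sides 0, 3 and for sides 1, 2
  differ by twice the claimed equality.\<close>

lemma diagonals_balance:
  "card {u \<in> E. side u = 0 \<and> side (m u) = 2} = card {u \<in> E. side u = 1 \<and> side (m u) = 3}"
proof -
  let ?n = "\<lambda>i j. card {u \<in> E. side u = i \<and> side (m u) = j}"
  have s: "card {u \<in> E. side u = i} = ?n i 0 + ?n i 1 + ?n i 2 + ?n i 3" for i
  proof -
    have "{..3::nat} = {0, 1, 2, 3}" by auto
    thus ?thesis unfolding card_side_split by simp
  qed
  have z: "?n i i = 0" for i by (simp add: card_same_type)
  have "?n 1 0 = ?n 0 1" "?n 2 0 = ?n 0 2" "?n 3 0 = ?n 0 3" "?n 2 1 = ?n 1 2" "?n 3 1 = ?n 1 3" "?n 3 2 = ?n 2 3"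
    by (rule card_types_sym)+
  thus ?thesis
    using card_side_t[of 0] card_side_t[of 1] z[of 0] z[of 1] z[of 2] z[of 3]
    unfolding s by simp
qed

context
  assumes nc: "crossings E x m = {}"
begin

lemma not_linked: "u \<in> E \<Longrightarrow> v \<in> E \<Longrightarrow> x u < x v \<Longrightarrow> x v < x (m u) \<Longrightarrow> x u < x (m v) \<and> x (m v) < x (m u)"
proof (rule ccontr)
  assume a: "u \<in> E" "v \<in> E" "x u < x v" "x v < x (m u)" "\<not> (x u < x (m v) \<and> x (m v) < x (m u))"
  have ne: "u \<noteq> v" "v \<noteq> m u" using a by auto
  have "m v \<noteq> m u" "m v \<noteq> u" using ne a m_inj m_m by metis+
  hence "x (m v) \<noteq> x u" "x (m v) \<noteq> x (m u)" using a inj_x m_in by (metis inj_onD)+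
  hence "(u, v) \<in> crossings E x m" using a ne by (auto simp: crossings_def separates_def)
  with nc show False by simp
qed

text \<open>A chord from 0 to 2 crosses every chord from 1 to 3, so one kind is absent; by
  \<open>diagonals_balance\<close> both are.\<close>

lemma no_diagonals: assumes u: "u \<in> E" shows "\<not> (side u = 0 \<and> side (m u) = 2)" "\<not> (side u = 1 \<and> side (m u) = 3)"
proof -
  let ?A = "{u \<in> E. side u = 0 \<and> side (m u) = 2}" and ?B = "{u \<in> E. side u = 1 \<and> side (m u) = 3}"
  have "?A = {} \<or> ?B = {}"
  proof (rule ccontr)
    assume "\<not> ?thesis"
    then obtain a b where ab: "a \<in> E" "b \<in> E" "side a = 0" "side (m a) = 2" "side b = 1" "side (m b) = 3"
      by blast
    have "x a < x b" "x b < x (m a)" "x (m a) < x (m b)"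
      using ab x_less_side m_in by simp_all
    with not_linked[of a b] ab show False by auto
  qed
  moreover have "finite ?A" "finite ?B" using finE by auto
  ultimately have "?A = {}" "?B = {}" using diagonals_balance by (metis (lifting) card_eq_0_iff)+
  thus "\<not> (side u = 0 \<and> side (m u) = 2)" "\<not> (side u = 1 \<and> side (m u) = 3)" using u by blast+
qed

text \<open>The chord cuts off a corner. The ends in the corner are matched among themselves, and as
  no chord returns to its side, those on one side are matched with those on the other.\<close>

lemma adjacent_card:
  assumes u: "u \<in> E" "side (m u) = Suc (side u)"
  shows "card (above u) = card (below (m u))"
proof -
  have lt: "x u < x (m u)" using u m_in x_less_side by simp
  have in1: "m v \<in> below (m u)" if "v \<in> above u" for v
  proof -
    have v: "v \<in> E" "side v = side u" "x u < x v" using that by (auto simp: above_def)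
    have "x v < x (m u)" using v u m_in x_less_side by simp
    from not_linked[OF u(1) v(1,3) this] have b: "x u < x (m v)" "x (m v) < x (m u)" by auto
    hence "side u \<le> side (m v)" "side (m v) \<le> side (m u)" using u v m_in side_mono by blast+
    with side_m[OF v(1)] v u b show ?thesis by (auto simp: below_def m_in)
  qed
  have in2: "m v \<in> above u" if "v \<in> below (m u)" for v
  proof -
    have v: "v \<in> E" "side v = side (m u)" "x v < x (m u)" using that by (auto simp: below_def)
    have "x u < x v" using v u m_in x_less_side by simp
    from not_linked[OF u(1) v(1) this v(3)] have b: "x u < x (m v)" "x (m v) < x (m u)" by auto
    hence "side u \<le> side (m v)" "side (m v) \<le> side (m u)" using u v m_in side_mono by blast+
    with side_m[OF v(1)] v u b show ?thesis by (auto simp: above_def m_in)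
  qed
  have "bij_betw m (above u) (below (m u))"
  proof (rule bij_betw_byWitness[where f'=m])
    show "\<forall>v\<in>above u. m (m v) = v" "\<forall>v\<in>below (m u). m (m v) = v"
      by (auto simp: above_def below_def m_m)
    show "m ` above u \<subseteq> below (m u)" using in1 by blast
    show "m ` below (m u) \<subseteq> above u" using in2 by blast
  qed
  thus ?thesis by (rule bij_betw_same_card)
qed

text \<open>The corner argument again, for the corner between sides 3 and 0 at which the boundary
  was cut open.\<close>

lemma outer_card:
  assumes u: "u \<in> E" "side u = 0" "side (m u) = 3"
  shows "card (below u) = card (above (m u))"
proof -
  have lt: "x u < x (m u)" using u m_in x_less_side by simp
  have *: "x (m v) < x u \<or> x (m v) > x (m u)" if v: "v \<in> E" and "x v < x u \<or> x v > x (m u)" for v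
  proof (rule ccontr)
    assume "\<not> ?thesis"
    moreover have "m v \<noteq> u" "m v \<noteq> m u" using that lt u m_m by (metis less_irrefl order_less_asym)+
    hence "x (m v) \<noteq> x u" "x (m v) \<noteq> x (m u)" using u v inj_x m_in by (metis inj_onD)+
    ultimately have "x u < x (m v)" "x (m v) < x (m u)" by auto
    from not_linked[OF u(1) m_in[OF v] this] v show False using that by (simp add: m_m)
  qed
  have in1: "m v \<in> above (m u)" if "v \<in> below u" for v
  proof -
    have v: "v \<in> E" "side v = side u" "x v < x u" using that by (auto simp: below_def)
    have "\<not> x (m v) < x u"
      using v u side_m[OF v(1)] side_mono[OF m_in[OF v(1)] u(1)] by auto
    with *[OF v(1)] v(3) have "x (m v) > x (m u)" by auto
    moreover from this have "side (m v) = 3" using side_mono[of "m u" "m v"] u v m_in side_le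
      by (metis le_antisym)
    ultimately show ?thesis using v u by (simp add: above_def m_in)
  qed
  have in2: "m v \<in> below u" if "v \<in> above (m u)" for v
  proof -
    have v: "v \<in> E" "side v = side (m u)" "x (m u) < x v" using that by (auto simp: above_def)
    have "\<not> x (m v) > x (m u)"
      using v u side_m[OF v(1)] side_mono[of "m u" "m v"] side_le[of "m v"] m_in by (metis le_antisym)
    with *[OF v(1)] v(3) have "x (m v) < x u" by auto
    moreover from this have "side (m v) = 0" using side_mono[of "m v" u] u v m_in by simp
    ultimately show ?thesis using v u by (simp add: below_def m_in)
  qed
  have "bij_betw m (below u) (above (m u))"
  proof (rule bij_betw_byWitness[where f'=m])
    show "\<forall>v\<in>below u. m (m v) = v" "\<forall>v\<in>above (m u). m (m v) = v"
      by (auto simp: above_def below_def m_m)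
    show "m ` below u \<subseteq> above (m u)" using in1 by blast
    show "m ` above (m u) \<subseteq> below u" using in2 by blast
  qed
  thus ?thesis by (rule bij_betw_same_card)
qed

lemma commute_outer: assumes "u \<in> E" "side u = 0" "side (m u) = 3" shows "m u = t u"
  using assms outer_card card_above_t m_in t_in side_t by (intro above_inj) auto

lemma commute_inner: assumes u: "u \<in> E" "side u = 1" "side (m u) = 2" shows "m u = t u"
proof -
  have "card (below (m u)) = card (below (t u))"
    using adjacent_card[of u] card_below_t[of u] u by simp
  hence "card (above (t (m u))) = card (above (t (t u)))" using u card_above_t m_in t_in by simp
  hence "t (m u) = t (t u)" using u m_in t_in side_t by (intro above_inj) auto
  thus ?thesis using u by (metis m_in t_in t_t)
qed

text \<open>Exclusion leaves side 2 for the partner of \<open>t u\<close>; corner counts at both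
  chords and the reversal by \<open>t\<close> then identify it.\<close>

lemma commute_corner: assumes u: "u \<in> E" "side u = 0" "side (m u) = 1" shows "m (t u) = t (m u)"
proof -
  let ?y = "m (t u)"
  have t3: "t u \<in> E" "side (t u) = 3" using u by (simp_all add: t_in side_t)
  have y: "?y \<in> E" "m ?y = t u" using t3 by (simp_all add: m_in m_m)
  have "side ?y \<noteq> 3" "side ?y \<noteq> 1" using side_m[OF t3(1)] t3 no_diagonals(2)[OF y(1)] y by auto
  moreover have "side ?y \<noteq> 0"
  proof
    assume "side ?y = 0"
    hence "m ?y = t ?y" using commute_outer[OF y(1)] y t3 by simp
    hence "u = ?y" using y u by (metis t_t)
    thus False using y u t3 by auto
  qed
  ultimately have s: "side ?y = 2" using side_le[OF y(1)] by linarith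
  have "card (above ?y) = card (below (t u))" using adjacent_card[OF y(1)] y t3 s by simp
  also have "\<dots> = card (above u)" using u card_below_t by simp
  also have "\<dots> = card (below (m u))" using u adjacent_card by simp
  also have "\<dots> = card (above (t (m u)))" using u card_above_t m_in by simp
  finally show ?thesis using y s u by (intro above_inj) (auto simp: m_in t_in side_t)
qed

text \<open>As \<open>m\<close> and \<open>t\<close> are commuting involutions, a component of the
  multicurve has at most the four ends \<open>u\<close>, \<open>m u\<close>, \<open>t u\<close>,
  \<open>m (t u)\<close>, that is, it crosses the sides at most twice.\<close>

lemma uncrossed_commute: assumes u: "u \<in> E" shows "m (t u) = t (m u)"
proof -
  have c10: "m (t u) = t (m u)" if u: "u \<in> E" "side u = 1" "side (m u) = 0" for u
    using commute_corner[of "m u"] u by (metis m_in m_m t_in)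
  have c23: "m (t u) = t (m u)" if u: "u \<in> E" "side u = 2" "side (m u) = 3" for u
  proof -
    have v: "t u \<in> E" "side (t u) = 1" using u by (simp_all add: t_in side_t)
    have "side (m (t u)) \<noteq> 2"
    proof
      assume "side (m (t u)) = 2"
      hence "m (t u) = u" using commute_inner[of "t u"] v u by (simp add: t_t)
      hence "m u = t u" using m_m[OF v(1)] by simp
      thus False using u v by simp
    qed
    moreover have "side (m (t u)) \<noteq> 1" "side (m (t u)) \<noteq> 3" using v side_m no_diagonals by fastforce+
    ultimately have "side (m (t u)) = 0" using side_le[OF m_in[OF v(1)]] by linarith
    from c10[OF v this] show ?thesis using u v by (metis m_in t_in t_t)
  qed
  have flip: "m (t u) = t (m u)" if u: "u \<in> E" "m (t (m u)) = t (m (m u))" for u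
    using u by (metis m_in m_m t_in)
  have eqt: "m (t u) = t (m u)" if "u \<in> E" "m u = t u" for u using that by (metis m_m t_t)
  have le: "side u \<le> 3" "side (m u) \<le> 3" "side (m u) \<noteq> side u" using u side_le side_m m_in by auto
  have d: "\<not> (side u = 0 \<and> side (m u) = 2)" "\<not> (side u = 1 \<and> side (m u) = 3)"
     "\<not> (side u = 2 \<and> side (m u) = 0)" "\<not> (side u = 3 \<and> side (m u) = 1)"
    using no_diagonals[of u] no_diagonals[of "m u"] u m_m m_in by auto
  have "side u = 0 \<or> side u = 1 \<or> side u = 2 \<or> side u = 3" "side (m u) = 0 \<or> side (m u) = 1 \<or> side (m u) = 2 \<or> side (m u) = 3"
    using le by linarith+
  then consider "side u = 0" "side (m u) = 1" | "side u = 1" "side (m u) = 0" | "side u = 1" "side (m u) = 2" 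
    | "side u = 2" "side (m u) = 1" | "side u = 2" "side (m u) = 3" | "side u = 3" "side (m u) = 2"
    | "side u = 0" "side (m u) = 3" | "side u = 3" "side (m u) = 0"
    using le d by fastforce
  thus ?thesis
  proof cases
    case 4 show ?thesis by (rule flip[OF u], rule eqt) (use 4 u commute_inner[of "m u"] in \<open>auto simp: m_in m_m\<close>)
  next
    case 8 show ?thesis by (rule flip[OF u], rule eqt) (use 8 u commute_outer[of "m u"] in \<open>auto simp: m_in m_m\<close>)
  next
    case 6 show ?thesis by (rule flip[OF u], rule c23) (use 6 u in \<open>auto simp: m_in m_m\<close>)
  qed (use u commute_corner c10 c23 commute_inner commute_outer eqt in blast)+
qed

end
end
end

text \<open>\<open>P\<close> tells on which side of the chord from \<open>y\<close> to
  \<open>z\<close> a point lies. Only the alternating pattern on \<open>a < b < c < d\<close> could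
  violate the inequalities, and two points of the line cannot produce it.\<close>

lemma separates_resolve:
  assumes "a < b" "b < c" "c < d" "y \<noteq> a" "y \<noteq> b" "y \<noteq> c" "y \<noteq> d" "z \<noteq> a" "z \<noteq> b" "z \<noteq> c" "z \<noteq> d"
  shows "of_bool (separates a b y z) + of_bool (separates c d y z)
       \<le> of_bool (separates a c y z) + (of_bool (separates b d y z) :: nat)" (is ?A)
    and "of_bool (separates a d y z) + of_bool (separates b c y z)
       \<le> of_bool (separates a c y z) + (of_bool (separates b d y z) :: nat)" (is ?B)
proof -
  define P where "P p \<longleftrightarrow> (p < y) \<noteq> (p < z)" for p
  have sep: "separates p r y z \<longleftrightarrow> P p \<noteq> P r" for p r by (auto simp: separates_def P_def)
  have "\<not> (P a = P c \<and> P b = P d \<and> P a \<noteq> P b)"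
    using assms(1-3) unfolding P_def by (smt (verit))
  thus ?A ?B unfolding sep by (cases "P a"; cases "P b"; cases "P c"; cases "P d"; simp)+
qed

lemma separates_flip: "separates p r q s = separates r p q s" "separates p r q s = separates p r s q"
  by (auto simp: separates_def)

lemma separates_sym:
  assumes "p \<noteq> q" "p \<noteq> s" "r \<noteq> q" "r \<noteq> s" shows "separates p r q s = separates q s p r"
proof -
  have "q < p \<longleftrightarrow> \<not> p < q" "s < p \<longleftrightarrow> \<not> p < s" "q < r \<longleftrightarrow> \<not> r < q" "s < r \<longleftrightarrow> \<not> r < s"
    using assms by auto
  thus ?thesis unfolding separates_def by auto
qed

lemma card_crossings_sum:
  assumes "finite E"
  shows "card (crossings E x m) = (\<Sum>u\<in>E. \<Sum>v\<in>E. of_bool ((u, v) \<in> crossings E x m))"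
proof -
  have "card (crossings E x m) = card {p \<in> E \<times> E. p \<in> crossings E x m}"
    by (rule arg_cong[where f=card]) (auto simp: crossings_def)
  also have "\<dots> = (\<Sum>p\<in>E \<times> E. of_bool (p \<in> crossings E x m))"
    using assms by (simp add: Int_def)
  finally show ?thesis by (simp add: sum.cartesian_product)
qed

context glued_polygon
begin

lemma crossing_order:
  assumes m: "chord_matching m" and ne: "crossings E x m \<noteq> {}"
  obtains a b where "a \<in> E" "b \<in> E" "x a < x b" "x b < x (m a)" "x (m a) < x (m b)"
proof -
  note mi = m_in[OF m] m_m[OF m] m_inj[OF m]
  from ne obtain u v where uv: "u \<in> E" "v \<in> E" "u \<noteq> v" "v \<noteq> m u"
    "separates (x u) (x (m u)) (x v) (x (m v))"
    by (auto simp: crossings_def)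
  have xne: "x p \<noteq> x q" if "p \<in> E" "q \<in> E" "p \<noteq> q" for p q using that inj_x by (auto dest: inj_onD)
  have "m u \<noteq> m v" "u \<noteq> m v" "m u \<noteq> u" "m v \<noteq> v" using uv mi side_m[OF m] by metis+
  hence d: "x u \<noteq> x v" "x u \<noteq> x (m u)" "x u \<noteq> x (m v)" "x v \<noteq> x (m u)" "x v \<noteq> x (m v)" "x (m u) \<noteq> x (m v)"
    using uv by (simp_all add: mi inj_on_eq_iff[OF inj_x])
  define P where "P \<equiv> \<lambda>a b. x a < x b \<and> x b < x (m a) \<and> x (m a) < x (m b)"
  have "P u v \<or> P u (m v) \<or> P (m u) v \<or> P (m u) (m v) \<or> P v u \<or> P v (m u) \<or> P (m v) u \<or> P (m v) (m u)"
    using d uv(5) unfolding P_def separates_def mi(2)[OF uv(1)] mi(2)[OF uv(2)] by (smt (verit))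
  thus ?thesis using that uv mi unfolding P_def by metis
qed

text \<open>The smoothed chords cross no third chord more often than before (\<open>QO\<close>,
  \<open>OQ\<close>), and the crossing between the two chords themselves disappears.\<close>

lemma smoothing_card:
  assumes m: "chord_matching m" and m': "chord_matching m'"
    and Q: "a \<in> E" "b \<in> E" "c \<in> E" "d \<in> E" "x a < x b" "x b < x c" "x c < x d" "m a = c" "m b = d"
    and ch: "(m' a = b \<and> m' c = d) \<or> (m' a = d \<and> m' b = c)"
    and out: "\<And>u. u \<notin> {a, b, c, d} \<Longrightarrow> m' u = m u"
  shows "card (crossings E x m') + 8 \<le> card (crossings E x m)"
proof -
  let ?Q = "{a, b, c, d}" and ?O = "E - {a, b, c, d}"
  define C where "C \<equiv> \<lambda>m u v. (of_bool ((u, v) \<in> crossings E x m) :: nat)"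
  have ne: "a \<noteq> b" "a \<noteq> c" "a \<noteq> d" "b \<noteq> c" "b \<noteq> d" "c \<noteq> d" using Q(5-7) by auto
  have mm: "m a = c" "m c = a" "m b = d" "m d = b" using Q m_m[OF m] by auto
  have E: "E = ?O \<union> ?Q" using Q by auto
  have split: "(\<Sum>u\<in>E. f u) = (\<Sum>u\<in>?O. f u) + (f a + f b + f c + f d)" for f :: "'a \<Rightarrow> nat"
  proof -
    have "(\<Sum>u\<in>E. f u) = (\<Sum>u\<in>?O. f u) + (\<Sum>u\<in>?Q. f u)"
      by (subst E, rule sum.union_disjoint) (use finE in auto)
    thus ?thesis using ne by simp
  qed
  have mO: "m u \<in> ?O" "m u \<noteq> u" if "u \<in> ?O" for u
    using that mm m_m[OF m, of u] m_in[OF m, of u] side_m[OF m, of u] by auto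
  have QO: "C m' a v + C m' b v + C m' c v + C m' d v \<le> C m a v + C m b v + C m c v + C m d v" if v: "v \<in> ?O" for v
  proof -
    have y: "x v \<noteq> x a" "x v \<noteq> x b" "x v \<noteq> x c" "x v \<noteq> x d"
      using v Q(1-4) by (simp_all add: inj_on_eq_iff[OF inj_x])
    have z: "x (m v) \<noteq> x a" "x (m v) \<noteq> x b" "x (m v) \<noteq> x c" "x (m v) \<noteq> x d"
      using mO[OF v] Q(1-4) by (simp_all add: inj_on_eq_iff[OF inj_x])
    have CQ: "C k p v = of_bool (separates (x p) (x (k p)) (x v) (x (k v)))" if "p \<in> E" "p \<in> ?Q" "k p \<in> ?Q" for k p
      using that v by (auto simp: C_def crossings_def)
    have mv: "m' v = m v" using v out by blast
    have m'm': "m' (m' u) = u" if "u \<in> E" for u using m_m[OF m'] that .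
    note s = separates_resolve[OF Q(5,6,7) y z]
    note f = separates_flip(1)[of "x b" "x a"] separates_flip(1)[of "x d" "x c"] separates_flip(1)[of "x c" "x a"]
      separates_flip(1)[of "x d" "x b"] separates_flip(1)[of "x d" "x a"] separates_flip(1)[of "x c" "x b"]
    have "C m a v + C m b v + C m c v + C m d v = 
       2 * (of_bool (separates (x a) (x c) (x v) (x (m v))) + of_bool (separates (x b) (x d) (x v) (x (m v))))"
      using v Q(1-4) mm f by (simp add: CQ)
    moreover have "C m' a v + C m' b v + C m' c v + C m' d v = 
       2 * (of_bool (separates (x a) (x b) (x v) (x (m v))) + of_bool (separates (x c) (x d) (x v) (x (m v))))
     \<or> C m' a v + C m' b v + C m' c v + C m' d v = 
       2 * (of_bool (separates (x a) (x d) (x v) (x (m v))) + of_bool (separates (x b) (x c) (x v) (x (m v))))"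
      using ch
    proof
      assume h: "m' a = b \<and> m' c = d"
      hence "m' b = a" "m' d = c" using m'm'[OF Q(1)] m'm'[OF Q(2)] m'm'[OF Q(3)] by auto
      thus ?thesis using v Q(1-4) h f mv by (intro disjI1) (simp add: CQ)
    next
      assume h: "m' a = d \<and> m' b = c"
      hence "m' d = a" "m' c = b" using m'm'[OF Q(1)] m'm'[OF Q(2)] m'm'[OF Q(3)] by auto
      thus ?thesis using v Q(1-4) h f mv by (intro disjI2) (simp add: CQ)
    qed
    ultimately show ?thesis using s by (metis mult_le_mono2)
  qed
  have sym: "C m u v = C m v u" if "u \<in> E" "v \<in> E" and m: "chord_matching m" for u v m
  proof (cases "u = v \<or> v = m u")
    case True
    thus ?thesis using that m_m[OF m] by (auto simp: C_def crossings_def)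
  next
    case False
    hence "u \<noteq> m v" "m u \<noteq> m v" using that m_m[OF m] by metis+
    with False show ?thesis using that
      by (auto simp: C_def crossings_def m_in[OF m] inj_on_eq_iff[OF inj_x] separates_sym[of "x u" "x v" "x (m v)" "x (m u)"])
  qed
  have OQ: "C m' v a + C m' v b + C m' v c + C m' v d \<le> C m v a + C m v b + C m v c + C m v d" if v: "v \<in> ?O" for v
  proof -
    have v': "v \<in> E" using v by simp
    have "C k v a + C k v b + C k v c + C k v d = C k a v + C k b v + C k c v + C k d v" if "chord_matching k" for k
      using sym[OF v' Q(1) that] sym[OF v' Q(2) that] sym[OF v' Q(3) that] sym[OF v' Q(4) that] by simp
    thus ?thesis using QO[OF v] m m' by simp
  qed
  have OO: "C m' u v = C m u v" if "u \<in> ?O" "v \<in> ?O" for u v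
    using that out by (simp add: C_def crossings_def)
  let ?S = "\<lambda>k. (C k a a + C k a b + C k a c + C k a d) + (C k b a + C k b b + C k b c + C k b d)
    + (C k c a + C k c b + C k c c + C k c d) + (C k d a + C k d b + C k d c + C k d d)"
  \<comment> \<open>Each of \<open>a\<close>, \<open>c\<close> with each of \<open>b\<close>,
    \<open>d\<close>, in both orders.\<close>
  have QQ: "?S m = 8"
    using Q mm ne by (simp add: C_def crossings_def separates_def)
  have QQ': "?S m' = 0"
    using ch
  proof
    assume h: "m' a = b \<and> m' c = d"
    hence "m' b = a" "m' d = c" using m_m[OF m' Q(1)] m_m[OF m' Q(2)] m_m[OF m' Q(3)] by auto
    thus ?thesis using Q h ne by (simp add: C_def crossings_def separates_def)
  next
    assume h: "m' a = d \<and> m' b = c"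
    hence "m' d = a" "m' c = b" using m_m[OF m' Q(1)] m_m[OF m' Q(2)] m_m[OF m' Q(3)] by auto
    thus ?thesis using Q h ne by (simp add: C_def crossings_def separates_def)
  qed
  have expand: "card (crossings E x k) = (\<Sum>u\<in>?O. \<Sum>v\<in>?O. C k u v)
     + (\<Sum>u\<in>?O. C k u a + C k u b + C k u c + C k u d)
     + (\<Sum>v\<in>?O. C k a v + C k b v + C k c v + C k d v) + ?S k" for k
  proof -
    have "card (crossings E x k) = (\<Sum>u\<in>E. \<Sum>v\<in>E. C k u v)"
      by (simp only: card_crossings_sum[OF finE] C_def)
    also have "\<dots> = (\<Sum>u\<in>E. (\<Sum>v\<in>?O. C k u v) + (C k u a + C k u b + C k u c + C k u d))"
      by (intro sum.cong refl split)
    also have "\<dots> = (\<Sum>u\<in>?O. \<Sum>v\<in>?O. C k u v) + (\<Sum>u\<in>?O. C k u a + C k u b + C k u c + C k u d)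
      + ((\<Sum>v\<in>?O. C k a v) + (\<Sum>v\<in>?O. C k b v) + (\<Sum>v\<in>?O. C k c v) + (\<Sum>v\<in>?O. C k d v)) + ?S k"
      unfolding split[of "\<lambda>u. (\<Sum>v\<in>?O. C k u v) + (C k u a + C k u b + C k u c + C k u d)"]
      unfolding sum.distrib[of "\<lambda>u. \<Sum>v\<in>?O. C k u v"] by linarith
    finally show ?thesis by (simp only: sum.distrib)
  qed
  have "(\<Sum>u\<in>?O. \<Sum>v\<in>?O. C m' u v) = (\<Sum>u\<in>?O. \<Sum>v\<in>?O. C m u v)"
    using OO by (intro sum.cong) auto
  moreover have "(\<Sum>u\<in>?O. C m' u a + C m' u b + C m' u c + C m' u d) \<le> (\<Sum>u\<in>?O. C m u a + C m u b + C m u c + C m u d)"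
    using OQ by (rule sum_mono)
  moreover have "(\<Sum>v\<in>?O. C m' a v + C m' b v + C m' c v + C m' d v) \<le> (\<Sum>v\<in>?O. C m a v + C m b v + C m c v + C m d v)"
    using QO by (rule sum_mono)
  ultimately show ?thesis unfolding expand QQ QQ' by linarith
qed

lemma card_merge:
  assumes "finite A"
  shows "card (l ` A) \<le> Suc (card ((\<lambda>u. if l u = i then j else l u) ` A))"
proof -
  have "l ` A \<subseteq> insert i ((\<lambda>u. if l u = i then j else l u) ` A)" by auto
  hence "card (l ` A) \<le> card (insert i ((\<lambda>u. if l u = i then j else l u) ` A))"
    using assms by (intro card_mono) auto
  also have "\<dots> \<le> Suc (card ((\<lambda>u. if l u = i then j else l u) ` A))" by (rule card_insert_le_m1) auto
  finally show ?thesis .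
qed

text \<open>A labelling that is constant along the multicurve bounds the number of its components from
  below. By induction on the number of crossings: of the two ways to smooth a crossing, one avoids
  chords from a side to itself. It changes the number of components by at most 1, and it removes at
  least one crossing, i.e. 8 ordered pairs of ends.\<close>

lemma labelling_exists:
  assumes "chord_matching m"
  shows "\<exists>l :: 'a \<Rightarrow> 'a set. (\<forall>u\<in>E. l (m u) = l u \<and> l (t u) = l u) \<and>
    2 * card E \<le> 8 * card (l ` E) + card (crossings E x m)"
  using assms
proof (induction "card (crossings E x m)" arbitrary: m rule: less_induct)
  case less
  note m = less.prems
  show ?case
  proof (cases "crossings E x m = {}")
    case True
    \<comment> \<open>The label of an end is the component containing it.\<close>
    define l where "l u = {u, m u, t u, m (t u)}" for u
    have inv: "l (m u) = l u" "l (t u) = l u" if u: "u \<in> E" for u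
    proof -
      have "m (m u) = u" "t (t u) = u" "m (t u) = t (m u)" "m (t (m u)) = t u" "t (m (t u)) = m u"
        using u uncrossed_commute[OF m True, of u] uncrossed_commute[OF m True, of "m u"] m_m[OF m, of u] t_t[of u]
          t_t[of "m u"] m_in[OF m, of u] by simp_all
      thus "l (m u) = l u" "l (t u) = l u" unfolding l_def by auto
    qed
    have "card E = card (\<Union>s\<in>l ` E. {u \<in> E. l u = s})" by (rule arg_cong[where f=card]) auto
    also have "\<dots> \<le> (\<Sum>s\<in>l ` E. card {u \<in> E. l u = s})"
      using finE by (intro card_UN_le) auto
    also have "\<dots> \<le> (\<Sum>s\<in>l ` E. 4)"
    proof (rule sum_mono)
      fix s assume "s \<in> l ` E"
      then obtain v where v: "s = l v" by auto
      have "{u \<in> E. l u = s} \<subseteq> {v, m v, t v, m (t v)}" using v by (auto simp: l_def)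
      hence "card {u \<in> E. l u = s} \<le> card {v, m v, t v, m (t v)}" by (intro card_mono) auto
      also have "\<dots> \<le> 4" by (simp add: card_insert_if)
      finally show "card {u \<in> E. l u = s} \<le> 4" .
    qed
    finally have "card E \<le> 4 * card (l ` E)" by simp
    thus ?thesis using inv by (intro exI[of _ l]) auto
  next
    case False
    note mi = m_in[OF m] m_m[OF m] side_m[OF m]
    obtain a b where ab: "a \<in> E" "b \<in> E" "x a < x b" "x b < x (m a)" "x (m a) < x (m b)"
      using crossing_order[OF m False] .
    define c d where "c = m a" and "d = m b"
    have Q: "a \<in> E" "b \<in> E" "c \<in> E" "d \<in> E" "x a < x b" "x b < x c" "x c < x d" "m a = c" "m b = d" "m c = a" "m d = b"
      using ab by (auto simp: c_def d_def mi)
    have ne: "a \<noteq> b" "a \<noteq> c" "a \<noteq> d" "b \<noteq> c" "b \<noteq> d" "c \<noteq> d" using Q(5-7) by auto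
    have sd: "side a \<le> side b" "side b \<le> side c" "side c \<le> side d" "side a \<noteq> side c" "side b \<noteq> side d"
      using Q side_mono[of a b] side_mono[of b c] side_mono[of c d] mi(3)[of a] mi(3)[of b] by simp_all
    \<comment> \<open>The sides do not decrease along \<open>a, b, c, d\<close>, while
      \<open>a\<close>, \<open>c\<close> and likewise \<open>b\<close>, \<open>d\<close> are on
      different sides. So \<open>a\<close> with \<open>b\<close> and \<open>c\<close> with
      \<open>d\<close> is allowed unless one of these pairs shares a side, and in that case the
      other smoothing is allowed.\<close>
    define m' where "m' = (if side a = side b \<or> side c = side d
       then m(a := d, d := a, b := c, c := b) else m(a := b, b := a, c := d, d := c))"
    have mO: "m u \<notin> {a, b, c, d}" if "u \<in> E" "u \<notin> {a, b, c, d}" for u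
      using that Q mi(2)[of u] by auto
    have m': "chord_matching m'"
      unfolding chord_matching_def
    proof
      fix u assume u: "u \<in> E"
      show "m' u \<in> E \<and> m' (m' u) = u \<and> side (m' u) \<noteq> side u"
      proof (cases "u \<in> {a, b, c, d}")
        case True thus ?thesis using Q ne sd by (auto simp: m'_def)
      next
        case False thus ?thesis using mO[OF u False] mi u by (simp add: m'_def)
      qed
    qed
    have ch: "(m' a = b \<and> m' c = d) \<or> (m' a = d \<and> m' b = c)" using ne by (auto simp: m'_def)
    have out: "m' u = m u" if "u \<notin> {a, b, c, d}" for u using that by (simp add: m'_def)
    have dec: "card (crossings E x m') + 8 \<le> card (crossings E x m)"
      using smoothing_card[OF m m' Q(1-9) ch out] .
    then obtain l :: "'a \<Rightarrow> 'a set" where l: "\<forall>u\<in>E. l (m' u) = l u \<and> l (t u) = l u"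
      "2 * card E \<le> 8 * card (l ` E) + card (crossings E x m')"
      using less.hyps[OF _ m'] by auto
    \<comment> \<open>After either smoothing the four ends carry only the labels \<open>l a\<close>
      and \<open>l c\<close>. Merging these restores invariance under \<open>m\<close> and costs at
      most one label, which the 8 lost crossings pay for.\<close>
    define l' where "l' u = (if l u = l c then l a else l u)" for u
    have "l' (m u) = l' u" if u: "u \<in> E" for u
    proof (cases "u \<in> {a, b, c, d}")
      case True
      have "(l a = l b \<and> l c = l d) \<or> (l a = l d \<and> l b = l c)" using ch l(1) Q by metis
      thus ?thesis using True Q by (auto simp: l'_def)
    next
      case False thus ?thesis using l(1) u out by (auto simp: l'_def)
    qed
    moreover have "l' (t u) = l' u" if "u \<in> E" for u using l(1) that by (simp add: l'_def)
    moreover have "card (l ` E) \<le> Suc (card (l' ` E))"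
      unfolding l'_def by (rule card_merge[OF finE])
    ultimately show ?thesis using l(2) dec by (intro exI[of _ l']) auto
  qed
qed

end

section \<open>The lower bound\<close>

definition positive :: "letter \<Rightarrow> bool" where "positive s \<longleftrightarrow> s = GenA \<or> s = GenB"

lemma positive_bar: "positive (bar s) \<longleftrightarrow> \<not> positive s"
  by (cases s) (auto simp: positive_def)

lemma separates_letters:
  assumes "distinct [s, t, x, y]"
  shows "((idx s < idx x) \<noteq> (idx t < idx x)) \<noteq> ((idx s < idx y) \<noteq> (idx t < idx y))
    \<longleftrightarrow> (ccw (idx s) (idx t) (idx x) \<longleftrightarrow> \<not> ccw (idx s) (idx t) (idx y))"
  using assms by (cases s; cases t; cases x; cases y) (simp_all add: ccw_def)

text \<open>\<open>rank (bar s)\<close> counts anticlockwise from \<open>s\<close>,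
  \<open>idx\<close> from the cut; they order \<open>t\<close> and \<open>t'\<close> alike unless
  \<open>s\<close> lies between them.\<close>

lemma rank_separates:
  assumes "t \<noteq> s" "t' \<noteq> s" "t \<noteq> t'"
  shows "rank (bar s) t < rank (bar s) t' \<longleftrightarrow> ((idx t < idx s) \<noteq> (idx s < idx t')) = (idx t < idx t')"
  using assms by (cases s; cases t; cases t') (simp_all add: rank_def)

fun reduced_word :: "letter list \<Rightarrow> bool" where
  "reduced_word (x # y # xs) \<longleftrightarrow> y \<noteq> bar x \<and> reduced_word (y # xs)"
| "reduced_word _ \<longleftrightarrow> True"

lemma reduced_word_snoc:
  "reduced_word (xs @ [x]) \<longleftrightarrow> reduced_word xs \<and> (xs \<noteq> [] \<longrightarrow> x \<noteq> bar (last xs))"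
  by (induction xs rule: reduced_word.induct) auto

context schottky
begin

lemma word_act_reduce:
  "\<exists>ys. reduced_word ys \<and> (\<forall>z. cmod z \<le> 1 \<longrightarrow> word_act g ys z = word_act g xs z)"
proof (induction xs)
  case Nil show ?case by (intro exI[of _ "[]"]) simp
next
  case (Cons x xs)
  then obtain ys where ys: "reduced_word ys" "\<And>z. cmod z \<le> 1 \<Longrightarrow> word_act g ys z = word_act g xs z" by blast
  show ?case
  proof (cases "\<exists>zs. ys = bar x # zs")
    case True
    then obtain zs where zs: "ys = bar x # zs" by blast
    have "reduced_word zs" using ys(1) zs by (cases zs) auto
    moreover have "word_act g zs z = word_act g (x # xs) z" if z: "cmod z \<le> 1" for z
    proof -
      have "word_act g (x # xs) z = g x (g (bar x) (word_act g zs z))" using ys(2)[OF z] zs by simp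
      also have "\<dots> = word_act g zs z" using disk_map_norm_le[OF word_act_disk_map z] by (intro bar_g)
      finally show ?thesis ..
    qed
    ultimately show ?thesis by blast
  next
    case False
    hence "reduced_word (x # ys)" using ys(1) by (cases ys) auto
    thus ?thesis using ys(2) by (intro exI[of _ "x # ys"]) simp
  qed
qed

lemma ping_word:
  assumes "reduced_word ys" "ys \<noteq> []" "z \<in> boundary_arc (D s)" "s \<noteq> bar (last ys)"
  shows "word_act g ys z \<in> boundary_arc (D (hd ys))"
  using assms
proof (induction ys rule: reduced_word.induct)
  case (1 x y xs)
  hence "word_act g (y # xs) z \<in> boundary_arc (D y)" by simp
  hence "g x (word_act g (y # xs) z) \<in> boundary_arc (D x)" using 1 by (intro ping_arc) auto
  thus ?case by simp
next
  case ("2_2" x) thus ?case using ping_arc by simp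
qed simp

lemma word_act_geodesic:
  assumes "cmod p = 1" "cmod q = 1"
  shows "word_act g xs ` geodesic p q = geodesic (word_act g xs p) (word_act g xs q)"
proof
  show "word_act g xs ` geodesic p q \<subseteq> geodesic (word_act g xs p) (word_act g xs q)"
    by (rule geodesic_image[OF word_act_disk_map])
  let ?p = "word_act g xs p" and ?q = "word_act g xs q"
  have s: "word_act g (inverse_word xs) ` geodesic ?p ?q \<subseteq> geodesic p q"
  proof -
    have "word_act g (inverse_word xs) ?p = p" "word_act g (inverse_word xs) ?q = q" using assms by (simp_all add: word_act_inverse)
    thus ?thesis using geodesic_image[OF word_act_disk_map, of "inverse_word xs" ?p ?q] by (simp only:)
  qed
  show "geodesic ?p ?q \<subseteq> word_act g xs ` geodesic p q"
  proof
    fix z assume z: "z \<in> geodesic ?p ?q"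
    then obtain f t where f: "disk_isometry f" "- 1 < t" "t < 1" "z = f (of_real t)" by (rule geodesicE)
    have "cmod (f (of_real t)) \<le> 1" using f(2,3) by (intro disk_map_norm_le[OF disk_isometry_disk_map[OF f(1)]]) simp
    hence "cmod z \<le> 1" by (simp only: f(4))
    hence "z = word_act g xs (word_act g (inverse_word xs) z)" by (rule inverse_word_act[symmetric])
    moreover have "word_act g (inverse_word xs) z \<in> geodesic p q" using s z by (simp only: image_subset_iff)
    ultimately show "z \<in> word_act g xs ` geodesic p q" by (rule image_eqI)
  qed
qed

end

text \<open>In the applications \<open>p\<close> is a difference of positions, \<open>x\<close> and
  \<open>y\<close> are differences of the codes ahead and behind. As \<open>p\<close> and
  \<open>y\<close> have the same sign, so has \<open>a * x = p + b * y\<close>.\<close>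

lemma sign_single:
  fixes p a b x y :: real
  assumes "p = a * x - b * y" "1 \<le> a" "1 \<le> b" "x \<noteq> 0" "y \<noteq> 0" "p < 0 \<longleftrightarrow> y < 0"
  shows "(x < 0 \<longleftrightarrow> y < 0) \<and> (p < 0 \<longleftrightarrow> x < 0)"
proof (cases "y < 0")
  case True
  hence "p < 0" "b * y < 0" using assms by (auto simp: mult_pos_neg)
  hence "a * x < 0" using assms(1) by linarith
  thus ?thesis using True assms by (auto simp: mult_less_0_iff)
next
  case False
  hence y: "y > 0" using assms(5) by simp
  hence "\<not> p < 0" "b * y > 0" using assms by auto
  hence "a * x > 0" using assms(1) by linarith
  thus ?thesis using y assms by (auto simp: zero_less_mult_iff)
qed

text \<open>Diagonal dominance: the diagonal weights are at least 1, the others at most 2/4. With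
  both unknowns negative, the sum of the two left sides would be at most
  \<open>(x + y) / 2 < 0\<close>.\<close>

lemma sign_double_aux:
  fixes a b a' b' x y :: real
  assumes "a * x - b * (y / 4) > 0" "a' * y - b' * (x / 4) > 0" "1 \<le> a" "1 \<le> b" "b \<le> 2" "1 \<le> a'" "1 \<le> b'" "b' \<le> 2"
  shows "x > 0 \<and> y > 0"
proof (rule ccontr)
  assume n: "\<not> ?thesis"
  have "x < 0 \<and> y < 0"
  proof (cases "x > 0")
    case True
    hence "y \<le> 0" using n by simp
    hence "a' * y \<le> 0" "b' * (x / 4) > 0" using True assms by (auto simp: mult_nonneg_nonpos)
    thus ?thesis using assms(2) by linarith
  next
    case False
    hence "a * x \<le> 0" using assms by (simp add: mult_nonneg_nonpos)
    hence "b * (y / 4) < 0" using assms(1) by linarith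
    hence y: "y < 0" using assms by (simp add: mult_less_0_iff)
    hence "a' * y < 0" using assms by (simp add: mult_pos_neg)
    hence "b' * (x / 4) < 0" using assms(2) by linarith
    thus ?thesis using y assms by (simp add: mult_less_0_iff)
  qed
  hence xy: "x < 0" "y < 0" by auto
  have "a * x \<le> 1 * x" "a' * y \<le> 1 * y" using xy assms by (intro mult_right_mono_neg; simp)+
  moreover have "b * (y / 4) \<ge> 2 * (y / 4)" "b' * (x / 4) \<ge> 2 * (x / 4)" using xy assms by (intro mult_right_mono_neg; simp)+
  ultimately show False using assms(1,2) xy by linarith
qed

lemma sign_double:
  fixes p q a b a' b' x y :: real
  assumes "p = a * x - b * (y / 4)" "q = a' * y - b' * (x / 4)" "1 \<le> a" "1 \<le> b" "b \<le> 2" "1 \<le> a'" "1 \<le> b'" "b' \<le> 2"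
    "p \<noteq> 0" "q \<noteq> 0" "p < 0 \<longleftrightarrow> q < 0"
  shows "(x < 0 \<longleftrightarrow> y < 0) \<and> (p < 0 \<longleftrightarrow> x < 0)"
proof (cases "p < 0")
  case True
  hence "a * (- x) - b * (- y / 4) > 0" "a' * (- y) - b' * (- x / 4) > 0" using assms by (auto simp: algebra_simps)
  from sign_double_aux[OF this] assms show ?thesis using True by auto
next
  case False
  hence "a * x - b * (y / 4) > 0" "a' * y - b' * (x / 4) > 0" using assms by auto
  from sign_double_aux[OF this] assms show ?thesis using False by auto
qed

text \<open>For positive values the first equation gives \<open>x > 2 * y\<close>, and then
  \<open>q \<ge> x - y / 2 > 0\<close>.\<close>

lemma sign_forward:
  fixes p q a b a' b' x y :: real
  assumes "p = a * (x / 4) - b * y" "q = a' * x - b' * (y / 4)" "1 \<le> a" "a \<le> 2" "1 \<le> b" "1 \<le> a'" "1 \<le> b'" "b' \<le> 2"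
    "x < 0 \<longleftrightarrow> y < 0" "x \<noteq> 0" "y \<noteq> 0" "p \<noteq> 0" "p < 0 \<longleftrightarrow> x < 0"
  shows "q < 0 \<longleftrightarrow> x < 0"
proof -
  have pos: "q > 0" if "p > 0" "x > 0" "y > 0" "p = a * (x / 4) - b * y" "q = a' * x - b' * (y / 4)" for p q x y
  proof -
    have "a * (x / 4) \<le> 2 * (x / 4)" "1 * y \<le> b * y" "b' * (y / 4) \<le> 2 * (y / 4)" "1 * x \<le> a' * x"
      using assms(3-8) that by (intro mult_right_mono; simp)+
    thus ?thesis using that by linarith
  qed
  show ?thesis
  proof (cases "x < 0")
    case True
    have "- q > 0" by (rule pos[of "- p" "- x" "- y"]) (use True assms in \<open>auto simp: algebra_simps\<close>)
    thus ?thesis using True by simp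
  next
    case False
    have "q > 0" by (rule pos[of p x y]) (use False assms in auto)
    thus ?thesis using False by simp
  qed
qed

section \<open>Group elements that carry lifts to lifts\<close>

context schottky_word
begin

text \<open>If neither end of the lift began with the inverse of the last letter of
  \<open>ys\<close>, ping-pong would send both ends into the arc of \<open>hd ys\<close>, whereas
  the ends of a lift lie in different arcs. So the last letter moves along the lift, and reducedness
  keeps the direction for the other letters.\<close>

lemma word_act_lift_eq:
  assumes "reduced_word ys" "ys \<noteq> []" "u \<in> E" "u' \<in> E" "word_act g ys ` lift u = lift u'"
  shows "\<exists>a\<in>{u, opp u}. (\<forall>k<length ys. ray a k = inverse_word ys ! k) \<and> lift u' = lift ((nx ^^ length ys) a)"
  using assms
proof (induction ys arbitrary: u rule: rev_induct)
  case (snoc x zs)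
  let ?ys = "zs @ [x]"
  have red: "reduced_word zs" "zs \<noteq> [] \<Longrightarrow> x \<noteq> bar (last zs)" using snoc.prems(1) by (auto simp: reduced_word_snoc)
  have "\<exists>a\<in>{u, opp u}. sd a = bar x"
  proof (rule ccontr)
    assume "\<not> ?thesis"
    hence arcs: "word_act g ?ys (pt u) \<in> boundary_arc (D (hd ?ys))" "word_act g ?ys (pt (opp u)) \<in> boundary_arc (D (hd ?ys))"
      using ping_word[OF snoc.prems(1,2) pt_arc[of u]] ping_word[OF snoc.prems(1,2) pt_arc[of "opp u"]] by simp_all
    have "geodesic (word_act g ?ys (pt (opp u))) (word_act g ?ys (pt u)) = geodesic (pt (opp u')) (pt u')"
      using snoc.prems(5) word_act_geodesic[of "pt (opp u)" "pt u" ?ys] by (simp add: lift_def)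
    moreover have "word_act g ?ys (pt (opp u)) \<noteq> word_act g ?ys (pt u)"
      using word_act_inverse[of "pt u" ?ys] word_act_inverse[of "pt (opp u)" ?ys] pt_opp_neq[of u] by (metis order_refl pt_norm)
    ultimately have "{word_act g ?ys (pt (opp u)), word_act g ?ys (pt u)} = {pt (opp u'), pt u'}"
      by (intro geodesic_eq) (simp_all add: disk_map_norm_1[OF word_act_disk_map])
    hence "pt (opp u') \<in> boundary_arc (D (hd ?ys))" "pt u' \<in> boundary_arc (D (hd ?ys))"
    proof -
      have "pt (opp u') \<in> {word_act g ?ys (pt (opp u)), word_act g ?ys (pt u)}" "pt u' \<in> {word_act g ?ys (pt (opp u)), word_act g ?ys (pt u)}"
        unfolding \<open>{word_act g ?ys (pt (opp u)), word_act g ?ys (pt u)} = {pt (opp u'), pt u'}\<close> by blast+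
      thus "pt (opp u') \<in> boundary_arc (D (hd ?ys))" "pt u' \<in> boundary_arc (D (hd ?ys))"
        using arcs by (elim insertE emptyE; simp only:)+
    qed
    hence "sd (opp u') = hd ?ys" "sd u' = hd ?ys" by (simp_all only: arc_disjoint[OF pt_arc])
    thus False using sd_opp[of u'] by simp
  qed
  then obtain a where a: "a \<in> {u, opp u}" "sd a = bar x" by blast
  have aE: "a \<in> E" using a snoc.prems by auto
  have la: "lift u = lift a" using a(1) by (auto simp: lift_opp)
  have gx: "g x ` lift u = lift (nx a)"
    using g_lift[of a] a(2) la lift_opp[of "tau a"] by (simp add: nx_def)
  have r0: "ray a 0 = inverse_word ?ys ! 0" using a(2) by (simp add: sd_def inverse_word_def)
  show ?case
  proof (cases "zs = []")
    case True
    have "lift u' = lift ((nx ^^ length ?ys) a)" using True gx snoc.prems(5) by simp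
    moreover have "\<forall>k<length ?ys. ray a k = inverse_word ?ys ! k" using True r0 by simp
    ultimately show ?thesis using a(1) by blast
  next
    case False
    have "word_act g zs ` lift (nx a) = lift u'"
    proof -
      have "word_act g ?ys = word_act g zs \<circ> g x" by (rule ext) (simp add: word_act_append)
      hence "word_act g zs ` (g x ` lift u) = word_act g ?ys ` lift u" by (simp only: image_comp)
      thus ?thesis using snoc.prems(5) gx by simp
    qed
    from snoc.IH[OF red(1) False nx_E snoc.prems(4) this] obtain a' where
      a': "a' \<in> {nx a, opp (nx a)}" "\<forall>k<length zs. ray a' k = inverse_word zs ! k" "lift u' = lift ((nx ^^ length zs) a')"
      by (elim bexE conjE)
    have "sd a' = bar (last zs)"
    proof -
      have "inverse_word zs ! 0 = bar (last zs)" using False by (cases zs rule: rev_cases) (simp_all add: inverse_word_def)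
      thus ?thesis using a'(2) False by (simp add: sd_def)
    qed
    moreover have "sd (opp (nx a)) = x" using a(2) by (simp add: opp_nx)
    ultimately have "a' = nx a" using a'(1) red(2)[OF False] by auto
    hence r: "ray a (Suc k) = inverse_word zs ! k" if "k < length zs" for k
      using a'(2) that \<open>a' = nx a\<close> by (simp add: ray_nx)
    have "ray a k = inverse_word ?ys ! k" if "k < length ?ys" for k
    proof (cases k)
      case 0 thus ?thesis using r0 by (simp only:)
    next
      case (Suc j)
      have "inverse_word ?ys = bar x # inverse_word zs" by (simp add: inverse_word_def)
      thus ?thesis using r[of j] that Suc by simp
    qed
    moreover have "(nx ^^ length ?ys) a = (nx ^^ length zs) (nx a)"
      by (simp only: length_append_singleton funpow_Suc_right comp_apply)
    hence "lift u' = lift ((nx ^^ length ?ys) a)" using a'(3) \<open>a' = nx a\<close> by (simp only:)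
    ultimately show ?thesis using a(1) by blast
  qed
qed simp

lemma pr_eq_iff:
  assumes "u \<in> E" "v \<in> E" "u' \<in> E" "v' \<in> E"
  shows "pr u v = pr u' v' \<longleftrightarrow> (u' = u \<or> u' = opp u) \<and> (v' = v \<or> v' = opp v) \<or> (u' = v \<or> u' = opp v) \<and> (v' = u \<or> v' = opp u)"
  unfolding pr_def doubleton_eq_iff lift_eq_iff[OF assms(1,3)] lift_eq_iff[OF assms(2,4)] lift_eq_iff[OF assms(1,4)] lift_eq_iff[OF assms(2,3)]
  by blast

text \<open>Converse of \<open>chain_class\<close>: the same reduced word moves along both lifts,
  hence they have this word in common.\<close>

lemma class_eq_chain:
  assumes cr: "crossing u v" "crossing u' v'" and cl: "cl u v = cl u' v'"
  shows "pr u v = pr u' v' \<or> (\<exists>n>0. \<exists>a\<in>{u, opp u}. \<exists>b\<in>{v, opp v}. (\<forall>k<n. ray a k = ray b k) \<and>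
    pr ((nx ^^ n) a) ((nx ^^ n) b) = pr u' v')"
proof -
  have E: "u \<in> E" "v \<in> E" "u' \<in> E" "v' \<in> E" using cr by (auto simp: crossing_def)
  have "(pr u v, pr u' v') \<in> R"
    using eq_equiv_class_iff[OF equiv_R pr_in_P[OF cr(1)] pr_in_P[OF cr(2)]] cl by (simp add: cl_def)
  then obtain xs where xs: "(\<lambda>S. word_act g xs ` S) ` pr u v = pr u' v'" by (auto simp: pair_equiv_def)
  obtain ys where ys: "reduced_word ys" "\<And>z. cmod z \<le> 1 \<Longrightarrow> word_act g ys z = word_act g xs z" using word_act_reduce by blast
  have "word_act g ys ` lift q = word_act g xs ` lift q" for q
    using ys(2) lift_ball[of q] by (intro image_cong refl) force
  hence im: "{word_act g ys ` lift u, word_act g ys ` lift v} = {lift u', lift v'}" using xs by (simp add: pr_def)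
  show ?thesis
  proof (cases "ys = []")
    case True
    thus ?thesis using im by (simp add: pr_def)
  next
    case False
    obtain p q where pq: "p \<in> E" "q \<in> E" "pr p q = pr u' v'" "word_act g ys ` lift u = lift p" "word_act g ys ` lift v = lift q"
      using im E(3,4) pr_commute[of u' v'] unfolding doubleton_eq_iff by blast
    obtain a where a: "a \<in> {u, opp u}" "\<And>k. k < length ys \<Longrightarrow> ray a k = inverse_word ys ! k" "lift p = lift ((nx ^^ length ys) a)"
      using word_act_lift_eq[OF ys(1) False E(1) pq(1,4)] by blast
    obtain b where b: "b \<in> {v, opp v}" "\<And>k. k < length ys \<Longrightarrow> ray b k = inverse_word ys ! k" "lift q = lift ((nx ^^ length ys) b)"
      using word_act_lift_eq[OF ys(1) False E(2) pq(2,5)] by blast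
    have "pr ((nx ^^ length ys) a) ((nx ^^ length ys) b) = pr u' v'"
      using pq(3) a(3) b(3) by (simp add: pr_def)
    moreover have "\<forall>k<length ys. ray a k = ray b k" using a(2) b(2) by simp
    moreover have "length ys > 0" using False by simp
    ultimately show ?thesis using a(1) b(1) by blast
  qed
qed

text \<open>Only the two end sides of the common word are kept, together with the fact that the
  second is viewed in the opposite direction; this suffices to tell classes apart in
  \<open>card_upper_example\<close>.\<close>

lemma class_eq_shared:
  assumes cr: "crossing u v" "crossing u' v'" and cl: "cl u v = cl u' v'"
  shows "pr u v = pr u' v' \<or> (\<exists>a\<in>{u, opp u}. \<exists>b\<in>{v, opp v}. sd a = sd b \<and>
    (\<exists>a'\<in>E. \<exists>b'\<in>E. sd a' = sd b' \<and> snd a' \<noteq> snd a \<and> snd b' \<noteq> snd b \<and> pr a' b' = pr u' v'))"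
proof (cases "pr u v = pr u' v'")
  case False
  then obtain n a b where n: "n > 0" "a \<in> {u, opp u}" "b \<in> {v, opp v}" "\<forall>k<n. ray a k = ray b k"
    "pr ((nx ^^ n) a) ((nx ^^ n) b) = pr u' v'" using class_eq_chain[OF assms] by blast
  obtain m where m: "n = Suc m" using n(1) by (cases n) auto
  let ?a = "tau ((nx ^^ m) a)" and ?b = "tau ((nx ^^ m) b)"
  have "sd a = sd b" using n(1,4) by (simp add: sd_def)
  moreover have "sd ?a = sd ?b" using n(4) m by (simp add: sd_funpow)
  moreover have "pr ?a ?b = pr u' v'" using n(5) unfolding m by (simp add: nx_def[of "(nx ^^ m) _"])
  moreover have "snd ?a \<noteq> snd a" "snd ?b \<noteq> snd b" by simp_all
  ultimately show ?thesis using n(2,3) tau_E by blast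
qed simp

lemma generic_weight:
  obtains c :: real where "1 < c" "c < 2"
    "\<And>u v. u \<in> E \<Longrightarrow> v \<in> E \<Longrightarrow> sd u = sd v \<Longrightarrow> u \<noteq> v \<Longrightarrow> cd u - cd v \<noteq> c * (cd (tau u) - cd (tau v))"
proof -
  \<comment> \<open>The ratios that would produce a tie: finitely many, so the open interval
    contains another value.\<close>
  define B where "B = (\<lambda>(u, v). (cd u - cd v) / (cd (tau u) - cd (tau v))) ` (E \<times> E)"
  have "infinite ({1<..<2::real} - B)"
    using finite_E by (intro Diff_infinite_finite) (auto simp: B_def infinite_Ioo)
  then obtain c where c: "c \<in> {1<..<2} - B" by (metis finite.emptyI ex_in_conv)
  have "cd u - cd v \<noteq> c * (cd (tau u) - cd (tau v))" if "u \<in> E" "v \<in> E" "sd u = sd v" "u \<noteq> v" for u v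
  proof
    assume a: "cd u - cd v = c * (cd (tau u) - cd (tau v))"
    have "tau u \<noteq> tau v" using that tau_tau by metis
    hence "cd (tau u) \<noteq> cd (tau v)" using that by (simp add: cd_inj)
    hence "c = (cd u - cd v) / (cd (tau u) - cd (tau v))" using a by simp
    hence "c \<in> B" using that by (auto simp: B_def)
    thus False using c by simp
  qed
  thus ?thesis using that[of c] c by auto
qed

end

section \<open>A drawing with at most one crossing per chain\<close>

locale weighted_word = schottky_word +
  fixes c :: real
  assumes c: "1 < c" "c < 2"
    and generic: "\<And>u v. u \<in> E \<Longrightarrow> v \<in> E \<Longrightarrow> sd u = sd v \<Longrightarrow> u \<noteq> v \<Longrightarrow> cd u - cd v \<noteq> c * (cd (tau u) - cd (tau v))"
begin

text \<open>The strand through \<open>u\<close> crosses the side \<open>sd u\<close> at position \<open>pos u\<close>. Moving along two strands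
  with a common initial word, the difference of the forward codes grows by the factor 4 at each
  wall and that of the backward codes shrinks by the factor 4; so the sign of the difference of the
  positions changes at most once, from that of the backward to that of the forward codes. The factor
  \<open>c\<close> rules out ties.\<close>

definition pos :: "state \<Rightarrow> real" where
  "pos u = (if positive (sd u) then cd u - c * cd (tau u) else c * cd u - cd (tau u))"

text \<open>The spacing 20 exceeds twice the bound 6 of \<open>pos_bound\<close>, so the sides
  occupy disjoint blocks in the order of \<open>idx\<close>.\<close>

definition xc :: "state \<Rightarrow> real" where "xc u = 20 * real (idx (sd u)) + pos u"

lemma cd_bounds: "0 \<le> cd u" "cd u \<le> 8 / 3"
  unfolding cd_def using code_bounds[OF ray_reduced] by auto

text \<open>Exactly one of a letter and its inverse is \<open>positive\<close>, so
  \<open>tau\<close> exchanges the two cases of \<open>pos\<close>. This makes the gluing reverse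
  the order on a side.\<close>

lemma pos_tau: "u \<in> E \<Longrightarrow> pos (tau u) = - pos u"
  by (simp add: pos_def positive_bar tau_tau)

lemma pos_bound: "\<bar>pos u\<bar> < 6"
proof -
  have "0 \<le> c * cd v" "c * cd v \<le> 2 * (8 / 3)" for v
    using c cd_bounds[of v] mult_mono[of c 2 "cd v" "8 / 3"] by simp_all
  from this[of u] this[of "tau u"] show ?thesis
    using cd_bounds[of u] cd_bounds[of "tau u"] unfolding pos_def by (auto simp: abs_if)
qed

lemma pos_inj: assumes "u \<in> E" "v \<in> E" "sd u = sd v" "u \<noteq> v" shows "pos u \<noteq> pos v"
proof (cases "positive (sd u)")
  case True thus ?thesis using generic[OF assms] assms(3) by (simp add: pos_def algebra_simps)
next
  case False
  have "tau u \<noteq> tau v" using assms tau_tau by metis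
  from generic[OF _ _ _ this] False show ?thesis using assms by (simp add: pos_def tau_tau algebra_simps)
qed

lemma pos_diff:
  assumes "sd u = sd v"
  obtains a b where "pos u - pos v = a * (cd u - cd v) - b * (cd (tau u) - cd (tau v))" "1 \<le> a" "a \<le> 2" "1 \<le> b" "b \<le> 2"
proof (cases "positive (sd u)")
  case True
  show ?thesis by (rule that[of 1 c]) (use True assms c in \<open>simp_all add: pos_def algebra_simps\<close>)
next
  case False
  show ?thesis by (rule that[of c 1]) (use False assms c in \<open>simp_all add: pos_def algebra_simps\<close>)
qed

lemma xc_less_side: "sd u \<noteq> sd v \<Longrightarrow> xc u < xc v \<longleftrightarrow> idx (sd u) < idx (sd v)"
proof -
  assume "sd u \<noteq> sd v"
  hence "idx (sd u) \<noteq> idx (sd v)" by simp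
  hence "real (idx (sd u)) + 1 \<le> real (idx (sd v)) \<or> real (idx (sd v)) + 1 \<le> real (idx (sd u))" by linarith
  thus ?thesis unfolding xc_def using pos_bound[of u] pos_bound[of v] by auto
qed

lemma xc_less_same: "sd u = sd v \<Longrightarrow> xc u < xc v \<longleftrightarrow> pos u < pos v"
  by (simp add: xc_def)

lemma inj_xc: "inj_on xc E"
proof (rule inj_onI)
  fix u v assume uv: "u \<in> E" "v \<in> E" "xc u = xc v"
  show "u = v"
  proof (cases "sd u = sd v")
    case True thus ?thesis using uv pos_inj[of u v] by (auto simp: xc_def)
  next
    case False
    hence "idx (sd u) \<noteq> idx (sd v)" by simp
    hence "idx (sd u) < idx (sd v) \<or> idx (sd v) < idx (sd u)" by linarith
    thus ?thesis using xc_less_side[OF False] xc_less_side[of v u] False uv(3) by auto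
  qed
qed

sublocale glued_polygon E xc "\<lambda>u. idx (sd u)" tau
proof
  show "finite E" by (rule finite_E)
  show "inj_on xc E" by (rule inj_xc)
  fix u assume u: "u \<in> E"
  show "idx (sd u) \<le> 3" by (rule idx_le)
  show "tau u \<in> E" "tau (tau u) = u" "idx (sd (tau u)) = 3 - idx (sd u)" using u by (simp_all add: tau_tau idx_bar)
  fix v assume v: "v \<in> E"
  show "xc u < xc v \<Longrightarrow> idx (sd u) \<le> idx (sd v)" using xc_less_side[of u v] by (cases "sd u = sd v") auto
  assume "idx (sd u) = idx (sd v)" "xc u < xc v"
  thus "xc (tau v) < xc (tau u)" using u v by (simp add: xc_less_same pos_tau)
qed

lemma chord_matching_opp: "chord_matching opp"
  unfolding chord_matching_def using sd_opp by simp

definition sep :: "state \<Rightarrow> state \<Rightarrow> bool" where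
  "sep u v \<longleftrightarrow> separates (xc u) (xc (opp u)) (xc v) (xc (opp v))"

lemma sep_opp [simp]: "sep (opp u) v = sep u v" "sep u (opp v) = sep u v"
  by (simp_all add: sep_def separates_flip[of "xc (opp u)" "xc u"] separates_flip(2)[of _ _ "xc (opp v)" "xc v"])

lemma sep_commute: assumes "u \<in> E" "v \<in> E" "v \<noteq> u" "v \<noteq> opp u" shows "sep u v = sep v u"
proof -
  have "opp v \<noteq> u" using assms(4) by auto
  thus ?thesis
  unfolding sep_def using assms by (intro separates_sym) (simp_all add: inj_on_eq_iff[OF inj_xc])
qed

definition linked :: "state \<Rightarrow> state \<Rightarrow> bool" where
  "linked u v \<longleftrightarrow> (cd u < cd v \<longleftrightarrow> cd (tau u) < cd (tau v))"

text \<open>The strands are ordered on the side as their forward ends are; a linked pair has thus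
  already switched its order before this side.\<close>

definition fw :: "state \<Rightarrow> state \<Rightarrow> bool" where
  "fw u v \<longleftrightarrow> (pos u < pos v \<longleftrightarrow> cd u < cd v)"

lemma cd_tau_diff: assumes "sd u = sd v" "sd (opp u) = sd (opp v)" 
  shows "cd (tau u) - cd (tau v) = (cd (opp u) - cd (opp v)) / 4"
proof -
  have "ray (tau u) 0 = ray (tau v) 0" "ray (tau u) 1 = ray (tau v) 1"
    using assms ray_tau_Suc[of u 0] ray_tau_Suc[of v 0] by (auto simp: ray_tau_0 sd_def)
  from code_less_tl[OF this] show ?thesis by (simp add: cd_def tl_ray_tau)
qed

text \<open>If the other sides differ, separation makes the order of positions that of the backward
  codes, and \<open>sign_single\<close> applies. If they agree, separation makes the orders of
  positions on both sides agree, and \<open>sign_double\<close> applies.\<close>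

lemma sep_shared:
  assumes u: "u \<in> E" "v \<in> E" "sd u = sd v" "u \<noteq> v" and s: "sep u v"
  shows "linked u v \<and> fw u v"
proof -
  have nt: "tau u \<noteq> tau v" using u tau_tau by metis
  have d0: "cd u - cd v \<noteq> 0" "cd (tau u) - cd (tau v) \<noteq> 0" using u nt by (simp_all add: cd_inj)
  have p0: "pos u - pos v \<noteq> 0" using pos_inj[OF u] by simp
  have su: "sd (opp u) \<noteq> sd v" "sd (opp v) \<noteq> sd v" using sd_opp[of u] sd_opp[of v] u(3) by auto
  obtain a b where ab: "pos u - pos v = a * (cd u - cd v) - b * (cd (tau u) - cd (tau v))" "1 \<le> a" "a \<le> 2" "1 \<le> b" "b \<le> 2"
    using pos_diff[OF u(3)] .
  have x: "xc u < xc v \<longleftrightarrow> pos u < pos v" "xc (opp u) < xc v \<longleftrightarrow> idx (sd (opp u)) < idx (sd v)"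
    "xc u < xc (opp v) \<longleftrightarrow> idx (sd v) < idx (sd (opp v))"
    using u(3) su xc_less_side[of "opp u" v] xc_less_side[of u "opp v"] by (auto simp: xc_less_same)
  show ?thesis
  proof (cases "sd (opp u) = sd (opp v)")
    case False
    have "xc (opp u) < xc (opp v) \<longleftrightarrow> idx (sd (opp u)) < idx (sd (opp v))" using xc_less_side[OF False] .
    hence "pos u < pos v \<longleftrightarrow> rank (bar (sd v)) (sd (opp u)) < rank (bar (sd v)) (sd (opp v))"
      using s rank_separates[OF su False] unfolding sep_def separates_def x by blast
    also have "\<dots> \<longleftrightarrow> cd (tau u) < cd (tau v)"
      unfolding cd_def using u(3) False ray_tau_Suc[of u 0] ray_tau_Suc[of v 0]
      by (subst code_less_digit[OF ray_reduced ray_reduced]) (auto simp: ray_tau_0 sd_def)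
    finally have "pos u - pos v < 0 \<longleftrightarrow> cd (tau u) - cd (tau v) < 0" by simp
    from sign_single[OF ab(1,2,4) d0 this] show ?thesis by (simp add: linked_def fw_def)
  next
    case True
    have "xc (opp u) < xc (opp v) \<longleftrightarrow> pos (opp u) < pos (opp v)" using xc_less_same[OF True] .
    hence pp: "pos u - pos v < 0 \<longleftrightarrow> pos (opp u) - pos (opp v) < 0"
      using s su unfolding sep_def separates_def x True by (auto simp: linorder_neq_iff)
    obtain a' b' where ab': "pos (opp u) - pos (opp v) = a' * (cd (opp u) - cd (opp v)) - b' * (cd (tau (opp u)) - cd (tau (opp v)))"
       "1 \<le> a'" "a' \<le> 2" "1 \<le> b'" "b' \<le> 2"
      using pos_diff[OF True] .
    have q0: "pos (opp u) - pos (opp v) \<noteq> 0" using pos_inj[of "opp u" "opp v"] u True by simp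
    have t: "cd (tau u) - cd (tau v) = (cd (opp u) - cd (opp v)) / 4" "cd (tau (opp u)) - cd (tau (opp v)) = (cd u - cd v) / 4"
      using cd_tau_diff[OF u(3) True] cd_tau_diff[of "opp u" "opp v"] u(3) True by simp_all
    have "(cd u - cd v < 0 \<longleftrightarrow> cd (opp u) - cd (opp v) < 0) \<and> (pos u - pos v < 0 \<longleftrightarrow> cd u - cd v < 0)"
      by (rule sign_double[OF ab(1)[unfolded t] ab'(1)[unfolded t] ab(2,4,5) ab'(2,4,5) p0 q0 pp])
    moreover have "cd (tau u) < cd (tau v) \<longleftrightarrow> cd (opp u) - cd (opp v) < 0" using t(1) by auto
    ultimately show ?thesis by (simp add: linked_def fw_def)
  qed
qed

lemma fw_nx:
  assumes u: "u \<in> E" "v \<in> E" "sd u = sd v" "u \<noteq> v" and n: "sd (nx u) = sd (nx v)" "linked u v" "fw u v"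
  shows "linked (nx u) (nx v) \<and> fw (nx u) (nx v)"
proof -
  have nt: "tau u \<noteq> tau v" using u tau_tau by metis
  have d0: "cd u - cd v \<noteq> 0" "cd (tau u) - cd (tau v) \<noteq> 0" using u nt by (simp_all add: cd_inj)
  have p0: "pos u - pos v \<noteq> 0" using pos_inj[OF u] by simp
  have t1: "cd u - cd v = (cd (nx u) - cd (nx v)) / 4"
    using cd_tau_diff[of "tau u" "tau v"] u n(1) by (simp add: tau_tau nx_def)
  have t2: "cd (tau (nx u)) - cd (tau (nx v)) = (cd (tau u) - cd (tau v)) / 4"
    using cd_tau_diff[of "nx u" "nx v"] u(3) n(1) by (simp add: opp_nx)
  obtain a b where ab: "pos u - pos v = a * (cd u - cd v) - b * (cd (tau u) - cd (tau v))" "1 \<le> a" "a \<le> 2" "1 \<le> b" "b \<le> 2"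
    using pos_diff[OF u(3)] .
  obtain a' b' where ab': "pos (nx u) - pos (nx v) = a' * (cd (nx u) - cd (nx v)) - b' * (cd (tau (nx u)) - cd (tau (nx v)))"
     "1 \<le> a'" "a' \<le> 2" "1 \<le> b'" "b' \<le> 2"
    using pos_diff[OF n(1)] .
  have l: "cd (nx u) - cd (nx v) < 0 \<longleftrightarrow> cd (tau u) - cd (tau v) < 0" using n(2) t1 by (auto simp: linked_def)
  have f: "pos u - pos v < 0 \<longleftrightarrow> cd (nx u) - cd (nx v) < 0" using n(3) t1 by (auto simp: fw_def)
  have "pos (nx u) - pos (nx v) < 0 \<longleftrightarrow> cd (nx u) - cd (nx v) < 0"
    by (rule sign_forward[OF ab(1)[unfolded t1] ab'(1)[unfolded t2] ab(2,3,4) ab'(2,4,5) l _ d0(2) p0 f]) (use d0(1) t1 in simp)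
  moreover have "cd (tau (nx u)) < cd (tau (nx v)) \<longleftrightarrow> cd (tau u) - cd (tau v) < 0" using t2 by auto
  ultimately show ?thesis using l by (simp add: linked_def fw_def)
qed

text \<open>\<open>tau\<close> reverses positions but, for a linked pair, keeps the order of the
  codes.\<close>

lemma fw_tau:
  assumes u: "u \<in> E" "v \<in> E" "sd u = sd v" "u \<noteq> v" "linked u v"
  shows "fw (tau u) (tau v) \<longleftrightarrow> \<not> fw u v"
  using pos_inj[OF u(1-4)] u(5) unfolding fw_def linked_def pos_tau[OF u(1)] pos_tau[OF u(2)] by auto

lemma sep_crossing:
  assumes u: "u \<in> E" "v \<in> E" "v \<noteq> u" "v \<noteq> opp u" and s: "sep u v"
  shows "crossing u v"
proof (cases "\<exists>a\<in>{u, opp u}. \<exists>b\<in>{v, opp v}. sd a = sd b")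
  case True
  then obtain a b where ab: "a \<in> {u, opp u}" "b \<in> {v, opp v}" "sd a = sd b" by blast
  have E: "a \<in> E" "b \<in> E" "a \<noteq> b" using ab u by auto
  have "sep a b" using ab s by auto
  hence "meets a b" using sep_shared[OF E(1,2) ab(3) E(3)] meets_shared[OF E(1,2) ab(3) E(3)] by (simp add: linked_def)
  hence "meets u v" using ab by auto
  thus ?thesis using u by (simp add: crossing_def)
next
  case False
  have d: "distinct [sd u, sd (opp u), sd v, sd (opp v)]" using False sd_opp[of u] sd_opp[of v] by auto
  have "meets u v"
    using s d separates_letters[OF d] xc_less_side[of u v] xc_less_side[of "opp u" v] xc_less_side[of u "opp v"] xc_less_side[of "opp u" "opp v"]
    unfolding meets_letters[OF u(1,2) d] sep_def separates_def by simp
  thus ?thesis using u by (simp add: crossing_def)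
qed

text \<open>The first drawn crossing gives \<open>fw\<close> at the start of the common word, and
  \<open>fw_nx\<close> carries it to the end. A second one there would give \<open>fw\<close> in the
  reversed direction, contradicting \<open>fw_tau\<close>.\<close>

lemma sep_chain_False:
  assumes u: "crossing a b" "sep a b" and n: "n > 0" "\<And>k. k < n \<Longrightarrow> ray a k = ray b k" and s: "sep ((nx ^^ n) a) ((nx ^^ n) b)"
  shows False
proof -
  have cr: "crossing ((nx ^^ k) a) ((nx ^^ k) b)" if "k \<le> n" for k using chain_class[OF u(1), of k] n(2) that by auto
  have sd: "sd ((nx ^^ k) a) = sd ((nx ^^ k) b)" if "k < n" for k using n(2)[OF that] by (simp add: sd_funpow)
  have f: "linked ((nx ^^ k) a) ((nx ^^ k) b) \<and> fw ((nx ^^ k) a) ((nx ^^ k) b)" if "k < n" for k using that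
  proof (induction k)
    case 0 thus ?case using sep_shared[of a b] sd[of 0] cr[of 0] u(2) by (auto simp: crossing_def)
  next
    case (Suc k)
    thus ?case using fw_nx[of "(nx ^^ k) a" "(nx ^^ k) b"] sd[of k] sd[of "Suc k"] cr[of k] by (auto simp: crossing_def)
  qed
  obtain m where m: "n = Suc m" using n(1) by (cases n) auto
  let ?a = "(nx ^^ m) a" and ?b = "(nx ^^ m) b"
  have E: "?a \<in> E" "?b \<in> E" "?a \<noteq> ?b" using cr[of m] m by (auto simp: crossing_def)
  have "sep (tau ?a) (tau ?b)" using s by (simp add: m nx_def[of ?a] nx_def[of ?b])
  moreover have "tau ?a \<noteq> tau ?b" using E tau_tau by metis
  ultimately have "fw (tau ?a) (tau ?b)" using sep_shared[of "tau ?a" "tau ?b"] sd[of m] m by simp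
  thus False using fw_tau[OF E(1,2) sd E(3)] f[of m] m by simp
qed

definition sep_pairs :: "(int \<times> int) set" where
  "sep_pairs = {(i, j). 0 \<le> i \<and> i < j \<and> j < L \<and> sep (i, True) (j, True)}"

lemma sep_fst: "sep u v = sep (fst u, True) (fst v, True)"
  using sep_opp(1)[of "(fst u, True)"] sep_opp(2)[of _ "(fst v, True)"] by (cases u; cases v; cases "snd u"; cases "snd v") (simp_all add: opp_def)

lemma same_class_same_pair:
  assumes "(i, j) \<in> sep_pairs" "(i', j') \<in> sep_pairs" "cl (i, True) (j, True) = cl (i', True) (j', True)"
  shows "(i, j) = (i', j')"
proof -
  let ?u = "(i, True)" and ?v = "(j, True)" and ?u' = "(i', True)" and ?v' = "(j', True)"
  have E: "?u \<in> E" "?v \<in> E" "?u' \<in> E" "?v' \<in> E" using assms by (auto simp: sep_pairs_def E_def)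
  have lt: "i < j" "i' < j'" and sp: "sep ?u ?v" "sep ?u' ?v'" using assms by (auto simp: sep_pairs_def)
  have cr: "crossing ?u ?v" "crossing ?u' ?v'" using E lt sp by (intro sep_crossing; simp add: opp_def)+
  show ?thesis
  proof (cases "pr ?u ?v = pr ?u' ?v'")
    case True
    hence "i = i' \<and> j = j' \<or> i = j' \<and> j = i'" unfolding pr_eq_iff[OF E] by (auto simp: opp_def)
    thus ?thesis using lt by auto
  next
    case False
    then obtain n a b where n: "n > 0" "a \<in> {?u, opp ?u}" "b \<in> {?v, opp ?v}" "\<forall>k<n. ray a k = ray b k"
      "pr ((nx ^^ n) a) ((nx ^^ n) b) = pr ?u' ?v'" using class_eq_chain[OF cr assms(3)] by blast
    have "a \<in> E" "b \<in> E" using n(2,3) E(1,2) by auto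
    hence aE: "(nx ^^ n) a \<in> E" "(nx ^^ n) b \<in> E" by (simp_all add: funpow_E)
    have "sep ?v' ?u'" using sp(2) sep_commute[OF E(3,4)] lt by (simp add: opp_def)
    hence "sep ((nx ^^ n) a) ((nx ^^ n) b)"
      using n(5)[symmetric] sp(2) unfolding pr_eq_iff[OF E(3,4) aE] by auto
    moreover have "sep a b" "crossing a b" using n(2,3) sp(1) cr(1) by auto
    ultimately have False using sep_chain_False[of a b n] n(1,4) by auto
    thus ?thesis ..
  qed
qed

lemma card_sep_pairs_le: "card sep_pairs \<le> card (P // R)"
proof (rule card_inj_on_le)
  show "inj_on (\<lambda>(i, j). cl (i, True) (j, True)) sep_pairs"
  proof (rule inj_onI)
    fix p q assume "p \<in> sep_pairs" "q \<in> sep_pairs" "(case p of (i, j) \<Rightarrow> cl (i, True) (j, True)) = (case q of (i, j) \<Rightarrow> cl (i, True) (j, True))"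
    thus "p = q" using same_class_same_pair by (cases p; cases q) auto
  qed
  show "(\<lambda>(i, j). cl (i, True) (j, True)) ` sep_pairs \<subseteq> P // R"
  proof
    fix q assume "q \<in> (\<lambda>(i, j). cl (i, True) (j, True)) ` sep_pairs"
    then obtain i j where ij: "(i, j) \<in> sep_pairs" "q = cl (i, True) (j, True)" by auto
    hence "crossing (i, True) (j, True)" by (intro sep_crossing) (auto simp: sep_pairs_def E_def opp_def)
    thus "q \<in> P // R" using ij(2) pr_in_P unfolding cl_def by (auto intro: quotientI)
  qed
  show "finite (P // R)" using finite_P by (rule finite_quotient) (auto simp: pair_equiv_def)
qed

lemma finite_sep_pairs: "finite sep_pairs"
  by (rule finite_subset[of _ "{0..<L} \<times> {0..<L}"]) (auto simp: sep_pairs_def)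

lemma card_crossings_le: "card (crossings E xc opp) \<le> 8 * card sep_pairs"
proof -
  \<comment> \<open>The factor 8: a direction for each of the two lifts, and the order of the
    pair.\<close>
  let ?f = "\<lambda>((i, j), b, b', s). if s then ((i, b), (j, b')) else ((j, b'), (i, b))"
  have "crossings E xc opp \<subseteq> ?f ` (sep_pairs \<times> (UNIV :: (bool \<times> bool \<times> bool) set))"
  proof
    fix p assume "p \<in> crossings E xc opp"
    then obtain u v where p: "p = (u, v)" "u \<in> E" "v \<in> E" "u \<noteq> v" "v \<noteq> opp u" "sep u v"
      by (auto simp: crossings_def sep_def)
    have s: "sep (fst u, True) (fst v, True)" "sep (fst v, True) (fst u, True)"
      using p sep_commute sep_fst by metis+
    have ne: "fst u \<noteq> fst v" using p by (auto simp: opp_def prod_eq_iff)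
    have r: "0 \<le> fst u" "fst u < L" "0 \<le> fst v" "fst v < L" using p by (auto simp: E_def)
    show "p \<in> ?f ` (sep_pairs \<times> UNIV)"
    proof (cases "fst u < fst v")
      case True
      hence "(fst u, fst v) \<in> sep_pairs" using s r by (simp add: sep_pairs_def)
      thus ?thesis by (intro image_eqI[of _ _ "((fst u, fst v), snd u, snd v, True)"]) (simp_all add: p(1))
    next
      case False
      hence "(fst v, fst u) \<in> sep_pairs" using s r ne by (simp add: sep_pairs_def)
      thus ?thesis by (intro image_eqI[of _ _ "((fst v, fst u), snd v, snd u, False)"]) (simp_all add: p(1))
    qed
  qed
  hence "card (crossings E xc opp) \<le> card (?f ` (sep_pairs \<times> (UNIV :: (bool \<times> bool \<times> bool) set)))"
    using finite_sep_pairs by (intro card_mono) auto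
  also have "\<dots> \<le> card (sep_pairs \<times> (UNIV :: (bool \<times> bool \<times> bool) set))"
    using finite_sep_pairs by (intro card_image_le) auto
  also have "\<dots> = 8 * card sep_pairs" by (simp add: card_cartesian_product card_UNIV_bool flip: UNIV_Times_UNIV)
  finally show ?thesis .
qed

text \<open>A single closed geodesic is one component: \<open>nx\<close> and \<open>opp\<close>
  reach every state from \<open>(0, True)\<close>, so an invariant labelling has one value. Then
  \<open>4 * L \<le> 8 + 8 * card sep_pairs\<close>.\<close>

lemma classes_lower_weighted: "length w \<le> 2 * card (P // R) + 2"
proof -
  obtain l :: "state \<Rightarrow> state set" where l: "\<And>u. u \<in> E \<Longrightarrow> l (opp u) = l u" "\<And>u. u \<in> E \<Longrightarrow> l (tau u) = l u"
    "2 * card E \<le> 8 * card (l ` E) + card (crossings E xc opp)"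
    using labelling_exists[OF chord_matching_opp] by blast
  have nx: "l (nx u) = l u" if "u \<in> E" for u using l that by (simp add: nx_def)
  have "l (int n, True) = l (0, True)" if "n < length w" for n using that
  proof (induction n)
    case (Suc n)
    have "nx (int n, True) = (int (Suc n), True)" using Suc.prems by (simp add: nx_def tau_def opp_def)
    moreover have "(int n, True) \<in> E" using Suc.prems by (simp add: E_def)
    ultimately show ?case using nx Suc by (metis Suc_lessD)
  qed simp
  hence T: "l (i, True) = l (0, True)" if "(i, True) \<in> E" for i
    using that zero_le_imp_eq_int[of i] by (auto simp: E_def)
  have "l u = l (0, True)" if u: "u \<in> E" for u
  proof (cases "snd u")
    case True thus ?thesis using T[of "fst u"] u by (cases u) auto
  next
    case False
    hence "opp u = (fst u, True)" by (simp add: opp_def)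
    thus ?thesis using T[of "fst u"] l(1)[OF u] u opp_E[of u] by simp
  qed
  hence "l ` E \<subseteq> {l (0, True)}" by auto
  hence "card (l ` E) \<le> 1" by (metis card_mono finite.emptyI finite_insert is_singletonI is_singleton_altdef)
  thus ?thesis using l(3) card_crossings_le card_sep_pairs_le unfolding card_E by linarith
qed

end

context schottky_word
begin

lemma classes_lower: "length w \<le> 2 * card (P // R) + 2"
proof -
  obtain c :: real where c: "1 < c" "c < 2"
    "\<And>u v. u \<in> E \<Longrightarrow> v \<in> E \<Longrightarrow> sd u = sd v \<Longrightarrow> u \<noteq> v \<Longrightarrow> cd u - cd v \<noteq> c * (cd (tau u) - cd (tau v))"
    using generic_weight by blast
  interpret weighted_word g D w c using c by unfold_locales
  show ?thesis by (rule classes_lower_weighted)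
qed

end

section \<open>Powers of words\<close>

lemma word_power_0 [simp]: "word_power u 0 = []" by (simp add: word_power_def)
lemma word_power_Suc: "word_power u (Suc m) = u @ word_power u m" by (simp add: word_power_def)
lemma word_power_1 [simp]: "word_power u (Suc 0) = u" by (simp add: word_power_Suc)

lemma word_power_add: "word_power u (m + n) = word_power u m @ word_power u n"
  by (simp add: word_power_def replicate_add)

lemma word_power_mult: "word_power (word_power u m) n = word_power u (m * n)"
  by (induction n) (simp_all add: word_power_Suc word_power_add)

lemma nth_word_power: "i < m * length u \<Longrightarrow> word_power u m ! i = u ! (i mod length u)"
  by (simp add: word_power_def nth_concat_replicate)

lemma count_word_power: "count_list (word_power u m) x = m * count_list u x"
  by (induction m) (simp_all add: word_power_Suc count_list_append)

lemma word_power_exponent_le: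
  assumes "w \<noteq> []" "w = word_power u m" shows "m \<le> length w"
proof -
  have "u \<noteq> []" using assms by (cases m) (auto simp: word_power_def)
  thus ?thesis using assms(2) by (cases u) auto
qed

lemma word_exponent_ge: "w \<noteq> [] \<Longrightarrow> w = word_power u m \<Longrightarrow> m \<le> word_exponent w"
  unfolding word_exponent_def using word_power_exponent_le by (intro Greatest_le_nat[where b="length w"]) blast+

lemma word_root_power:
  assumes "w \<noteq> []" shows "w = word_power (word_root w) (word_exponent w)"
proof -
  have "\<exists>u. w = word_power u (word_exponent w)"
    unfolding word_exponent_def using word_power_exponent_le[OF assms]
    by (rule_tac GreatestI_nat[where k="Suc 0" and b="length w"]) (auto intro: exI[of _ w])
  then obtain u where u: "w = word_power u (word_exponent w)" by blast
  define m where "m = word_exponent w"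
  have wu: "w = word_power u m" using u by (simp only: m_def)
  have m: "m \<noteq> 0" using wu assms by (cases m) auto
  have "length w div m = length u" using wu m by simp
  moreover have "take (length u) w = u" using wu m by (cases m) (simp_all add: word_power_Suc)
  ultimately have "word_root w = u" unfolding word_root_def m_def by (simp only:)
  thus ?thesis using u by (simp only:)
qed

lemma word_exponent_pos: "w \<noteq> [] \<Longrightarrow> word_exponent w > 0"
  using word_exponent_ge[of w w "Suc 0"] by simp

lemma length_word_root: "w \<noteq> [] \<Longrightarrow> length w = word_exponent w * length (word_root w)"
  using word_root_power[of w] length_word_power[of "word_root w" "word_exponent w"] by simp

lemma word_root_primitive:
  assumes w: "w \<noteq> []" and u: "word_root w = word_power u m" shows "m = 1"
proof -
  have "w = word_power u (m * word_exponent w)"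
    using word_root_power[OF w] unfolding u word_power_mult .
  hence "m * word_exponent w \<le> word_exponent w" by (rule word_exponent_ge[OF w])
  hence "m \<le> 1" using word_exponent_pos[OF w] by simp
  moreover have "m \<noteq> 0"
  proof
    assume "m = 0"
    hence "length (word_root w) = 0" using u by simp
    thus False using length_word_root[OF w] w by simp
  qed
  ultimately show ?thesis by simp
qed

lemma word_exponent_primitive:
  assumes "w \<noteq> []" "\<And>u m. w = word_power u m \<Longrightarrow> m = 1"
  shows "word_exponent w = 1" "word_root w = w"
proof -
  show 1: "word_exponent w = 1" using assms(2)[OF word_root_power[OF assms(1)]] .
  show "word_root w = w" unfolding word_root_def 1 by simp
qed

lemma closed_geodesic_word_root:
  assumes "closed_geodesic_word w" shows "closed_geodesic_word (word_root w)"
proof -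
  let ?r = "word_root w" and ?m = "word_exponent w"
  have w: "w \<noteq> []" using assms by (simp add: closed_geodesic_word_def)
  have len: "length w = ?m * length ?r" by (rule length_word_root[OF w])
  have r: "?r \<noteq> []" using len w by auto
  have nth: "w ! i = ?r ! (i mod length ?r)" if "i < length w" for i
    using nth_word_power[of i ?m ?r] that len word_root_power[OF w] by simp
  have "?r ! (Suc i mod length ?r) \<noteq> bar (?r ! i)" if i: "i < length ?r" for i
  proof -
    have "length ?r \<le> length w" unfolding len using word_exponent_pos[OF w] by simp
    hence il: "i < length w" using i by simp
    have "w ! (Suc i mod length w) = ?r ! (Suc i mod length w mod length ?r)" using w by (intro nth) simp
    also have "Suc i mod length w mod length ?r = Suc i mod length ?r" unfolding len by (intro mod_mod_cancel) simp
    finally have "w ! (Suc i mod length w) = ?r ! (Suc i mod length ?r)" .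
    moreover have "w ! i = ?r ! i" using nth[OF il] i by simp
    moreover have "w ! (Suc i mod length w) \<noteq> bar (w ! i)" using assms il unfolding closed_geodesic_word_def by blast
    ultimately show ?thesis by simp
  qed
  thus ?thesis using r by (simp add: closed_geodesic_word_def)
qed

context schottky_word
begin

lemma primitive_card: "primitive_self_intersection g w = card (P // R)"
  by (simp add: primitive_self_intersection_def)

text \<open>The two sides of the last estimate differ by \<open>4 * ?p\<^sup>2\<close>. The square
  of \<open>straight\<close> is kept because an odd length makes \<open>straight\<close> odd, which
  gives the improved odd bound.\<close>

lemma classes_square_bound: "4 * card (P // R) + straight\<^sup>2 \<le> (length w)\<^sup>2"
proof -
  let ?x = "turns GenA GenB" and ?p = "turns GenA InvB" and ?n = straight
  have "4 * card (P // R) + ?n\<^sup>2 \<le> 4 * (?x\<^sup>2 + 2 * ?p * ?x + (?p + ?x) * ?n) + ?n\<^sup>2"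
    using classes_upper by simp
  also have "\<dots> \<le> (?n + 2 * ?p + 2 * ?x)\<^sup>2"
    by (simp add: power2_eq_square algebra_simps)
  finally show ?thesis unfolding length_turns .
qed

end

lemma (in schottky) root_bounds:
  assumes "closed_geodesic_word w"
  defines "r \<equiv> word_root w"
  defines "i \<equiv> primitive_self_intersection g r"
  shows "4 * i \<le> (length r)\<^sup>2" "odd (length r) \<Longrightarrow> 4 * i + 1 \<le> (length r)\<^sup>2" "length r \<le> 2 * i + 2"
proof -
  have w: "w \<noteq> []" using assms by (simp add: closed_geodesic_word_def)
  interpret schottky_word g D r
    using closed_geodesic_word_root[OF assms(1)] word_root_primitive[OF w] unfolding r_def by unfold_locales
  show "4 * i \<le> (length r)\<^sup>2" using classes_square_bound unfolding i_def primitive_card by linarith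
  show "length r \<le> 2 * i + 2" using classes_lower unfolding i_def primitive_card .
  assume "odd (length r)"
  hence "odd straight" unfolding length_turns by simp
  hence "straight > 0" by (rule odd_pos)
  hence "straight\<^sup>2 > 0" by (rule zero_less_power)
  thus "4 * i + 1 \<le> (length r)\<^sup>2" using classes_square_bound unfolding i_def primitive_card by linarith
qed

lemma (in schottky) self_intersection_bounds:
  assumes w: "closed_geodesic_word w"
  shows "4 * self_intersection g w \<le> (length w)\<^sup>2"
    and "odd (length w) \<Longrightarrow> 4 * self_intersection g w + 1 \<le> (length w)\<^sup>2"
    and "non_simple g w \<Longrightarrow> length w \<le> 2 * self_intersection g w + 2"
proof -
  define m r i where "m = word_exponent w" and "r = length (word_root w)" and "i = primitive_self_intersection g (word_root w)"
  have w0: "w \<noteq> []" using w by (simp add: closed_geodesic_word_def)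
  have len: "length w = m * r" using length_word_root[OF w0] by (simp add: m_def r_def)
  have s: "self_intersection g w = m\<^sup>2 * i" by (simp add: self_intersection_def m_def i_def)
  have m: "m > 0" using word_exponent_pos[OF w0] by (simp add: m_def)
  note b = root_bounds[OF w, folded r_def i_def]
  have "m\<^sup>2 * (4 * i) \<le> m\<^sup>2 * r\<^sup>2" using b(1) by (intro mult_left_mono) auto
  thus "4 * self_intersection g w \<le> (length w)\<^sup>2" unfolding s len by (simp add: power_mult_distrib mult_ac)
  show "4 * self_intersection g w + 1 \<le> (length w)\<^sup>2" if "odd (length w)"
  proof -
    have "odd r" using that len by simp
    have "m\<^sup>2 * (4 * i + 1) \<le> m\<^sup>2 * r\<^sup>2" using b(2)[OF \<open>odd r\<close>] by (intro mult_left_mono) auto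
    moreover have "1 \<le> m\<^sup>2" using m by (simp add: Suc_leI)
    ultimately show ?thesis unfolding s len by (simp add: power_mult_distrib algebra_simps)
  qed
  show "length w \<le> 2 * self_intersection g w + 2" if "non_simple g w"
  proof -
    have i: "i \<ge> 1" using that s by (auto simp: non_simple_def Suc_leI)
    obtain k where k: "m = Suc k" using m by (cases m) auto
    obtain j where j: "i = Suc j" using i by (cases i) auto
    have "m * r \<le> m * (2 * i + 2)" using b(3) by (intro mult_left_mono) auto
    \<comment> \<open>The difference is \<open>2 * (m - 1) * (m * i - 1)\<close>, nonnegative
      because \<open>i \<ge> 1\<close>; here non-simplicity enters.\<close>
    also have "\<dots> \<le> 2 * (m\<^sup>2 * i) + 2" unfolding k j by (simp add: power2_eq_square algebra_simps)
    finally show ?thesis unfolding s len .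
  qed
qed

section \<open>The extremal words of odd length\<close>

definition odd_word :: "letter \<Rightarrow> nat \<Rightarrow> letter list" where
  "odd_word x k = GenA # word_power [GenA, x] k"

lemma length_odd_word [simp]: "length (odd_word x k) = 2 * k + 1"
  by (simp add: odd_word_def)

lemma nth_odd_word:
  assumes "0 < i" "i \<le> 2 * k" shows "odd_word x k ! i = (if odd i then GenA else x)"
proof -
  obtain j where j: "i = Suc j" using assms by (cases i) auto
  have "odd_word x k ! i = [GenA, x] ! (j mod 2)" using assms j by (simp add: odd_word_def nth_word_power numeral_2_eq_2)
  moreover have "j mod 2 = (if odd i then 0 else 1)" using j by presburger
  ultimately show ?thesis by simp
qed

lemma nth_odd_word_0: "odd_word x k ! 0 = GenA" by (simp add: odd_word_def)

text \<open>The exponent divides the numbers of both letters, which are \<open>k + 1\<close> and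
  \<open>k\<close>.\<close>

lemma odd_word_primitive:
  assumes "x \<noteq> GenA" "odd_word x k = word_power u m" shows "m = 1"
proof -
  have "count_list (odd_word x k) GenA = k + 1" "count_list (odd_word x k) x = k"
    using assms(1) by (auto simp: odd_word_def count_word_power)
  hence "m dvd k + 1" "m dvd k" unfolding assms(2) count_word_power by (metis dvd_triv_left)+
  hence "m dvd (k + 1) - k" by (rule dvd_diff_nat)
  thus ?thesis by simp
qed

lemma odd_word_closed: assumes "x = GenB \<or> x = InvB" shows "closed_geodesic_word (odd_word x k)"
proof -
  have "odd_word x k ! i \<in> {GenA, x}" if "i < 2 * k + 1" for i
    using nth_odd_word[of i k x] nth_odd_word_0[of x k] that by (cases "i = 0") auto
  hence *: "odd_word x k ! (i mod (2 * k + 1)) \<in> {GenA, x}" for i by simp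
  show ?thesis unfolding closed_geodesic_word_def
  proof (intro conjI allI impI)
    show "odd_word x k \<noteq> []" by (simp add: odd_word_def)
    fix i assume "i < length (odd_word x k)"
    thus "odd_word x k ! (Suc i mod length (odd_word x k)) \<noteq> bar (odd_word x k ! i)"
      using *[of i] *[of "Suc i"] assms by auto
  qed
qed

locale schottky_odd_word = schottky_word g D "odd_word x k" for g D x k +
  assumes x: "x = GenB \<or> x = InvB" and k: "k > 0"
begin

text \<open>Read from index 1 to \<open>L\<close>, with the initial letter moved to the end, the
  word alternates throughout.\<close>

lemma e_odd: assumes "1 \<le> i" "i \<le> 2 * int k + 1" shows "e i = (if odd i then GenA else x)"
proof (cases "i = 2 * int k + 1")
  case True
  hence "i mod L = 0" by (simp add: add.commute)
  thus ?thesis using True by (simp add: e_def nth_odd_word_0)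
next
  case False
  hence "nat (i mod L) = nat i" using assms by simp
  moreover have "odd (nat i) \<longleftrightarrow> odd i" using assms by (simp add: even_nat_iff)
  ultimately show ?thesis unfolding e_def using nth_odd_word[of "nat i" k x] assms False by simp
qed

lemma e_shift: "e (i + L) = e i" by (rule e_periodic(2))

lemma e_cases: "e i = GenA \<or> e i = x"
proof -
  have "e (1 + (i - 1) mod L) = e i" using e_mod_add(1)[of "i - 1" 1] by (simp add: add.commute)
  moreover have "1 \<le> 1 + (i - 1) mod L" "1 + (i - 1) mod L \<le> 2 * int k + 1"
    using L_pos pos_mod_bound[of L "i - 1"] by (simp_all del: pos_mod_bound)
  ultimately show ?thesis using e_odd by metis
qed

lemma sd_cases: "sd (i, True) = GenA \<or> sd (i, True) = x" "sd (i, False) = InvA \<or> sd (i, False) = bar x"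
  using e_cases[of i] e_cases[of "i - 1"] by (auto simp: sd_def ray_def)

lemma turns_x: "turns GenA x = 0"
proof -
  have "{u \<in> E. sd u = GenA \<and> sd (opp u) = x} = {}"
    using sd_cases x by (auto simp: opp_def) (metis (full_types) bar.simps letter.distinct)+
  thus ?thesis by (simp only: turns_def card.empty)
qed

text \<open>The cyclic word repeats a letter only once, namely \<open>GenA\<close> at indices 0 and
  1.\<close>

lemma straight_1: "straight = 1"
proof -
  have r: "1 \<le> i \<or> i = 0" "i \<le> 2 * int k" if "(i, b) \<in> E" for i b using that by (auto simp: E_def)
  have e0: "e 0 = GenA" "e (-1) = x" using e_odd[of L] e_odd[of "2 * int k"] e_shift[of 0] e_shift[of "-1"] k by simp_all
  have "u \<in> {u \<in> E. sd u = GenA \<and> sd (opp u) = InvA} \<longleftrightarrow> u = (1, True)" for u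
  proof
    assume u: "u \<in> {u \<in> E. sd u = GenA \<and> sd (opp u) = InvA}"
    obtain i b where ib: "u = (i, b)" by (cases u)
    have b: b using u sd_cases(2)[of i] x ib by (cases b) auto
    have ee: "e i = GenA" "e (i - 1) = GenA" using u ib b by (auto simp: sd_def ray_def opp_def) (metis bar.simps(1) bar_bar)
    have "i \<noteq> 0" using e0 ee x by auto
    hence i: "1 \<le> i" "i \<le> 2 * int k" using r[of i b] u ib by auto
    hence "odd i" using e_odd[of i] ee x by (auto split: if_splits)
    hence "i - 1 < 1" using e_odd[of "i - 1"] ee x i by (cases "i - 1 < 1") (auto split: if_splits)
    thus "u = (1, True)" using i ib b by simp
  next
    assume "u = (1, True)"
    thus "u \<in> {u \<in> E. sd u = GenA \<and> sd (opp u) = InvA}" using e0 e_odd[of 1] k by (simp add: E_def sd_def ray_def opp_def)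
  qed
  hence "{u \<in> E. sd u = GenA \<and> sd (opp u) = InvA} = {(1, True)}" by blast
  hence 1: "turns GenA InvA = 1" by (simp add: turns_def)
  have nox: "\<not> (e i = x \<and> e (i - 1) = x)" if "(i, b) \<in> E" for i b
  proof
    assume ee: "e i = x \<and> e (i - 1) = x"
    have "i \<noteq> 0" using e0 ee x by auto
    hence i: "1 \<le> i" "i \<le> 2 * int k" using r[OF that] by auto
    hence "even i" using e_odd[of i] ee x by (auto split: if_splits)
    thus False using e_odd[of "i - 1"] ee x i by (cases "i = 1") (auto split: if_splits)
  qed
  have "{u \<in> E. sd u = GenB \<and> sd (opp u) = InvB} = {}"
  proof -
    have "\<not> (sd (i, b) = GenB \<and> sd (opp (i, b)) = InvB)" if ib: "(i, b) \<in> E" for i b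
      using nox[OF ib] e_cases[of i] e_cases[of "i - 1"] x by (cases b) (auto simp: sd_def ray_def opp_def)
    thus ?thesis by auto
  qed
  hence "turns GenB InvB = 0" by (simp only: turns_def card.empty)
  thus ?thesis using 1 by simp
qed

end

section \<open>Extremal words\<close>

lemma code_less_at:
  assumes "reduced f" "reduced h" "\<And>i. i \<le> n \<Longrightarrow> f i = h i" "f (Suc n) \<noteq> h (Suc n)"
  shows "code f < code h \<longleftrightarrow> rank (f n) (f (Suc n)) < rank (f n) (h (Suc n))"
  using assms
proof (induction n arbitrary: f h)
  case 0 thus ?case using code_less_digit[of f h] by simp
next
  case (Suc n)
  have "code f < code h \<longleftrightarrow> code (tl_ray f) < code (tl_ray h)"
    using code_less_tl[of f h] Suc.prems(3)[of 0] Suc.prems(3)[of 1] by auto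
  also have "\<dots> \<longleftrightarrow> rank (tl_ray f n) (tl_ray f (Suc n)) < rank (tl_ray f n) (tl_ray h (Suc n))"
    using Suc.prems by (intro Suc.IH reduced_tl) (simp_all add: tl_ray_def)
  finally show ?case by (simp add: tl_ray_def)
qed

lemma (in schottky_word) diagonal_crossing: assumes "(u, v) \<in> diagonal_pairs" shows "crossing u v"
proof -
  have uv: "u \<in> E" "v \<in> E" "sd u = GenA" "sd (opp u) = GenB" "sd v = InvB" "sd (opp v) = InvA"
    using assms by (auto simp: diagonal_pairs_def)
  have "meets u v" using uv by (subst meets_letters) (simp_all add: ccw_def)
  moreover have "v \<noteq> u" "v \<noteq> opp u" using uv by auto
  ultimately show ?thesis using uv by (simp add: crossing_def)
qed

context schottky_odd_word
begin

lemma fin_classes: "finite (P // R)"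
  using finite_P by (rule finite_quotient) (auto simp: pair_equiv_def)

text \<open>Without diagonals and with one straight lift the upper estimate becomes
  \<open>k\<close>, and the general lower bound for the odd length \<open>2 * k + 1\<close> is
  \<open>k\<close> as well.\<close>

lemma card_lower_example:
  assumes "x = GenB" shows "card (P // R) = k"
proof -
  have 0: "turns GenA GenB = 0" using turns_x assms by simp
  hence "turns GenA InvB = k" using length_turns straight_1 by simp
  hence "card (P // R) \<le> k" using classes_upper straight_1 0 by simp
  moreover have "2 * k + 1 \<le> 2 * card (P // R) + 2" using classes_lower by simp
  ultimately show ?thesis by simp
qed

text \<open>The word is \<open>a\<close> followed by \<open>k\<close> copies of \<open>a x\<close>, and the lift 1 is the only one that comes from
  \<open>InvA\<close> and goes to \<open>GenA\<close>.\<close>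

definition double_pairs :: "(state \<times> state) set" where
  "double_pairs = {(u, v) \<in> E \<times> E. u = (1, True) \<and> (sd v = GenA \<and> sd (opp v) = GenB)}"

lemma e_01: "e 0 = GenA" "e 1 = GenA"
  using e_odd[of L] e_odd[of 1] e_shift[of 0] k by simp_all

lemma sd_1: "sd (1, True) = GenA" "sd (opp (1, True)) = InvA"
  using e_01 by (simp_all add: sd_def ray_def opp_def)

lemma double_crossing:
  assumes xB: "x = InvB" and "(u, v) \<in> double_pairs" shows "crossing u v"
proof -
  have uv: "u \<in> E" "v \<in> E" "u = (1, True)" "sd v = GenA" "sd (opp v) = GenB"
    using assms(2) by (auto simp: double_pairs_def)
  obtain i b where ib: "v = (i, b)" by (cases v)
  have b: b using uv(4) sd_cases(2)[of i] xB ib by (cases b) auto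
  have i: "0 \<le> i" "i \<le> 2 * int k" using uv(2) ib by (auto simp: E_def)
  have ei: "e i = GenA" "e (i - 1) = InvB"
  proof -
    show "e i = GenA" using uv(4) ib b by (simp add: sd_def ray_def)
    have "bar (e (i - 1)) = GenB" using uv(5) ib b by (simp add: sd_def ray_def opp_def)
    thus "e (i - 1) = InvB" by (metis bar.simps(3) bar_bar)
  qed
  \<comment> \<open>The representative of \<open>i\<close> in the range from 1 to \<open>L\<close>,
    where \<open>e_odd\<close> applies.\<close>
  define J where "J = (if i = 0 then L else i)"
  have eJ: "e (J + t) = e (i + t)" for t using e_shift[of t] by (simp add: J_def add.commute)
  have J: "1 \<le> J" "J \<le> 2 * int k + 1" using i by (auto simp: J_def)
  have "J \<noteq> 1"
  proof
    assume J1: "J = 1"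
    have "i = 1" using J1 k by (auto simp: J_def split: if_splits)
    thus False using ei(2) e_01 by simp
  qed
  have "odd J" using e_odd[OF J] eJ[of 0] ei(1) xB by (auto split: if_splits)
  then obtain m' where m': "J = 2 * m' + 1" by (metis oddE)
  \<comment> \<open>\<open>J + n = L\<close>: both rays alternate up to index \<open>n\<close>. Then
    \<open>v\<close> runs into the repeated \<open>GenA\<close>, while \<open>u\<close> continues
    with \<open>InvB\<close>.\<close>
  define m n where "m = nat m'" and "n = 2 * (k - m)"
  have m: "J = 2 * int m + 1" "1 \<le> m" "m \<le> k" using m' J \<open>J \<noteq> 1\<close> by (auto simp: m_def)
  have n: "int n = 2 * int k - 2 * int m" using m by (simp add: n_def of_nat_diff)
  have ru: "ray u t = e (1 + int t)" "ray v t = e (J + int t)" for t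
    using uv(3) ib b eJ by (simp_all add: ray_def)
  have agree: "ray u t = ray v t" if "t \<le> n" for t
  proof -
    have "int t \<le> 2 * int k - 2 * int m" using that n by linarith
    thus ?thesis unfolding ru using m by (subst (1 2) e_odd) auto
  qed
  have last: "ray u n = GenA" unfolding ru using n m by (subst e_odd) auto
  have next_u: "ray u (Suc n) = InvB" unfolding ru using n m xB by (subst e_odd) auto
  have "J + int (Suc n) = 1 + L" using n m by simp
  hence next_v: "ray v (Suc n) = GenA" unfolding ru using e_shift[of 1] e_01 by (simp only:)
  have "code (ray u) < code (ray v) \<longleftrightarrow> rank (ray u n) (ray u (Suc n)) < rank (ray u n) (ray v (Suc n))"
    using agree next_u next_v by (intro code_less_at ray_reduced) auto
  hence 1: "\<not> cd u < cd v" unfolding cd_def last next_u next_v by (simp add: rank_def)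
  have "cd (tau u) < cd (tau v) \<longleftrightarrow> rank InvA InvA < rank InvA GenB"
    unfolding cd_def using uv sd_1 ray_tau_Suc[of u 0] ray_tau_Suc[of v 0]
    by (subst code_less_digit[OF ray_reduced ray_reduced]) (auto simp: ray_tau_0 sd_def)
  hence 2: "\<not> cd (tau u) < cd (tau v)" by (simp add: rank_def)
  have ne: "u \<noteq> v" "v \<noteq> opp u" using next_u next_v uv(4) sd_1(2) uv(3) by auto
  have "meets u v" using meets_shared[OF uv(1,2) _ ne(1)] uv(3,4) sd_1 1 2 by simp
  thus ?thesis using uv ne by (simp add: crossing_def)
qed

text \<open>The \<open>k\<^sup>2\<close> diagonal and \<open>k\<close> double pairs lie in different
  classes. The only side shared inside such a pair is \<open>GenA\<close>, which all lifts traverse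
  forwards; a second pair further along the chain would have to share a side viewed
  backwards.\<close>

lemma card_upper_example:
  assumes xB: "x = InvB" shows "k\<^sup>2 + k \<le> card (P // R)"
proof -
  have "turns GenA InvB = 0" using turns_x xB by simp
  hence tk: "turns GenA GenB = k" using length_turns straight_1 by simp
  have "(1, True) \<in> E" using k by (simp add: E_def)
  hence "double_pairs = {(1, True)} \<times> {u \<in> E. sd u = GenA \<and> sd (opp u) = GenB}"
    by (auto simp: double_pairs_def)
  hence c2: "card double_pairs = k" using tk by (simp only: card_cartesian_product turns_def) simp
  have disj: "diagonal_pairs \<inter> double_pairs = {}" by (auto simp: diagonal_pairs_def double_pairs_def)
  have fin: "finite double_pairs" unfolding double_pairs_def using finite_E by (auto intro: finite_subset[of _ "E \<times> E"])
  let ?S = "diagonal_pairs \<union> double_pairs"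
  have cS: "card ?S = k\<^sup>2 + k"
    using card_Un_disjoint[OF finite_flags(2) fin disj] card_diagonal_pairs tk c2 by simp
  have forward: "snd v" if "sd v = GenA" for v
    using that sd_cases(2)[of "fst v"] xB by (cases v; cases "snd v") auto
  have cr: "crossing u v" if "(u, v) \<in> ?S" for u v
    using that diagonal_crossing double_crossing[OF xB] by blast
  have letters: "(sd u = GenA \<and> sd (opp u) = GenB \<and> sd v = InvB \<and> sd (opp v) = InvA)
     \<or> (u = (1, True) \<and> sd u = GenA \<and> sd (opp u) = InvA \<and> sd v = GenA \<and> sd (opp v) = GenB)" "u \<in> E" "v \<in> E" if "(u, v) \<in> ?S" for u v
    using that sd_1 by (auto simp: diagonal_pairs_def double_pairs_def)
  have inj: "u = u' \<and> v = v'" if s: "(u, v) \<in> ?S" "(u', v') \<in> ?S" and cl: "cl u v = cl u' v'" for u v u' v'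
  proof -
    note l = letters[OF s(1)] letters[OF s(2)]
    from class_eq_shared[OF cr[OF s(1)] cr[OF s(2)] cl] show ?thesis
    proof (elim disjE bexE conjE)
      assume "pr u v = pr u' v'"
      hence "(u' = u \<or> u' = opp u) \<and> (v' = v \<or> v' = opp v) \<or> (u' = v \<or> u' = opp v) \<and> (v' = u \<or> v' = opp u)"
        using pr_eq_iff l by blast
      thus ?thesis using l(1,4) by (elim disjE conjE) simp_all
    next
      fix a b a' b'
      assume ab: "a \<in> {u, opp u}" "b \<in> {v, opp v}" "sd a = sd b" "a' \<in> E" "b' \<in> E" "sd a' = sd b'"
        "snd a' \<noteq> snd a" "snd b' \<noteq> snd b" "pr a' b' = pr u' v'"
      have "sd a = GenA" using ab(1-3) l(1) by (elim disjE conjE insertE emptyE) simp_all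
      hence a_back: "\<not> snd a'" using forward[of a] ab(7) by simp
      have "(u' = a' \<or> u' = opp a') \<and> (v' = b' \<or> v' = opp b') \<or> (u' = b' \<or> u' = opp b') \<and> (v' = a' \<or> v' = opp a')"
        using pr_eq_iff[OF ab(4,5) l(5,6)] ab(9) by blast
      moreover have "sd a' \<noteq> GenA" "sd b' \<noteq> GenA" using a_back forward[of a'] ab(6) by auto
      ultimately show ?thesis using l(4) ab(6) by (elim disjE conjE) simp_all
    qed
  qed
  have "card ?S \<le> card (P // R)"
  proof (rule card_inj_on_le[where f="\<lambda>(u, v). cl u v"])
    show "inj_on (\<lambda>(u, v). cl u v) ?S" by (rule inj_onI) (use inj in \<open>auto split: prod.splits\<close>)
    show "(\<lambda>(u, v). cl u v) ` ?S \<subseteq> P // R"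
    proof
      fix q assume "q \<in> (\<lambda>(u, v). cl u v) ` ?S"
      then obtain u v where uv: "(u, v) \<in> ?S" "q = cl u v" by auto
      show "q \<in> P // R" using quotientI[OF pr_in_P[OF cr[OF uv(1)]], of R] uv(2) by (simp add: cl_def)
    qed
  qed (rule fin_classes)
  thus ?thesis using cS by simp
qed

end

context schottky
begin

lemma self_intersection_odd_word:
  assumes "x = GenB \<or> x = InvB" "k > 0"
  shows "x = GenB \<Longrightarrow> self_intersection g (odd_word x k) = k"
    and "x = InvB \<Longrightarrow> k\<^sup>2 + k \<le> self_intersection g (odd_word x k)"
proof -
  have xA: "x \<noteq> GenA" using assms(1) by auto
  interpret schottky_odd_word g D x k
    using odd_word_closed[OF assms(1)] odd_word_primitive[OF xA] assms by unfold_locales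
  have "odd_word x k \<noteq> []" by (simp add: odd_word_def)
  from word_exponent_primitive[OF this odd_word_primitive[OF xA]]
  have "self_intersection g (odd_word x k) = card (P // R)"
    unfolding self_intersection_def by (simp add: primitive_card)
  thus "x = GenB \<Longrightarrow> self_intersection g (odd_word x k) = k"
    "x = InvB \<Longrightarrow> k\<^sup>2 + k \<le> self_intersection g (odd_word x k)"
    using card_lower_example card_upper_example by simp_all
qed

lemma self_intersection_square: "self_intersection g [GenA, GenA] = 0"
proof -
  have p: "[GenA, GenA] = word_power [GenA] 2" by (simp add: word_power_def numeral_2_eq_2)
  have "2 \<le> word_exponent [GenA, GenA]" by (rule word_exponent_ge[OF _ p]) simp
  moreover have "length [GenA, GenA] = word_exponent [GenA, GenA] * length (word_root [GenA, GenA])"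
    by (rule length_word_root) simp
  ultimately have "length (word_root [GenA, GenA]) \<le> 1"
    by (cases "length (word_root [GenA, GenA])") (auto simp: numeral_2_eq_2)
  hence "intersecting_pairs g (word_root [GenA, GenA]) = {}"
    unfolding intersecting_pairs_def by auto
  thus ?thesis by (simp add: self_intersection_def primitive_self_intersection_def)
qed

text \<open>The root has one class: its two lifts are crossing diagonals, and the general bound for
  length 2 allows no more. Counting \<open>GenA\<close> shows that the exponent of the power is
  exactly \<open>m\<close>.\<close>

lemma self_intersection_figure_eight_power:
  assumes m: "m > 0" shows "self_intersection g (word_power [GenA, InvB] m) = m\<^sup>2"
proof -
  let ?w = "word_power [GenA, InvB] m" and ?r = "[GenA, InvB]"
  have w: "?w \<noteq> []" using m by (cases m) (simp_all add: word_power_Suc)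
  have cg: "closed_geodesic_word ?r" by (auto simp: closed_geodesic_word_def less_Suc_eq)
  have prim: "n = 1" if "?r = word_power u n" for u n
  proof -
    have "count_list ?r GenA = n * count_list u GenA" unfolding that count_word_power ..
    thus ?thesis by simp
  qed
  have "word_exponent ?w dvd m"
  proof -
    have "count_list ?w GenA = word_exponent ?w * count_list (word_root ?w) GenA"
      using word_root_power[OF w] count_word_power by metis
    hence "m = word_exponent ?w * count_list (word_root ?w) GenA" unfolding count_word_power by simp
    thus ?thesis by (rule dvdI)
  qed
  moreover have "m \<le> word_exponent ?w" by (rule word_exponent_ge[OF w refl])
  ultimately have ex: "word_exponent ?w = m" using m by (metis dvd_imp_le le_antisym)
  have "length ?w div m = 2" using m by simp
  hence root: "word_root ?w = ?r" unfolding word_root_def ex using m by (cases m) (simp_all add: word_power_Suc numeral_2_eq_2)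
  interpret schottky_word g D ?r using cg prim by unfold_locales
  have "(0, True) \<in> E" "(1, True) \<in> E" by (simp_all add: E_def)
  moreover have "sd (0, True) = GenA" "sd (opp (0, True)) = GenB" "sd (1, True) = InvB" "sd (opp (1, True)) = InvA"
    by (simp_all add: sd_def ray_def opp_def e_def)
  ultimately have "((0, True), (1, True)) \<in> diagonal_pairs" by (simp add: diagonal_pairs_def)
  hence "pr (0, True) (1, True) \<in> P" by (intro pr_in_P diagonal_crossing)
  hence "P // R \<noteq> {}" unfolding quotient_def by blast
  hence "card (P // R) \<ge> 1"
    using finite_quotient[OF finite_P, of R] by (simp add: Suc_le_eq card_gt_0_iff pair_equiv_def) blast
  moreover have "4 * card (P // R) \<le> 4" using classes_square_bound by (simp add: power2_eq_square)
  ultimately have "primitive_self_intersection g ?r = 1" unfolding primitive_card by simp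
  thus ?thesis by (simp add: self_intersection_def ex root)
qed

end

theorem theorem1p2:
  fixes g :: "letter \<Rightarrow> complex \<Rightarrow> complex" and D :: "letter \<Rightarrow> complex set"
  assumes "schottky_pants g D"
  shows "(\<forall>w. closed_geodesic_word w \<and> non_simple g w \<longrightarrow>
            (even (length w) \<longrightarrow>
               real (length w) / 2 - 1 \<le> real (self_intersection g w) \<and>
               real (self_intersection g w) \<le> (real (length w))\<^sup>2 / 4) \<and>
            (odd (length w) \<longrightarrow>
               (real (length w) - 1) / 2 \<le> real (self_intersection g w) \<and>
               real (self_intersection g w) \<le> ((real (length w))\<^sup>2 - 1) / 4)) \<and>
         (\<exists>w. closed_geodesic_word w \<and> even (length w) \<and>
            real (self_intersection g w) = real (length w) / 2 - 1) \<and>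
         (\<forall>L\<ge>2. even L \<longrightarrow>
            (\<exists>w. closed_geodesic_word w \<and> non_simple g w \<and> length w = L \<and>
               real (self_intersection g w) = (real L)\<^sup>2 / 4)) \<and>
         (\<forall>L\<ge>3. odd L \<longrightarrow>
            (\<exists>w. closed_geodesic_word w \<and> non_simple g w \<and> length w = L \<and>
               real (self_intersection g w) = (real L - 1) / 2) \<and>
            (\<exists>w. closed_geodesic_word w \<and> non_simple g w \<and> length w = L \<and>
               real (self_intersection g w) = ((real L)\<^sup>2 - 1) / 4))"
proof (intro conjI allI impI)
  interpret schottky g D using assms by unfold_locales
  {
    fix w assume w: "closed_geodesic_word w \<and> non_simple g w"
    have up: "real (4 * self_intersection g w) \<le> real ((length w)\<^sup>2)"
      using self_intersection_bounds(1) w by (simp only: of_nat_le_iff)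
    have low: "length w \<le> 2 * self_intersection g w + 2" using self_intersection_bounds(3) w by blast
    show "real (length w) / 2 - 1 \<le> real (self_intersection g w)" using low by linarith
    show "real (self_intersection g w) \<le> (real (length w))\<^sup>2 / 4" using up by simp
    assume o: "odd (length w)"
    \<comment> \<open>Parity excludes equality in the bound for even lengths.\<close>
    have "length w \<le> 2 * self_intersection g w + 1" using low o by presburger
    hence "real (length w) \<le> 2 * real (self_intersection g w) + 1" by linarith
    thus "(real (length w) - 1) / 2 \<le> real (self_intersection g w)" by simp
    have "real (4 * self_intersection g w + 1) \<le> real ((length w)\<^sup>2)"
      using self_intersection_bounds(2)[OF conjunct1[OF w] o] by (simp only: of_nat_le_iff)
    thus "real (self_intersection g w) \<le> ((real (length w))\<^sup>2 - 1) / 4" by simp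
  next
    \<comment> \<open>At length 2 the lower bound is 0, the value for the double of a simple
      geodesic.\<close>
    have "closed_geodesic_word [GenA, GenA]" by (auto simp: closed_geodesic_word_def less_Suc_eq)
    thus "\<exists>w. closed_geodesic_word w \<and> even (length w) \<and> real (self_intersection g w) = real (length w) / 2 - 1"
      using self_intersection_square by (intro exI[of _ "[GenA, GenA]"]) simp
  next
    fix L :: nat assume L: "2 \<le> L" "even L"
    then obtain m where m: "L = 2 * m" "m > 0" by auto
    let ?w = "word_power [GenA, InvB] m"
    have s: "self_intersection g ?w = m\<^sup>2" by (rule self_intersection_figure_eight_power[OF m(2)])
    have "closed_geodesic_word ?w"
      unfolding closed_geodesic_word_def
    proof (intro conjI allI impI)
      show "?w \<noteq> []" using m(2) by (cases m) (simp_all add: word_power_Suc)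
      fix i assume i: "i < length ?w"
      have "?w ! j \<in> {GenA, InvB}" if "j < length ?w" for j
      proof -
        have "j mod 2 = 0 \<or> j mod 2 = 1" by linarith
        thus ?thesis using that nth_word_power[of j m "[GenA, InvB]"] by (auto simp: numeral_2_eq_2)
      qed
      from this[of i] this[of "Suc i mod length ?w"] show "?w ! (Suc i mod length ?w) \<noteq> bar (?w ! i)" using i by fastforce
    qed
    moreover have "non_simple g ?w" using s m(2) by (simp add: non_simple_def)
    moreover have "length ?w = L" using m by simp
    moreover have "real (self_intersection g ?w) = (real L)\<^sup>2 / 4" unfolding s m by (simp add: power_mult_distrib)
    ultimately show "\<exists>w. closed_geodesic_word w \<and> non_simple g w \<and> length w = L \<and> real (self_intersection g w) = (real L)\<^sup>2 / 4"
      by blast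
  next
    fix L :: nat assume L: "3 \<le> L" "odd L"
    then obtain k where k: "L = 2 * k + 1" by (metis oddE)
    have k0: "k > 0" using L k by simp
    have s: "self_intersection g (odd_word GenB k) = k" using self_intersection_odd_word(1)[of GenB k] k0 by simp
    show "\<exists>w. closed_geodesic_word w \<and> non_simple g w \<and> length w = L \<and> real (self_intersection g w) = (real L - 1) / 2"
      using odd_word_closed[of GenB k] s k k0 by (intro exI[of _ "odd_word GenB k"]) (simp add: non_simple_def)
    have cl: "closed_geodesic_word (odd_word InvB k)" by (rule odd_word_closed) simp
    have "4 * self_intersection g (odd_word InvB k) + 1 \<le> (2 * k + 1)\<^sup>2"
      using self_intersection_bounds(2)[OF cl] by simp
    moreover have "k\<^sup>2 + k \<le> self_intersection g (odd_word InvB k)" using self_intersection_odd_word(2)[of InvB k] k0 by simp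
    ultimately have s': "self_intersection g (odd_word InvB k) = k\<^sup>2 + k" by (simp add: power2_eq_square)
    show "\<exists>w. closed_geodesic_word w \<and> non_simple g w \<and> length w = L \<and> real (self_intersection g w) = ((real L)\<^sup>2 - 1) / 4"
      using cl s' k k0 by (intro exI[of _ "odd_word InvB k"]) (simp add: non_simple_def power2_eq_square field_simps)
  }
qed

end
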